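(* Let $n\geq 1$ be an integer. Up to isomorphism, the tournaments of the class $\mathcal{T}_{\delta}^{4n+2}$ (the $(4n+2)$-vertex tournaments $T$ with $\delta(T)=\delta(4n+2)$) are exactly the tournaments with one of the following forms, where $T_k$ denotes an arbitrary $k$-vertex tournament: (F4) $T_{2n+1}.\underline{2}$; (F5) $C_{3}(\underline{1},\underline{1},T_{2n}.\underline{2})$; (F6) $\underline{2}(\underline{1}, T_{2n+1}(\underline{1},\underline{2},\ldots,\underline{2}))$ or its dual; (F7) $\underline{2}(\underline{1}, T_{2n}(C_{3},\underline{2},\ldots,\underline{2}))$ or its dual; (F8) $\underline{3}(\underline{1}, T_{2n+1}(\underline{1},\underline{1},\underline{2},\ldots,\underline{2}),\underline{1})$; (F9) $\underline{3}(\underline{1}, T_{2n}(C_{3},\underline{1},\underline{2},\ldots,\underline{2}),\underline{1})$; (F10) $\underline{3}(\underline{1},T_{2n-1}(C_{3},C_{3},\underline{2},\ldots,\underline{2}),\underline{1})$, when $n \geq 2$.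
   Context: A tournament $T$ consists of a finite vertex set $V(T)$ and a set $A(T)$ of ordered pairs of distinct vertices (arcs) such that for all $x\neq y\in V(T)$, $(x,y)\in A(T)$ if and only if $(y,x)\notin A(T)$; $v(T)=|V(T)|$. The dual $T^{\star}$ of $T$ is obtained by reversing all arcs. A module of $T$ is a subset $M\subseteq V(T)$ such that for all $x,y\in M$ and $v\in V(T)\setminus M$, $(v,x)\in A(T)$ if and only if $(v,y)\in A(T)$. The trivial modules are $\emptyset$, the singletons and $V(T)$. $T$ is indecomposable if all its modules are trivial, and decomposable otherwise. For $B\subseteq A(T)$, ${\rm Inv}(T,B)$ is the tournament obtained from $T$ by reversing all arcs of $B$. For a tournament $T$ with $v(T)\ge 5$, the decomposability index $\delta(T)$ is the smallest integer $m$ for which there is $B\subseteq A(T)$ with $|B|=m$ and ${\rm Inv}(T,B)$ indecomposable (it is well-defined since for every $n\geq 5$ there exist indecomposable $n$-vertex tournaments). For an integer $m\ge 5$, $\delta(m)$ is the maximum of $\delta(T)$ over the $m$-vertex tournaments $T$, and $\mathcal{T}_{\delta}^{m}$ is the class of $m$-vertex tournaments $T$ with $\delta(T)=\delta(m)$ (tournaments with $\delta$-maximal decomposability). For $k\geq 1$, $\underline{k}$ is the transitive tournament on $\{0,\ldots,k-1\}$ whose arcs are the pairs $(i,j)$ with $0\le i<j\le k-1$. $C_3=(\{0,1,2\},\{(0,1),(1,2),(2,0)\})$. Given a tournament $T$ with $V(T)=\{0,\ldots,k-1\}$ and tournaments $H_0,\ldots,H_{k-1}$ (replaced by isomorphic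 copies on pairwise disjoint vertex sets if necessary), the lexicographic sum $T(H_0,\ldots,H_{k-1})$ is the tournament on $\bigcup_i V(H_i)$ in which, for $x\in V(H_i)$ and $y\in V(H_j)$, $(x,y)$ is an arc if either $i=j$ and $(x,y)\in A(H_i)$, or $i\ne j$ and $(i,j)\in A(T)$. When all $H_i$ are isomorphic to one tournament $H$, this sum is denoted $T.H$. Arbitrary tournaments $T_k$ are taken on the vertex set $\{0,\ldots,k-1\}$; in $T_k(X_1,\ldots,X_r,\underline{2},\ldots,\underline{2})$ there are $k$ entries in total, all those after the first $r$ displayed ones being $\underline{2}$ (possibly none). *)

theory Defs
  imports
    "Graph_Theory.Pair_Digraph"
    "Graph_Theory.Digraph_Isomorphism"
    "HOL-Library.Nat_Bijection"
begin

locale tournament = pair_digraph G for G :: "'a pair_pre_digraph" +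
  assumes arc_iff_not_converse:
    "x \<in> pverts G \<Longrightarrow> y \<in> pverts G \<Longrightarrow> x \<noteq> y \<Longrightarrow> (x, y) \<in> parcs G \<longleftrightarrow> (y, x) \<notin> parcs G"

abbreviation isomorphic ::
    "'a pair_pre_digraph \<Rightarrow> 'b pair_pre_digraph \<Rightarrow> bool"  (infix "\<simeq>" 50) where
  "G \<simeq> H \<equiv> digraph_iso (with_proj G) (with_proj H)"

definition dual :: "'a pair_pre_digraph \<Rightarrow> 'a pair_pre_digraph" where
  "dual T = \<lparr> pverts = pverts T, parcs = (parcs T)\<inverse> \<rparr>"

definition is_module :: "'a pair_pre_digraph \<Rightarrow> 'a set \<Rightarrow> bool" where
  "is_module T M \<longleftrightarrow> M \<subseteq> pverts T \<and>
     (\<forall>x\<in>M. \<forall>y\<in>M. \<forall>v\<in>pverts T - M. (v, x) \<in> parcs T \<longleftrightarrow> (v, y) \<in> parcs T)"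

definition indecomposable :: "'a pair_pre_digraph \<Rightarrow> bool" where
  "indecomposable T \<longleftrightarrow>
     (\<forall>M. is_module T M \<longrightarrow> M = {} \<or> (\<exists>x\<in>pverts T. M = {x}) \<or> M = pverts T)"

definition Inv :: "'a pair_pre_digraph \<Rightarrow> ('a \<times> 'a) set \<Rightarrow> 'a pair_pre_digraph" where
  "Inv T B = \<lparr> pverts = pverts T, parcs = (parcs T - B) \<union> B\<inverse> \<rparr>"

text \<open>Meaningful for tournaments with at least 5 vertices; otherwise the set of candidates
  may be empty.\<close>

definition decomposability_index :: "'a pair_pre_digraph \<Rightarrow> nat" where
  "decomposability_index T = (LEAST m. \<exists>B\<subseteq>parcs T. card B = m \<and> indecomposable (Inv T B))"

text \<open>Every finite tournament is isomorphic to one with vertices in \<^typ>\<open>nat\<close>, so the maximum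
  may be taken over these; for m at least 5 its range is a finite nonempty set of numbers.\<close>

definition max_decomposability_index :: "nat \<Rightarrow> nat" where
  "max_decomposability_index m =
     Max {decomposability_index T | T :: nat pair_pre_digraph. tournament T \<and> card (pverts T) = m}"

definition delta_maximal :: "nat \<Rightarrow> 'a pair_pre_digraph set" where
  "delta_maximal m = {T. tournament T \<and> card (pverts T) = m \<and>
     decomposability_index T = max_decomposability_index m}"

definition transitive_tournament :: "nat \<Rightarrow> nat pair_pre_digraph" where
  "transitive_tournament k = \<lparr> pverts = {..<k}, parcs = {(i, j). i < j \<and> j < k} \<rparr>"

abbreviation one :: "nat pair_pre_digraph" where "one \<equiv> transitive_tournament 1"
abbreviation two :: "nat pair_pre_digraph" where "two \<equiv> transitive_tournament 2"
abbreviation three :: "nat pair_pre_digraph" where "three \<equiv> transitive_tournament 3"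

definition C3 :: "nat pair_pre_digraph" where
  "C3 = \<lparr> pverts = {0, 1, 2}, parcs = {(0, 1), (1, 2), (2, 0)} \<rparr>"

definition tournament_on :: "nat \<Rightarrow> nat pair_pre_digraph \<Rightarrow> bool" where
  "tournament_on k T \<longleftrightarrow> tournament T \<and> pverts T = {..<k}"

text \<open>The summands \<open>Hs ! i\<close> are made disjoint by renaming the vertex \<open>x\<close> of the i-th summand to
  the code of \<open>(i, x)\<close>. The tournament \<open>T\<close> is meant to have vertex set \<open>{..<length Hs}\<close>.\<close>

definition lex_sum ::
    "nat pair_pre_digraph \<Rightarrow> nat pair_pre_digraph list \<Rightarrow> nat pair_pre_digraph" where
  "lex_sum T Hs =
     \<lparr> pverts = {prod_encode (i, x) | i x. i < length Hs \<and> x \<in> pverts (Hs ! i)},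
       parcs = {(prod_encode (i, x), prod_encode (j, y)) | i x j y.
         i < length Hs \<and> x \<in> pverts (Hs ! i) \<and> j < length Hs \<and> y \<in> pverts (Hs ! j) \<and>
         (i = j \<and> (x, y) \<in> parcs (Hs ! i) \<or> i \<noteq> j \<and> (i, j) \<in> parcs T)} \<rparr>"

end

theory Submission
  imports Defs
begin

text \<open>A comodule is a set \<open>Q\<close> such that \<open>Q\<close> or its complement is a nontrivial module. If reversing
  the arcs of \<open>B\<close> makes \<open>T\<close> indecomposable, then some arc of \<open>B\<close> joins each comodule to its complement;
  hence \<open>d\<close> pairwise disjoint comodules force \<open>2 * card B \<ge> d\<close>.

  Conversely, distinct minimal comodules are disjoint, except that 2-element modules may form paths.
  So if \<open>d\<close> is the maximal number of disjoint comodules, some \<open>d\<close> vertices hit all comodules. For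
  well chosen \<open>x\<close> and \<open>y\<close> among them the reversal of the arc between \<open>x\<close> and \<open>y\<close> creates no module
  separating \<open>x\<close> from \<open>y\<close>, and the other \<open>d - 2\<close> vertices hit all comodules of the new tournament
  (\<open>d - 1\<close> vertices if \<open>d = 3\<close>). By induction \<open>(d + 1) div 2\<close> reversals suffice.

  At most two minimal comodules are singletons, namely a source and a sink. With \<open>4 * n + 2\<close> vertices
  this gives \<open>d \<le> 2 * n + 2\<close>, the maximal index is \<open>n + 1\<close>, and it is attained if and only if
  \<open>d \<ge> 2 * n + 1\<close>. Then at most two vertices are in excess of those in disjoint pairs, which leaves
  the listed forms.\<close>

section \<open>Modules and comodules\<close>

text \<open>A safe reversal creates no comodules: those of the new tournament are among the old ones
  and do not separate \<open>x\<close> from \<open>y\<close>. So both vertices may be dropped from a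
  hitting set unless some comodule meets it exactly in \<open>x\<close> and \<open>y\<close>. This
  is the obstacle in every step. With \<open>d = 2\<close> it cannot occur, since the complement
  would miss the hitting set. With \<open>d\<close> at least 4, three such comodules sharing
  \<open>x\<close> cannot coexist, so one of three partners of \<open>x\<close> is harmless. With
  \<open>d = 3\<close> it always occurs, because the complement of the third block is such a
  comodule; but keeping \<open>y\<close> is affordable, as \<open>(3 + 1) div 2\<close> is one more
  than \<open>(2 + 1) div 2\<close>. The induction carries an arbitrary hitting set, because the
  remaining vertices need not represent minimal comodules of the new tournament. A disjoint family
  is chosen afresh each time and is never larger than the hitting set. The bound of 6 vertices comes
  from two conflicts on five vertices: a two-element module with a 3-cycle, and a source and a sink
  with a 3-cycle. The union must be a proper subset.\<close>

definition nontrivial_module :: "'a pair_pre_digraph \<Rightarrow> 'a set \<Rightarrow> bool" where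
  "nontrivial_module T M \<longleftrightarrow> is_module T M \<and> 2 \<le> card M \<and> M \<noteq> pverts T"

text \<open>Passing to complements also lets singletons count: \<open>{s}\<close> is never a
  nontrivial module, and it is a comodule when its complement is one, that is, when \<open>s\<close>
  is a source or a sink.\<close>

definition comodule :: "'a pair_pre_digraph \<Rightarrow> 'a set \<Rightarrow> bool" where
  "comodule T Q \<longleftrightarrow> Q \<subseteq> pverts T \<and> (nontrivial_module T Q \<or> nontrivial_module T (pverts T - Q))"

definition min_comodule :: "'a pair_pre_digraph \<Rightarrow> 'a set \<Rightarrow> bool" where
  "min_comodule T Q \<longleftrightarrow> comodule T Q \<and> (\<forall>Q'\<subseteq>Q. comodule T Q' \<longrightarrow> Q' = Q)"

text \<open>The intersection picks out whichever of the two pairs is an arc, so the orientation need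
  not be known and \<open>flip\<close> is symmetric in \<open>x\<close> and
  \<open>y\<close>.\<close>

definition flip :: "'a pair_pre_digraph \<Rightarrow> 'a \<Rightarrow> 'a \<Rightarrow> 'a pair_pre_digraph" where
  "flip T x y = Inv T (parcs T \<inter> {(x, y), (y, x)})"

text \<open>The sets separating \<open>x\<close> from \<open>y\<close> that become nontrivial modules when the arc between
  \<open>x\<close> and \<open>y\<close> is reversed.\<close>

definition new_module :: "'a pair_pre_digraph \<Rightarrow> 'a \<Rightarrow> 'a \<Rightarrow> 'a set \<Rightarrow> bool" where
  "new_module T x y M \<longleftrightarrow> M \<subseteq> pverts T \<and> x \<in> M \<and> y \<in> pverts T - M \<and> 2 \<le> card M \<and>
     (\<forall>v\<in>pverts T - M - {y}. \<forall>a\<in>M. \<forall>b\<in>M. (v, a) \<in> parcs T \<longleftrightarrow> (v, b) \<in> parcs T) \<and>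
     (\<forall>z\<in>M - {x}. (y, z) \<in> parcs T \<longleftrightarrow> (x, y) \<in> parcs T)"

text \<open>\<open>new_module\<close> is not symmetric: it covers the sets containing its first
  vertex and missing the second. Both orders together rule out every new module.\<close>

definition safe :: "'a pair_pre_digraph \<Rightarrow> 'a \<Rightarrow> 'a \<Rightarrow> bool" where
  "safe T x y \<longleftrightarrow> (\<forall>M. \<not> new_module T x y M \<and> \<not> new_module T y x M)"

lemma pverts_flip [simp]: "pverts (flip T x y) = pverts T"
  by (simp add: flip_def Inv_def)

lemma safe_commute: "safe T x y \<longleftrightarrow> safe T y x"
  by (auto simp: safe_def)

context tournament
begin

abbreviation beats :: "'a \<Rightarrow> 'a \<Rightarrow> bool"  (infix "\<rhd>" 50) where
  "x \<rhd> y \<equiv> (x, y) \<in> parcs G"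

abbreviation V :: "'a set" where "V \<equiv> pverts G"

lemma finite_subV: "A \<subseteq> V \<Longrightarrow> finite A"
  using pair_finite_verts finite_subset by blast

lemma not_refl [simp]: "\<not> x \<rhd> x"
  using pair_no_loops by fastforce

lemma arc_V: "x \<rhd> y \<Longrightarrow> x \<in> V" "x \<rhd> y \<Longrightarrow> y \<in> V"
  using wellformed' by auto

lemma arc_asym: "x \<rhd> y \<Longrightarrow> \<not> y \<rhd> x"
  using arc_iff_not_converse arc_V not_refl by metis

lemma arc_total: "x \<in> V \<Longrightarrow> y \<in> V \<Longrightarrow> x \<noteq> y \<Longrightarrow> \<not> x \<rhd> y \<longleftrightarrow> y \<rhd> x"
  using arc_iff_not_converse by blast

lemma module_subset: "is_module G M \<Longrightarrow> M \<subseteq> V"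
  by (simp add: is_module_def)

lemma module_in: "is_module G M \<Longrightarrow> v \<in> V \<Longrightarrow> v \<notin> M \<Longrightarrow> a \<in> M \<Longrightarrow> b \<in> M \<Longrightarrow> v \<rhd> a \<longleftrightarrow> v \<rhd> b"
  unfolding is_module_def by blast

lemma module_out:
  assumes "is_module G M" "v \<in> V" "v \<notin> M" "a \<in> M" "b \<in> M"
  shows "a \<rhd> v \<longleftrightarrow> b \<rhd> v"
proof -
  have "a \<in> V" "b \<in> V" "v \<noteq> a" "v \<noteq> b" using assms module_subset by auto
  then show ?thesis using module_in[OF assms] assms(2) arc_total by metis
qed

lemma is_moduleI:
  assumes "M \<subseteq> V" "\<And>v a b. v \<in> V \<Longrightarrow> v \<notin> M \<Longrightarrow> a \<in> M \<Longrightarrow> b \<in> M \<Longrightarrow> v \<rhd> a \<Longrightarrow> v \<rhd> b"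
  shows "is_module G M"
  unfolding is_module_def using assms by blast

lemma module_Int: "is_module G A \<Longrightarrow> is_module G B \<Longrightarrow> is_module G (A \<inter> B)"
  by (rule is_moduleI) (auto dest: module_subset module_in)

lemma module_Un:
  assumes "is_module G A" "is_module G B" "A \<inter> B \<noteq> {}"
  shows "is_module G (A \<union> B)"
proof (rule is_moduleI)
  show "A \<union> B \<subseteq> V" using assms module_subset by auto
  fix v a b assume v: "v \<in> V" "v \<notin> A \<union> B" "a \<in> A \<union> B" "b \<in> A \<union> B" "v \<rhd> a"
  obtain c where "c \<in> A" "c \<in> B" using assms by auto
  then show "v \<rhd> b" using v module_in[OF assms(1), of v] module_in[OF assms(2), of v]
    by (metis Un_iff)
qed

text \<open>For \<open>v\<close> in both modules, compare with a vertex \<open>c\<close> of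
  \<open>B - A\<close>: an element of \<open>A - B\<close> sees \<open>v\<close> and
  \<open>c\<close> alike because both lie in \<open>B\<close>, and \<open>c\<close> sees all of
  \<open>A\<close> alike.\<close>

lemma module_Diff:
  assumes A: "is_module G A" and B: "is_module G B" and "B - A \<noteq> {}"
  shows "is_module G (A - B)"
proof (rule is_moduleI)
  show "A - B \<subseteq> V" using A module_subset by auto
  fix v a b assume v: "v \<in> V" "v \<notin> A - B" "a \<in> A - B" "b \<in> A - B" "v \<rhd> a"
  obtain c where c: "c \<in> B" "c \<notin> A" using assms by auto
  have V: "a \<in> V" "b \<in> V" "c \<in> V" using A B c v module_subset by auto
  show "v \<rhd> b"
  proof (cases "v \<in> A")
    case True
    then have vB: "v \<in> B" "v \<noteq> a" "v \<noteq> b" using v by auto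
    have "\<not> a \<rhd> v" using v(5) arc_asym by blast
    then have "\<not> a \<rhd> c" using module_in[OF B, of a v c] vB c v V by auto
    then have "c \<rhd> a" using arc_total V c v by blast
    then have "c \<rhd> b" using module_in[OF A, of c a b] c v V by auto
    then have "\<not> b \<rhd> c" using arc_asym by blast
    then have "\<not> b \<rhd> v" using module_in[OF B, of b v c] vB c v V by auto
    then show ?thesis using arc_total vB v V by blast
  next
    case False
    then show ?thesis using module_in[OF A, of v a b] v by auto
  qed
qed

lemma nontrivial_moduleD:
  assumes "nontrivial_module G M"
  shows "is_module G M" "2 \<le> card M" "M \<noteq> V" "M \<subseteq> V"
  using assms module_subset by (auto simp: nontrivial_module_def)

lemma indecomposable_iff: "indecomposable G \<longleftrightarrow> (\<forall>M. \<not> nontrivial_module G M)"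
proof -
  have "2 \<le> card M \<longleftrightarrow> M \<noteq> {} \<and> (\<forall>x\<in>V. M \<noteq> {x})" if "M \<subseteq> V" for M
  proof -
    have f: "finite M" using that finite_subV by blast
    have "2 \<le> card M \<longleftrightarrow> card M \<noteq> 0 \<and> card M \<noteq> Suc 0" by linarith
    then show ?thesis
      using that f by (auto simp: card_1_singleton_iff)
  qed
  then show ?thesis unfolding indecomposable_def nontrivial_module_def
    using module_subset by metis
qed

lemma comodule_subset: "comodule G Q \<Longrightarrow> Q \<subseteq> V"
  by (simp add: comodule_def)

lemma comodule_compl: "comodule G Q \<Longrightarrow> comodule G (V - Q)"
  by (auto simp: comodule_def double_diff)

lemma comodule_nonempty: "comodule G Q \<Longrightarrow> Q \<noteq> {}"
  by (auto simp: comodule_def nontrivial_module_def)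

lemma nontrivial_imp_comodule: "nontrivial_module G M \<Longrightarrow> comodule G M"
  unfolding comodule_def by (blast dest: nontrivial_moduleD)

lemma nontrivial_compl_imp_comodule: "nontrivial_module G M \<Longrightarrow> comodule G (V - M)"
  using comodule_compl nontrivial_imp_comodule by blast

lemma min_comoduleD:
  assumes "min_comodule G M"
  shows "comodule G M" "M \<subseteq> V" "finite M" "M \<noteq> {}" "\<And>Q. comodule G Q \<Longrightarrow> Q \<subseteq> M \<Longrightarrow> Q = M"
  using assms comodule_subset finite_subV comodule_nonempty by (auto simp: min_comodule_def)

lemma ex_min_comodule:
  assumes "comodule G Q"
  obtains M where "M \<subseteq> Q" "min_comodule G M"
proof -
  have "finite {Q'. Q' \<subseteq> Q \<and> comodule G Q'}"
    using assms comodule_subset finite_subV by (auto intro!: finite_subset[OF _ finite_Pow_iff[THEN iffD2, of Q]])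
  moreover have "Q \<in> {Q'. Q' \<subseteq> Q \<and> comodule G Q'}" using assms by auto
  ultimately obtain M where M: "M \<in> {Q'. Q' \<subseteq> Q \<and> comodule G Q'}"
    "\<forall>N\<in>{Q'. Q' \<subseteq> Q \<and> comodule G Q'}. N \<subseteq> M \<longrightarrow> M = N"
    using finite_has_minimal2[of "{Q'. Q' \<subseteq> Q \<and> comodule G Q'}" Q] by blast
  show ?thesis
  proof (rule that[of M])
    show "M \<subseteq> Q" using M by blast
    show "min_comodule G M" unfolding min_comodule_def using M by blast
  qed
qed

lemma card_le_1D: "finite A \<Longrightarrow> card A \<le> 1 \<Longrightarrow> x \<in> A \<Longrightarrow> y \<in> A \<Longrightarrow> x = y"
  by (simp add: card_le_Suc0_iff_eq)

text \<open>\<open>M\<close> may be just the complement of a module. With two elements,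
  \<open>N\<close> would be a smaller comodule.\<close>

lemma module_in_min_comodule:
  assumes "min_comodule G M" "is_module G N" "N \<subset> M"
  shows "card N \<le> 1"
proof (rule ccontr)
  assume "\<not> card N \<le> 1"
  then have "nontrivial_module G N"
    using assms min_comoduleD(2)[OF assms(1)] by (auto simp: nontrivial_module_def)
  then show False using assms nontrivial_imp_comodule min_comoduleD(5) by blast
qed

text \<open>If they met, \<open>M\<close> would also meet the module \<open>V - M'\<close>, and the
  complement \<open>M' - M\<close> of their union would be a comodule properly inside
  \<open>M'\<close>.\<close>

lemma min_comodule_not_overlap_compl:
  assumes M: "min_comodule G M" "nontrivial_module G M"
    and M': "min_comodule G M'" "\<not> nontrivial_module G M'" and neq: "M \<noteq> M'"
  shows "M \<inter> M' = {}"
proof (rule ccontr)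
  assume meet: "M \<inter> M' \<noteq> {}"
  have nt: "nontrivial_module G (V - M')"
    using M' by (auto simp: min_comodule_def comodule_def)
  note sub = min_comoduleD(2)[OF M(1)] min_comoduleD(2)[OF M'(1)]
  have 1: "M \<inter> (V - M') \<noteq> {}" using min_comoduleD(5)[OF M'(1), of M] M neq sub min_comoduleD(1) by blast
  have 2: "M' - M \<noteq> {}" using min_comoduleD(5)[OF M(1), of M'] M' neq min_comoduleD(1) by blast
  have "is_module G (M \<union> (V - M'))"
    using module_Un 1 nt M(2) nontrivial_moduleD(1) by blast
  moreover have "2 \<le> card (M \<union> (V - M'))"
    using card_mono[of "M \<union> (V - M')" M] M(2) sub finite_subV[of "M \<union> (V - M')"]
    by (auto simp: nontrivial_module_def)
  moreover have "M \<union> (V - M') \<noteq> V" using 2 sub by blast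
  ultimately have "comodule G (V - (M \<union> (V - M')))"
    using nontrivial_compl_imp_comodule by (auto simp: nontrivial_module_def)
  moreover have "V - (M \<union> (V - M')) = M' - M" using sub by blast
  ultimately have "M' - M = M'" using min_comoduleD(5)[OF M'(1), of "M' - M"] by auto
  then show False using meet by blast
qed

text \<open>For two overlapping modules, \<open>M \<inter> M'\<close> and \<open>M - M'\<close> are
  proper submodules of \<open>M\<close>, so each has at most one element. The mixed case is excluded
  above. For two complements of modules, the union of these modules would leave the smaller comodule
  \<open>M \<inter> M'\<close>.\<close>

lemma min_comodules_meet:
  assumes M: "min_comodule G M" and M': "min_comodule G M'" and neq: "M \<noteq> M'"
    and meet: "M \<inter> M' \<noteq> {}"
  shows "nontrivial_module G M" "nontrivial_module G M'" "card M = 2" "card M' = 2"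
proof -
  note sub = min_comoduleD(2)[OF M] min_comoduleD(2)[OF M']
  have ns: "\<not> M \<subseteq> M'" "\<not> M' \<subseteq> M"
    using min_comoduleD(5)[OF M', of M] min_comoduleD(5)[OF M, of M'] M M' neq min_comoduleD(1) by blast+
  have *: "nontrivial_module G M \<or> nontrivial_module G M'"
  proof (rule ccontr)
    assume a: "\<not> ?thesis"
    then have nt: "nontrivial_module G (V - M)" "nontrivial_module G (V - M')"
      using M M' by (auto simp: min_comodule_def comodule_def)
    show False
    proof (cases "(V - M) \<inter> (V - M') = {}")
      \<comment> \<open>If the two modules \<open>V - M\<close> and \<open>V - M'\<close> are
        disjoint, the first lies in \<open>M'\<close> and equals it by minimality, although
        \<open>M'\<close> is assumed not to be a module.\<close>
      case True
      then have "V - M \<subseteq> M'" by blast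
      then have "V - M = M'" using nt(1) nontrivial_imp_comodule min_comoduleD(5)[OF M'] by blast
      then show False using nt a by auto
    next
      case False
      then have "is_module G ((V - M) \<union> (V - M'))"
        using module_Un nt nontrivial_moduleD(1) by blast
      moreover have "2 \<le> card ((V - M) \<union> (V - M'))"
        using card_mono[of "(V - M) \<union> (V - M')" "V - M"] nt(1) finite_subV[of "(V - M) \<union> (V - M')"]
        by (auto simp: nontrivial_module_def)
      moreover have "(V - M) \<union> (V - M') \<noteq> V" using meet sub by blast
      ultimately have "comodule G (V - ((V - M) \<union> (V - M')))"
        using nontrivial_compl_imp_comodule by (auto simp: nontrivial_module_def)
      moreover have "V - ((V - M) \<union> (V - M')) = M \<inter> M'" using sub by blast
      ultimately have "M \<inter> M' = M" using min_comoduleD(5)[OF M, of "M \<inter> M'"] by auto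
      then show False using ns by blast
    qed
  qed
  have nt: "nontrivial_module G M" "nontrivial_module G M'"
    using * min_comodule_not_overlap_compl M M' neq meet by blast+
  have c: "card M = 2" if A: "min_comodule G M" "nontrivial_module G M" "nontrivial_module G M'"
    "\<not> M \<subseteq> M'" "\<not> M' \<subseteq> M" "M \<inter> M' \<noteq> {}" for M M'
  proof -
    have f: "finite M" using A(1) min_comoduleD(3) by blast
    have "card (M \<inter> M') \<le> 1"
      using A module_in_min_comodule[OF A(1) module_Int] nontrivial_moduleD by blast
    moreover have "card (M - M') \<le> 1"
      using A module_in_min_comodule[OF A(1) module_Diff, of M M'] nontrivial_moduleD by blast
    moreover have "card M = card (M \<inter> M') + card (M - M')"
      using card_Un_disjoint[of "M \<inter> M'" "M - M'"] f by (metis Diff_Diff_Int Int_Diff_disjoint Int_Diff_Un finite_Diff finite_Int)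
    ultimately show ?thesis using A nontrivial_moduleD(2)[OF A(2)] by linarith
  qed
  show "nontrivial_module G M" "nontrivial_module G M'" "card M = 2" "card M' = 2"
    using nt c[OF M nt(1,2)] c[OF M' nt(2,1)] ns meet by auto
qed

section \<open>The effect of reversing one arc on modules and comodules\<close>

lemma arcs_flip:
  "x \<in> V \<Longrightarrow> y \<in> V \<Longrightarrow> x \<noteq> y \<Longrightarrow> (a, b) \<in> parcs (flip G x y) \<longleftrightarrow>
    (if a = x \<and> b = y \<or> a = y \<and> b = x then (b, a) \<in> parcs G else (a, b) \<in> parcs G)"
  using arc_asym arc_total by (auto simp: flip_def Inv_def)

lemma tournament_Inv:
  assumes "B \<subseteq> parcs G"
  shows "tournament (Inv G B)"
proof unfold_locales
  show "finite (pverts (Inv G B))" "finite (parcs (Inv G B))"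
    using pair_finite_verts pair_finite_arcs finite_subset[OF assms] by (auto simp: Inv_def)
  show "\<And>e. e \<in> parcs (Inv G B) \<Longrightarrow> fst e \<in> pverts (Inv G B)"
    "\<And>e. e \<in> parcs (Inv G B) \<Longrightarrow> snd e \<in> pverts (Inv G B)"
    "\<And>e. e \<in> parcs (Inv G B) \<Longrightarrow> fst e \<noteq> snd e"
    using assms arc_V by (auto simp: Inv_def)
  show "(x, y) \<in> parcs (Inv G B) \<longleftrightarrow> (y, x) \<notin> parcs (Inv G B)"
    if "x \<in> pverts (Inv G B)" "y \<in> pverts (Inv G B)" "x \<noteq> y" for x y
    using that assms arc_total[of x y] arc_asym by (auto simp: Inv_def)
qed

lemma tournament_flip: "tournament (flip G x y)"
  unfolding flip_def by (rule tournament_Inv) auto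

text \<open>A set not separating \<open>x\<close> from \<open>y\<close> has the same arcs to the
  outside before and after the reversal. A separating one that is a nontrivial module afterwards is
  what \<open>safe\<close> forbids.\<close>

lemma flip_module:
  assumes xy: "x \<in> V" "y \<in> V" "x \<noteq> y" and M: "nontrivial_module (flip G x y) M"
    and safe: "safe G x y"
  shows "nontrivial_module G M" "x \<in> M \<longleftrightarrow> y \<in> M"
proof -
  have new: "new_module G x y M" if xy: "x \<in> V" "y \<in> V" "x \<noteq> y" and M: "nontrivial_module (flip G x y) M"
    and "x \<in> M" "y \<notin> M" for x y
  proof -
    have M': "M \<subseteq> V" "2 \<le> card M"
      "\<And>v a b. v \<in> V \<Longrightarrow> v \<notin> M \<Longrightarrow> a \<in> M \<Longrightarrow> b \<in> M \<Longrightarrow>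
        (v, a) \<in> parcs (flip G x y) \<longleftrightarrow> (v, b) \<in> parcs (flip G x y)"
      using tournament.nontrivial_moduleD[OF tournament_flip M]
        tournament.module_in[OF tournament_flip, of x y M] pverts_flip by (simp, simp, metis)
    have "v \<rhd> a \<longleftrightarrow> v \<rhd> b" if "v \<in> V - M - {y}" "a \<in> M" "b \<in> M" for v a b
    proof -
      have "v \<noteq> x" "v \<noteq> y" using that \<open>x \<in> M\<close> by auto
      then show ?thesis using M'(3)[of v a b] that by (simp add: arcs_flip[OF xy])
    qed
    moreover have "y \<rhd> z \<longleftrightarrow> x \<rhd> y" if "z \<in> M - {x}" for z
      using M'(3)[of y x z] that \<open>x \<in> M\<close> \<open>y \<notin> M\<close> arcs_flip[OF xy] xy by auto
    ultimately show ?thesis unfolding new_module_def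
      using M'(1,2) \<open>x \<in> M\<close> \<open>y \<notin> M\<close> xy by blast
  qed
  have "flip G x y = flip G y x" by (simp add: flip_def insert_commute)
  then show iff: "x \<in> M \<longleftrightarrow> y \<in> M"
    using new[OF xy M] new[of y x] xy M safe by (auto simp: safe_def)
  have "is_module G M" using M iff arcs_flip[OF xy]
    unfolding nontrivial_module_def is_module_def by (auto split: if_splits)
  then show "nontrivial_module G M" using M by (auto simp: nontrivial_module_def)
qed

lemma flip_comodule:
  assumes xy: "x \<in> V" "y \<in> V" "x \<noteq> y" and Q: "comodule (flip G x y) Q"
    and safe: "safe G x y"
  shows "comodule G Q" "x \<in> Q \<longleftrightarrow> y \<in> Q"
proof -
  show "comodule G Q" using Q flip_module(1)[OF xy _ safe] by (auto simp: comodule_def)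
  show "x \<in> Q \<longleftrightarrow> y \<in> Q"
    using Q flip_module(2)[OF xy _ safe, of Q] flip_module(2)[OF xy _ safe, of "V - Q"] xy
    by (auto simp: comodule_def)
qed

end

section \<open>Modules created by reversing an arc\<close>

text \<open>The choice of \<open>y\<close> in \<open>M\<close> that keeps the reversal of an arc at \<open>y\<close> from creating
  new modules; only for a 3-cycle every choice may fail.\<close>

definition good_rep :: "'a pair_pre_digraph \<Rightarrow> 'a set \<Rightarrow> 'a \<Rightarrow> bool" where
  "good_rep T M y \<longleftrightarrow> y \<in> M \<and> (nontrivial_module T M \<longrightarrow>
     (card M = 2 \<longrightarrow> (\<exists>v. M = {v, y} \<and> (v, y) \<in> parcs T)) \<and>
     (4 \<le> card M \<longrightarrow> \<not> (\<exists>z\<in>M. (y, z) \<in> parcs T \<and> (\<forall>b\<in>M - {y, z}. (z, b) \<in> parcs T))))"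

context tournament
begin

lemma new_moduleD:
  assumes "new_module G x y M"
  shows "M \<subseteq> V" "x \<in> M" "y \<in> V" "y \<notin> M" "x \<in> V" "finite M" "x \<noteq> y" "2 \<le> card M"
    "\<And>z. z \<in> M \<Longrightarrow> z \<noteq> x \<Longrightarrow> y \<rhd> z \<longleftrightarrow> x \<rhd> y"
  using assms finite_subV by (auto simp: new_module_def)

lemma new_module_in:
  "new_module G x y M \<Longrightarrow> v \<in> V \<Longrightarrow> v \<notin> M \<Longrightarrow> v \<noteq> y \<Longrightarrow> a \<in> M \<Longrightarrow> b \<in> M \<Longrightarrow> v \<rhd> a \<longleftrightarrow> v \<rhd> b"
  unfolding new_module_def by blast

lemma new_module_ex:
  assumes "new_module G x y M"
  obtains z where "z \<in> M" "z \<noteq> x"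
proof -
  have "\<not> M \<subseteq> {x}" using new_moduleD(8)[OF assms] card_mono[of "{x}" M] by auto
  then show ?thesis using that by blast
qed

text \<open>The exceptional vertex \<open>y\<close> lies outside \<open>M1\<close>, so
  \<open>M \<inter> M1\<close> is a module of \<open>G\<close> itself. It is not all of
  \<open>M1\<close>, since \<open>y\<close> must treat \<open>x\<close> differently from the other
  vertices of \<open>M\<close>. Minimality then leaves only \<open>x\<close>.\<close>

lemma new_module_Int:
  assumes new: "new_module G x y M" and M1: "min_comodule G M1" "nontrivial_module G M1"
    and xy: "x \<in> M1" "y \<notin> M1"
  shows "M \<inter> M1 = {x}"
proof -
  note n = new_moduleD[OF new] and m = nontrivial_moduleD[OF M1(2)]
  have mod: "is_module G (M \<inter> M1)"
  proof (rule is_moduleI)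
    show "M \<inter> M1 \<subseteq> V" using n by blast
    fix v a b assume v: "v \<in> V" "v \<notin> M \<inter> M1" "a \<in> M \<inter> M1" "b \<in> M \<inter> M1" "v \<rhd> a"
    show "v \<rhd> b"
    proof (cases "v \<in> M1")
      case True
      then show ?thesis using new_module_in[OF new, of v a b] v xy by blast
    next
      case False
      then show ?thesis using module_in[OF m(1), of v a b] v by blast
    qed
  qed
  have "M \<inter> M1 \<noteq> M1"
  proof
    assume "M \<inter> M1 = M1"
    then have sub: "M1 \<subseteq> M" by blast
    have "\<not> M1 \<subseteq> {x}" using m(2) card_mono[of "{x}" M1] by auto
    then obtain z where z: "z \<in> M1" "z \<noteq> x" by blast
    then have "y \<rhd> z \<longleftrightarrow> x \<rhd> y" using n(9) sub by blast
    moreover have "y \<rhd> z \<longleftrightarrow> y \<rhd> x" using module_in[OF m(1), of y z x] z xy n by blast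
    ultimately show False using arc_total[of x y] arc_asym n by blast
  qed
  then have "card (M \<inter> M1) \<le> 1" using module_in_min_comodule[OF M1(1) mod] by blast
  then show ?thesis using card_le_1D[of "M \<inter> M1" x] n xy by blast
qed

lemma module_minus_uniform:
  assumes "is_module G M" "y \<in> M" "\<And>a b. a \<in> M - {y} \<Longrightarrow> b \<in> M - {y} \<Longrightarrow> y \<rhd> a \<Longrightarrow> y \<rhd> b"
  shows "is_module G (M - {y})"
proof (rule is_moduleI)
  show "M - {y} \<subseteq> V" using assms module_subset by blast
  fix v a b assume v: "v \<in> V" "v \<notin> M - {y}" "a \<in> M - {y}" "b \<in> M - {y}" "v \<rhd> a"
  show "v \<rhd> b"
    using v assms(2) assms(3)[of a b] module_in[OF assms(1), of v a b] by blast
qed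

lemma card_ge_2E:
  assumes "2 \<le> card M" "y \<in> M"
  obtains z where "z \<in> M" "z \<noteq> y"
proof -
  have "\<not> M \<subseteq> {y}" using assms card_mono[of "{y}" M] by auto
  then show ?thesis using that by blast
qed

lemma card_ge_3_minus:
  assumes "3 \<le> card M" "y \<in> M"
  shows "2 \<le> card (M - {y})"
  using assms by (simp add: card_Diff_singleton)

text \<open>A vertex that treats the rest of \<open>M\<close> uniformly could be removed, leaving a
  smaller module with at least two elements.\<close>

lemma min_comodule_no_uniform:
  assumes M: "min_comodule G M" "is_module G M" "3 \<le> card M" "y \<in> M"
  shows "\<not> (\<forall>a\<in>M - {y}. \<forall>b\<in>M - {y}. y \<rhd> a \<longrightarrow> y \<rhd> b)"
proof
  assume *: "\<forall>a\<in>M - {y}. \<forall>b\<in>M - {y}. y \<rhd> a \<longrightarrow> y \<rhd> b"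
  have "is_module G (M - {y})" using module_minus_uniform M(2,4) * by blast
  then have "card (M - {y}) \<le> 1" using module_in_min_comodule[OF M(1)] M(4) by blast
  then show False using card_ge_3_minus M by fastforce
qed

text \<open>Some \<open>z\<close> of \<open>M\<close> lies outside \<open>M1\<close>. It sees the
  vertices of \<open>M1\<close> alike, and each vertex of \<open>M1 - {x}\<close> sees
  \<open>z\<close> and \<open>x\<close> alike, so \<open>x\<close> would treat the rest of
  \<open>M1\<close> uniformly.\<close>

lemma not_new_module_big:
  assumes M1: "min_comodule G M1" "nontrivial_module G M1" "3 \<le> card M1"
    and xy: "x \<in> M1" "y \<notin> M1"
  shows "\<not> new_module G x y M"
proof
  assume new: "new_module G x y M"
  note n = new_moduleD[OF new] and m = nontrivial_moduleD[OF M1(2)]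
  have int: "M \<inter> M1 = {x}" using new_module_Int[OF new M1(1,2) xy] .
  obtain z where z: "z \<in> M" "z \<noteq> x" using new_module_ex[OF new] .
  then have z': "z \<notin> M1" "z \<in> V" using int n by blast+
  have "x \<rhd> b" if "a \<in> M1 - {x}" "b \<in> M1 - {x}" "x \<rhd> a" for a b
  proof -
    have ab: "a \<notin> M" "b \<notin> M" "a \<in> V" "b \<in> V" "a \<noteq> y" "b \<noteq> y" using that int m xy by blast+
    have "\<not> a \<rhd> x" using that arc_asym by blast
    then have "\<not> a \<rhd> z" using new_module_in[OF new, of a x z] ab n z by blast
    then have "z \<rhd> a" using arc_total[of a z] ab z' that by blast
    then have "z \<rhd> b" using module_in[OF m(1), of z a b] z' that by blast
    then have "\<not> b \<rhd> z" using arc_asym by blast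
    then have "\<not> b \<rhd> x" using new_module_in[OF new, of b x z] ab n z by blast
    then show ?thesis using arc_total[of b x] ab n that by blast
  qed
  then show False using min_comodule_no_uniform[OF M1(1) m(1) M1(3) xy(1)] by blast
qed

text \<open>The predecessor \<open>u\<close> sees \<open>x\<close> and the rest of \<open>M\<close>
  alike, so \<open>u\<close>, and with it its twin \<open>x\<close>, dominates
  \<open>M - {x}\<close>. Choosing all representatives of two-element modules at the head of the arc
  fixes this direction.\<close>

lemma new_module_twin:
  assumes new: "new_module G x y M" and M1: "min_comodule G {u, x}" "nontrivial_module G {u, x}"
    and ux: "u \<rhd> x" and y: "y \<notin> {u, x}"
  shows "u \<notin> M" "is_module G (M - {x})" "\<And>z. z \<in> M \<Longrightarrow> z \<noteq> x \<Longrightarrow> x \<rhd> z"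
proof -
  note n = new_moduleD[OF new] and m = nontrivial_moduleD[OF M1(2)]
  have int: "M \<inter> {u, x} = {x}" using new_module_Int[OF new M1] y by blast
  have "u \<noteq> x" using ux by auto
  then show u: "u \<notin> M" using int by blast
  have uV: "u \<in> V" using ux arc_V by blast
  show xz: "x \<rhd> z" if "z \<in> M" "z \<noteq> x" for z
  proof -
    have z: "z \<in> V" "z \<notin> {u, x}" using that n u by auto
    have "u \<rhd> z" using new_module_in[OF new, of u x z] u ux y that n uV by blast
    then show ?thesis using module_out[OF m(1), of z u x] z by blast
  qed
  show "is_module G (M - {x})"
  proof (rule is_moduleI)
    show "M - {x} \<subseteq> V" using n by blast
    fix v a b assume v: "v \<in> V" "v \<notin> M - {x}" "a \<in> M - {x}" "b \<in> M - {x}" "v \<rhd> a"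
    consider "v = x" | "v = y" | "v \<notin> M" "v \<noteq> y" using v by blast
    then show "v \<rhd> b"
    proof cases
      case 1
      then show ?thesis using xz v by blast
    next
      case 2
      then show ?thesis using n(9) v by blast
    next
      case 3
      then show ?thesis using new_module_in[OF new, of v a b] v by blast
    qed
  qed
qed

text \<open>In a two-element module the representative is the head of the arc; in a larger one every
  vertex is dominated by another one inside, by \<open>min_comodule_no_uniform\<close>.\<close>

lemma good_rep_not_dominating:
  assumes M: "min_comodule G M" "nontrivial_module G M" and r: "good_rep G M y"
  obtains b where "b \<in> M" "b \<noteq> y" "\<not> y \<rhd> b"
proof (cases "card M = 2")
  case True
  then obtain v where v: "M = {v, y}" "v \<rhd> y" using r M by (auto simp: good_rep_def)
  then have "v \<noteq> y" by auto
  then show ?thesis using that[of v] v arc_asym by blast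
next
  case False
  then have "3 \<le> card M" "y \<in> M" using M nontrivial_moduleD(2)[OF M(2)] r by (auto simp: good_rep_def)
  then have "\<not> (\<forall>a\<in>M - {y}. \<forall>b\<in>M - {y}. y \<rhd> a \<longrightarrow> y \<rhd> b)"
    using min_comodule_no_uniform M nontrivial_moduleD(1) by blast
  then show ?thesis using that by blast
qed

text \<open>The set \<open>M\<close> must be a pair \<open>{x, z}\<close> with \<open>z\<close> in
  \<open>M2\<close>. Then \<open>y\<close> dominates \<open>z\<close> and \<open>z\<close> dominates
  the rest of \<open>M2\<close>, which \<open>good_rep\<close> tolerates only when \<open>M2\<close>
  has fewer than four elements.\<close>

lemma new_module_twin_cases:
  assumes new: "new_module G x y M" and M1: "min_comodule G {u, x}" "nontrivial_module G {u, x}"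
    and ux: "u \<rhd> x" and M2: "min_comodule G M2" "nontrivial_module G M2"
    and disj: "{u, x} \<inter> M2 = {}" and r: "good_rep G M2 y"
  shows "card M2 = 3" "is_module G ({u, x} \<union> M2)" "x \<rhd> y"
proof -
  have yM2: "y \<in> M2" using r by (simp add: good_rep_def)
  then have y: "y \<notin> {u, x}" using disj by blast
  note n = new_moduleD[OF new] and m = nontrivial_moduleD[OF M2(2)]
  note t = new_module_twin[OF new M1 ux y]
  have x: "x \<notin> M2" using disj by blast
  have fin: "finite M2" using m finite_subV by blast
  obtain b where b: "b \<in> M2" "b \<noteq> y" "\<not> y \<rhd> b" using good_rep_not_dominating[OF M2 r] .
  have "b \<notin> M"
  proof
    assume "b \<in> M"
    then have "x \<rhd> b" using t(3) b x by blast
    then have "x \<rhd> y" using module_in[OF m(1), of x b y] b x n yM2 by blast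
    then show False using n(9) \<open>b \<in> M\<close> b x by blast
  qed
  \<comment> \<open>If \<open>z\<close> were outside \<open>M2\<close>, then \<open>x\<close> and
    \<open>z\<close> would each see \<open>b\<close> and \<open>y\<close> alike; but
    \<open>b\<close> sees \<open>x\<close> and \<open>z\<close> alike, while \<open>y\<close> does
    not.\<close>
  have "z \<in> M2" if z: "z \<in> M" "z \<noteq> x" for z
  proof (rule ccontr)
    assume zM: "z \<notin> M2"
    have zV: "z \<in> V" "b \<in> V" using z n b m by blast+
    have "z \<rhd> b \<longleftrightarrow> z \<rhd> y" using module_in[OF m(1), of z b y] zM zV b yM2 by blast
    moreover have "x \<rhd> b \<longleftrightarrow> x \<rhd> y" using module_in[OF m(1), of x b y] x n b yM2 by blast
    moreover have "b \<rhd> x \<longleftrightarrow> b \<rhd> z" using new_module_in[OF new, of b x z] \<open>b \<notin> M\<close> b z n zV by blast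
    moreover have "y \<rhd> z \<longleftrightarrow> x \<rhd> y" using n(9) z by blast
    moreover have "x \<noteq> b" "z \<noteq> b" "z \<noteq> y" using x b zM yM2 by blast+
    ultimately show False using arc_total[of x b] arc_total[of z b] arc_total[of z y] zV n by blast
  qed
  then have sub: "M - {x} \<subseteq> M2" by blast
  have "card (M - {x}) \<le> 1"
    using module_in_min_comodule[OF M2(1) t(2)] sub n(4) yM2 by blast
  moreover obtain z where z: "z \<in> M" "z \<noteq> x" using new_module_ex[OF new] .
  ultimately have Mz: "M = {x, z}" using card_le_1D[of "M - {x}"] n by blast
  have zM2: "z \<in> M2" using sub z by blast
  have xM2: "x \<rhd> c" if "c \<in> M2" for c
    using module_in[OF m(1), of x z c] t(3)[OF z] that x n zM2 by blast
  then show "x \<rhd> y" using yM2 by blast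
  then have yz: "y \<rhd> z" using n(9) z by blast
  have "z \<rhd> c" if "c \<in> M2 - {y, z}" for c
  proof -
    have "c \<notin> M" "c \<in> V" "c \<noteq> y" using that Mz x m by blast+
    then have "\<not> c \<rhd> z" using new_module_in[OF new, of c x z] z n xM2[of c] that arc_asym by blast
    then show ?thesis using arc_total[of c z] that \<open>c \<in> V\<close> zM2 m by blast
  qed
  then have "\<not> 4 \<le> card M2" using r M2 yz zM2 unfolding good_rep_def by blast
  moreover have "3 \<le> card M2"
  proof -
    have "card {b, y, z} = 3" using b z Mz \<open>b \<notin> M\<close> n by auto
    then show ?thesis using card_mono[of M2 "{b, y, z}"] fin b yM2 zM2 by auto
  qed
  ultimately show "card M2 = 3" by simp
  \<comment> \<open>The pair \<open>M = {x, z}\<close> links the two blocks: a vertex outside both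
    sees \<open>x\<close> and \<open>z\<close> alike.\<close>
  show "is_module G ({u, x} \<union> M2)"
  proof (rule is_moduleI)
    show "{u, x} \<union> M2 \<subseteq> V" using m M1(1) min_comoduleD(2) by blast
    fix v a b assume v: "v \<in> V" "v \<notin> {u, x} \<union> M2" "a \<in> {u, x} \<union> M2" "b \<in> {u, x} \<union> M2" "v \<rhd> a"
    have 1: "v \<rhd> c \<longleftrightarrow> v \<rhd> z" if "c \<in> M2" for c
      using module_in[OF m(1), of v c z] v that zM2 by blast
    have 2: "v \<rhd> z \<longleftrightarrow> v \<rhd> x" using new_module_in[OF new, of v z x] v Mz yM2 zM2 by blast
    have 3: "v \<rhd> u \<longleftrightarrow> v \<rhd> x" using module_in[OF nontrivial_moduleD(1)[OF M1(2)], of v u x] v by blast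
    show "v \<rhd> b" using v 1 2 3 by blast
  qed
qed

definition is_source :: "'a \<Rightarrow> bool" where
  "is_source s \<longleftrightarrow> s \<in> V \<and> (\<forall>v\<in>V - {s}. s \<rhd> v)"

lemma not_new_module_source:
  assumes s: "is_source s"
  shows "\<not> new_module G y s M"
proof
  assume new: "new_module G y s M"
  note n = new_moduleD[OF new]
  obtain z where "z \<in> M" "z \<noteq> y" using new_module_ex[OF new] .
  then have "s \<rhd> z" "s \<rhd> z \<longleftrightarrow> y \<rhd> s" "s \<rhd> y" using n s by (auto simp: is_source_def)
  then show False using arc_asym by blast
qed

text \<open>The analysis of \<open>new_module_twin_cases\<close> with the source in the role of
  \<open>x\<close>. The vertex \<open>b\<close> is a hypothesis because it comes from
  \<open>good_rep\<close> in one application and from the size of \<open>M2\<close> in the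
  other.\<close>

lemma new_module_source_cases:
  assumes s: "is_source s" and new: "new_module G s y M"
    and M2: "min_comodule G M2" "nontrivial_module G M2" "s \<notin> M2" "y \<in> M2"
    and b: "b \<in> M2" "b \<noteq> y" "\<not> y \<rhd> b"
  shows "3 \<le> card M2" "is_module G ({s} \<union> M2)"
    "\<exists>z\<in>M2. y \<rhd> z \<and> (\<forall>b\<in>M2 - {y, z}. z \<rhd> b)"
proof -
  note n = new_moduleD[OF new] and m = nontrivial_moduleD[OF M2(2)]
  have fin: "finite M2" using m finite_subV by blast
  have sv: "s \<rhd> v" if "v \<in> V" "v \<noteq> s" for v using s that by (auto simp: is_source_def)
  have yz: "y \<rhd> z" if "z \<in> M" "z \<noteq> s" for z
    using n(9)[OF that] sv[of y] n by blast
  have zv: "z \<rhd> v" if "z \<in> M" "z \<noteq> s" "v \<in> V" "v \<notin> M" "v \<noteq> y" for z v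
  proof -
    have "\<not> v \<rhd> s" using sv[of v] that n arc_asym by blast
    then have "\<not> v \<rhd> z" using new_module_in[OF new, of v s z] that n by blast
    then show ?thesis using arc_total[of v z] that n by blast
  qed
  have "b \<notin> M" using yz b M2 by blast
  have "z \<in> M2" if z: "z \<in> M" "z \<noteq> s" for z
  proof (rule ccontr)
    assume zM: "z \<notin> M2"
    have "b \<rhd> z" using module_out[OF m(1), of z y b] yz[OF z] z zM n b M2 by blast
    then show False using zv[OF z, of b] arc_asym b m \<open>b \<notin> M\<close> by blast
  qed
  then have sub: "M - {s} \<subseteq> M2" by blast
  have "is_module G (M - {s})"
  proof (rule is_moduleI)
    show "M - {s} \<subseteq> V" using n by blast
    fix v a c assume v: "v \<in> V" "v \<notin> M - {s}" "a \<in> M - {s}" "c \<in> M - {s}" "v \<rhd> a"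
    consider "v = s" | "v = y" | "v \<notin> M" "v \<noteq> y" using v by blast
    then show "v \<rhd> c"
    proof cases
      case 1
      then show ?thesis using sv v n by blast
    next
      case 2
      then show ?thesis using yz v by blast
    next
      case 3
      then show ?thesis using zv v arc_asym by blast
    qed
  qed
  then have "card (M - {s}) \<le> 1"
    using module_in_min_comodule[OF M2(1)] sub n(4) M2(4) by blast
  moreover obtain z where z: "z \<in> M" "z \<noteq> s" using new_module_ex[OF new] .
  ultimately have Mz: "M = {s, z}" using card_le_1D[of "M - {s}"] n by blast
  have zM2: "z \<in> M2" using sub z by blast
  have "card {b, y, z} = 3" using b z Mz \<open>b \<notin> M\<close> n by auto
  then show "3 \<le> card M2" using card_mono[of M2 "{b, y, z}"] fin b M2 zM2 by auto
  have "z \<rhd> c" if "c \<in> M2 - {y, z}" for c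
    using zv[OF z, of c] that Mz m M2(3) by blast
  then show "\<exists>z\<in>M2. y \<rhd> z \<and> (\<forall>b\<in>M2 - {y, z}. z \<rhd> b)" using zM2 yz[OF z] by blast
  show "is_module G ({s} \<union> M2)"
  proof (rule is_moduleI)
    show "{s} \<union> M2 \<subseteq> V" using m n by blast
    fix v a b assume v: "v \<in> V" "v \<notin> {s} \<union> M2" "a \<in> {s} \<union> M2" "b \<in> {s} \<union> M2" "v \<rhd> a"
    have "\<not> v \<rhd> z" using zv[OF z, of v] v Mz zM2 M2(4) arc_asym by blast
    then have "\<not> v \<rhd> c" if "c \<in> M2" for c
      using module_in[OF m(1), of v c z] v that zM2 by blast
    moreover have "\<not> v \<rhd> s" using sv[of v] v arc_asym by blast
    ultimately show "v \<rhd> b" using v by blast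
  qed
qed

text \<open>Let \<open>K = V - M1\<close>. If \<open>M\<close> missed \<open>K\<close>, then
  \<open>y\<close> and another vertex of \<open>K\<close> would disagree on \<open>M\<close>,
  although \<open>K\<close> is a module. So \<open>M \<union> K\<close> is a module, minimality
  gives \<open>M1 \<subseteq> M\<close>, and a further vertex outside \<open>M\<close> would turn
  \<open>M1\<close> into a module.\<close>

lemma new_module_compl_left:
  assumes M1: "min_comodule G M1" "\<not> nontrivial_module G M1" "2 \<le> card M1"
    and xy: "x \<in> M1" "y \<in> V - M1" and new: "new_module G x y M"
  shows "M = V - {y}"
proof -
  note n = new_moduleD[OF new]
  define K where "K = V - M1"
  have nt: "nontrivial_module G K" using M1 by (auto simp: min_comodule_def comodule_def K_def)
  note k = nontrivial_moduleD[OF nt]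
  have M1V: "M1 \<subseteq> V" using min_comoduleD(2)[OF M1(1)] .
  have yK: "y \<in> K" using xy by (simp add: K_def)
  have meet: "M \<inter> K \<noteq> {}"
  proof
    assume a: "M \<inter> K = {}"
    obtain l where l: "l \<in> K" "l \<noteq> y" using card_ge_2E[OF k(2) yK] .
    obtain z where z: "z \<in> M" "z \<noteq> x" using new_module_ex[OF new] .
    have V: "l \<in> V" "l \<notin> M" "z \<in> V" "z \<notin> K" "x \<notin> K" "x \<in> V" using a l k z n by blast+
    have "l \<rhd> x \<longleftrightarrow> l \<rhd> z" using new_module_in[OF new, of l x z] V l z n by blast
    moreover have "l \<rhd> x \<longleftrightarrow> y \<rhd> x" "l \<rhd> z \<longleftrightarrow> y \<rhd> z"
      using module_out[OF k(1), of x l y] module_out[OF k(1), of z l y] V l yK by blast+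
    ultimately show False using n(9)[OF z] arc_total[of x y] arc_asym n by blast
  qed
  have mod: "is_module G (M \<union> K)"
  proof (rule is_moduleI)
    show "M \<union> K \<subseteq> V" using n k by blast
    fix v a b assume v: "v \<in> V" "v \<notin> M \<union> K" "a \<in> M \<union> K" "b \<in> M \<union> K" "v \<rhd> a"
    obtain c where c: "c \<in> M" "c \<in> K" using meet by blast
    have "v \<rhd> d \<longleftrightarrow> v \<rhd> c" if "d \<in> M" for d
      using new_module_in[OF new, of v d c] v c that yK by blast
    moreover have "v \<rhd> d \<longleftrightarrow> v \<rhd> c" if "d \<in> K" for d
      using module_in[OF k(1), of v d c] v c that by blast
    ultimately show "v \<rhd> b" using v by blast
  qed
  have sub: "M1 \<subseteq> M"
  proof (rule ccontr)
    assume "\<not> M1 \<subseteq> M"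
    then have "M \<union> K \<noteq> V" using M1V by (auto simp: K_def)
    moreover have "2 \<le> card (M \<union> K)"
      using k(2) card_mono[of "M \<union> K" K] finite_subV[of "M \<union> K"] n k by auto
    ultimately have "comodule G (V - (M \<union> K))"
      using mod nontrivial_compl_imp_comodule by (auto simp: nontrivial_module_def)
    moreover have "V - (M \<union> K) \<subseteq> M1" by (auto simp: K_def)
    ultimately have "V - (M \<union> K) = M1" using min_comoduleD(5)[OF M1(1)] by blast
    then show False using xy n by blast
  qed
  have "v \<in> M" if v: "v \<in> V" "v \<noteq> y" for v
  proof (rule ccontr)
    assume vM: "v \<notin> M"
    then have vK: "v \<in> K" using v sub by (auto simp: K_def)
    \<comment> \<open>\<open>v\<close> sees all of \<open>M1\<close> alike, and since
      \<open>K\<close> is a module, so does every vertex of \<open>K\<close>.\<close>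
    have "is_module G M1"
    proof (rule is_moduleI)
      fix w a b assume w: "w \<in> V" "w \<notin> M1" "a \<in> M1" "b \<in> M1" "w \<rhd> a"
      then have wK: "w \<in> K" "a \<notin> K" "b \<notin> K" by (auto simp: K_def)
      have "v \<rhd> a" using module_out[OF k(1), of a w v] w wK M1V vK by blast
      then have "v \<rhd> b" using new_module_in[OF new, of v a b] v vM w sub by blast
      then show "w \<rhd> b" using module_out[OF k(1), of b w v] w wK M1V vK by blast
    qed (use M1V in auto)
    then show False using M1 yK M1V by (auto simp: nontrivial_module_def K_def)
  qed
  then show ?thesis using n by blast
qed

text \<open>A vertex of \<open>M\<close> other than \<open>y\<close> in the module
  \<open>V - M1\<close> would be seen by \<open>x\<close> like \<open>y\<close>, which the reversal
  forbids. The last claim compares \<open>y\<close> with a vertex of \<open>M\<close> inside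
  \<open>M1\<close>, which all of \<open>V - M1\<close> dominates because \<open>y\<close>
  does.\<close>

lemma new_module_compl_right:
  assumes M1: "min_comodule G M1" "\<not> nontrivial_module G M1" and x: "x \<in> M1"
    and M2: "min_comodule G {v, y}" "nontrivial_module G {v, y}" "v \<rhd> y" "{v, y} \<inter> M1 = {}"
    and new: "new_module G y x M"
  shows "M - {y} \<subseteq> M1" "\<And>z. z \<in> M \<Longrightarrow> z \<noteq> y \<Longrightarrow> y \<rhd> z" "\<And>l. l \<in> V - M1 - {y} \<Longrightarrow> l \<rhd> y"
proof -
  note n = new_moduleD[OF new]
  define K where "K = V - M1"
  have nt: "nontrivial_module G K" using M1 by (auto simp: min_comodule_def comodule_def K_def)
  note k = nontrivial_moduleD[OF nt]
  have yK: "y \<in> K" using M2 min_comoduleD(2)[OF M2(1)] by (auto simp: K_def)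
  have "x \<notin> {v, y}" using x M2 by blast
  note t = new_module_twin[OF new M2(1-3) this]
  have "z \<in> M1" if z: "z \<in> M" "z \<noteq> y" for z
  proof (rule ccontr)
    assume "z \<notin> M1"
    then have "z \<in> K" using z n by (auto simp: K_def)
    then have "x \<rhd> z \<longleftrightarrow> x \<rhd> y" using module_in[OF k(1), of x z y] x yK n by (auto simp: K_def)
    moreover have "x \<rhd> z \<longleftrightarrow> y \<rhd> x" using n(9) z by blast
    ultimately show False using arc_total[of x y] arc_asym n by blast
  qed
  then show 1: "M - {y} \<subseteq> M1" by blast
  show 2: "\<And>z. z \<in> M \<Longrightarrow> z \<noteq> y \<Longrightarrow> y \<rhd> z" using t(3) .
  fix l assume l: "l \<in> V - M1 - {y}"
  obtain z where z: "z \<in> M" "z \<noteq> y" using new_module_ex[OF new] .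
  have zK: "z \<in> V" "z \<notin> K" "l \<in> K" "l \<notin> M" using z 1 n l by (auto simp: K_def)
  have "l \<rhd> z" using module_out[OF k(1), of z y l] zK yK 2[OF z] by blast
  then show "l \<rhd> y" using new_module_in[OF new, of l y z] zK z n l x by blast
qed

end

section \<open>Safe pairs of vertices\<close>

lemma pverts_dual [simp]: "pverts (dual T) = pverts T"
  by (simp add: dual_def)

lemma parcs_dual [simp]: "(a, b) \<in> parcs (dual T) \<longleftrightarrow> (b, a) \<in> parcs T"
  by (simp add: dual_def)

lemma dual_dual [simp]: "dual (dual T) = T"
  by (simp add: dual_def)

context tournament
begin

section \<open>Invariance under duality\<close>

lemma tournament_dual: "tournament (dual G)"
proof unfold_locales
  show "finite (pverts (dual G))" "finite (parcs (dual G))"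
    using pair_finite_verts pair_finite_arcs by (auto simp: dual_def)
  show "\<And>e. e \<in> parcs (dual G) \<Longrightarrow> fst e \<in> pverts (dual G)"
    "\<And>e. e \<in> parcs (dual G) \<Longrightarrow> snd e \<in> pverts (dual G)"
    "\<And>e. e \<in> parcs (dual G) \<Longrightarrow> fst e \<noteq> snd e"
    using arc_V by (auto simp: dual_def)
  show "(x, y) \<in> parcs (dual G) \<longleftrightarrow> (y, x) \<notin> parcs (dual G)"
    if "x \<in> pverts (dual G)" "y \<in> pverts (dual G)" "x \<noteq> y" for x y
    using that arc_total[of x y] arc_asym[of x y] by auto
qed

lemma is_module_dual: "is_module (dual G) M \<longleftrightarrow> is_module G M"
proof
  assume M: "is_module G M"
  show "is_module (dual G) M"
    unfolding is_module_def pverts_dual parcs_dual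
  proof (intro conjI ballI)
    show "a \<rhd> v \<longleftrightarrow> b \<rhd> v" if "a \<in> M" "b \<in> M" "v \<in> V - M" for a b v
      using that by (intro module_out[OF M]) auto
  qed (rule module_subset[OF M])
next
  assume M: "is_module (dual G) M"
  show "is_module G M"
    unfolding is_module_def
  proof (intro conjI ballI)
    show "v \<rhd> a \<longleftrightarrow> v \<rhd> b" if "a \<in> M" "b \<in> M" "v \<in> V - M" for a b v
      using tournament.module_out[OF tournament_dual M, of v a b] that by simp
    show "M \<subseteq> V" using tournament.module_subset[OF tournament_dual M] by simp
  qed
qed

lemma nontrivial_module_dual: "nontrivial_module (dual G) M \<longleftrightarrow> nontrivial_module G M"
  by (simp add: nontrivial_module_def is_module_dual)

lemma comodule_dual: "comodule (dual G) = comodule G"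
  by (rule ext) (simp add: comodule_def nontrivial_module_dual)

lemma min_comodule_dual: "min_comodule (dual G) M \<longleftrightarrow> min_comodule G M"
  by (simp add: min_comodule_def comodule_dual)

lemma new_module_dual_imp:
  assumes "new_module G x y M"
  shows "new_module (dual G) x y M"
proof -
  note n = new_moduleD[OF assms]
  have 1: "a \<rhd> v \<longleftrightarrow> b \<rhd> v" if "v \<in> V - M - {y}" "a \<in> M" "b \<in> M" for v a b
  proof -
    have "v \<noteq> a" "v \<noteq> b" "a \<in> V" "b \<in> V" "v \<in> V" using that n by auto
    then show ?thesis
      using new_module_in[OF assms, of v a b] that arc_total[of v a] arc_total[of v b] by blast
  qed
  have 2: "z \<rhd> y \<longleftrightarrow> y \<rhd> x" if "z \<in> M - {x}" for z
  proof -
    have "z \<in> V" "z \<noteq> y" using that n by auto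
    then show ?thesis using n(9)[of z] that arc_total[of y z] arc_total[of x y] n by blast
  qed
  show ?thesis unfolding new_module_def pverts_dual parcs_dual
  proof (intro conjI ballI)
    show "a \<rhd> v \<longleftrightarrow> b \<rhd> v" if "v \<in> V - M - {y}" "a \<in> M" "b \<in> M" for v a b using 1[OF that] .
    show "z \<rhd> y \<longleftrightarrow> y \<rhd> x" if "z \<in> M - {x}" for z using 2[OF that] .
  qed (use n in auto)
qed

lemma new_module_dual: "new_module (dual G) x y M \<longleftrightarrow> new_module G x y M"
  using new_module_dual_imp tournament.new_module_dual_imp[OF tournament_dual] by fastforce

lemma safe_dual: "safe (dual G) x y \<longleftrightarrow> safe G x y"
  by (simp add: safe_def new_module_dual)

text \<open>The complement is the module here. Thus singleton comodules are sources or
  sinks.\<close>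

lemma singleton_comodule_uniform:
  assumes "comodule G {t}" "a \<in> V - {t}" "b \<in> V - {t}"
  shows "t \<rhd> a \<longleftrightarrow> t \<rhd> b"
proof -
  have "\<not> nontrivial_module G {t}" by (simp add: nontrivial_module_def)
  then have "nontrivial_module G (V - {t})" "t \<in> V" using assms by (auto simp: comodule_def)
  then show ?thesis using module_in[OF nontrivial_moduleD(1), of "V - {t}" t a b] assms by blast
qed

text \<open>Otherwise the two sets are disjoint. A vertex \<open>m\<close> of \<open>M2\<close> sees
  \<open>M1\<close> uniformly because \<open>M1\<close> lies in the module \<open>V - M2\<close>,
  and all of \<open>V - M1\<close> behaves like \<open>m\<close>, so \<open>M1\<close> would be a
  module. In a canonical family, a complement block with two or more elements thus leaves only
  modules besides it.\<close>

lemma compl_type_unique: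
  assumes M1: "min_comodule G M1" "\<not> nontrivial_module G M1" "2 \<le> card M1"
    and M2: "min_comodule G M2" "\<not> nontrivial_module G M2"
  shows "M1 = M2"
proof (rule ccontr)
  assume ne: "M1 \<noteq> M2"
  have disj: "M1 \<inter> M2 = {}" using min_comodules_meet(1)[OF M1(1) M2(1) ne] M1 by blast
  have nt: "nontrivial_module G (V - M1)" "nontrivial_module G (V - M2)"
    using M1 M2 by (auto simp: min_comodule_def comodule_def)
  note k = nontrivial_moduleD(1)[OF nt(1)] nontrivial_moduleD(1)[OF nt(2)]
  note sub = min_comoduleD(2)[OF M1(1)] min_comoduleD(2)[OF M2(1)]
  obtain m where m: "m \<in> M2" using min_comoduleD(4)[OF M2(1)] by blast
  have "is_module G M1"
  proof (rule is_moduleI)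
    fix v a b assume v: "v \<in> V" "v \<notin> M1" "a \<in> M1" "b \<in> M1" "v \<rhd> a"
    have m': "m \<in> V - M1" "a \<in> V - M2" "b \<in> V - M2" "m \<notin> V - M2" "a \<notin> V - M1" "b \<notin> V - M1"
      "a \<in> V" "b \<in> V"
      using m v disj sub by blast+
    have "m \<rhd> a" using module_out[OF k(1), of a v m] v m' by blast
    then have "m \<rhd> b" using module_in[OF k(2), of m a b] m' by blast
    then show "v \<rhd> b" using module_out[OF k(1), of b v m] v m' by blast
  qed (use sub in auto)
  then show False using M1 nt(1) m disj sub by (auto simp: nontrivial_module_def)
qed

lemma card_2_good_rep:
  assumes "nontrivial_module G M" "card M = 2" "good_rep G M x"
  obtains u where "M = {u, x}" "u \<rhd> x"
  using assms by (auto simp: good_rep_def)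

text \<open>A conflict needs a two-element module on the side of the new set and exactly three
  elements on the other side.\<close>

lemma safe_modules_same_kind:
  assumes M1: "min_comodule G M1" "nontrivial_module G M1" "good_rep G M1 x"
    and M2: "min_comodule G M2" "nontrivial_module G M2" "good_rep G M2 y"
    and disj: "M1 \<inter> M2 = {}" and same: "card M1 = 2 \<longleftrightarrow> card M2 = 2"
  shows "safe G x y"
proof -
  have *: "\<not> new_module G x y M"
    if M1: "min_comodule G M1" "nontrivial_module G M1" "good_rep G M1 x"
    and M2: "min_comodule G M2" "nontrivial_module G M2" "good_rep G M2 y"
    and disj: "M1 \<inter> M2 = {}" and same: "card M1 = 2 \<longleftrightarrow> card M2 = 2" for M1 M2 x y M
  proof
    assume new: "new_module G x y M"
    have xy: "x \<in> M1" "y \<in> M2" "y \<notin> M1" using M1 M2 disj by (auto simp: good_rep_def)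
    have "\<not> 3 \<le> card M1" using not_new_module_big[OF M1(1,2)] new xy by blast
    then have c: "card M1 = 2" using nontrivial_moduleD(2)[OF M1(2)] by simp
    obtain u where u: "M1 = {u, x}" "u \<rhd> x" using card_2_good_rep[OF M1(2) c M1(3)] .
    have "card M2 = 3"
      using new_module_twin_cases(1)[OF new _ _ u(2) M2(1,2) _ M2(3)] M1 u(1) disj by simp
    then show False using c same by simp
  qed
  show ?thesis unfolding safe_def using *[OF M1 M2 disj same] *[OF M2 M1] disj same by blast
qed

text \<open>The direction of the arc is recorded because it contradicts the one given by
  \<open>not_safe_compl\<close> when both conflicts occur at \<open>x\<close>.\<close>

lemma not_safe_twin_big:
  assumes M1: "min_comodule G M1" "nontrivial_module G M1" "good_rep G M1 x" "card M1 = 2"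
    and M2: "min_comodule G M2" "nontrivial_module G M2" "good_rep G M2 y" "card M2 \<noteq> 2"
    and disj: "M1 \<inter> M2 = {}" and "\<not> safe G x y"
  shows "card M2 = 3" "is_module G (M1 \<union> M2)" "x \<rhd> y"
proof -
  have xy: "x \<in> M1" "y \<in> M2" "y \<notin> M1" "x \<notin> M2" using M1 M2 disj by (auto simp: good_rep_def)
  have "3 \<le> card M2" using M2 nontrivial_moduleD(2)[OF M2(2)] by simp
  then have "\<not> new_module G y x M" for M using not_new_module_big[OF M2(1,2)] xy by blast
  then obtain M where new: "new_module G x y M" using \<open>\<not> safe G x y\<close> by (auto simp: safe_def)
  obtain u where u: "M1 = {u, x}" "u \<rhd> x" using card_2_good_rep[OF M1(2,4,3)] .
  show "card M2 = 3" "is_module G (M1 \<union> M2)" "x \<rhd> y"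
    using new_module_twin_cases[OF new _ _ u(2) M2(1,2) _ M2(3)] M1 u(1) disj by simp_all
qed

lemma not_safe_source:
  assumes s: "is_source s" and M2: "min_comodule G M2" "nontrivial_module G M2" "good_rep G M2 y"
    and "s \<notin> M2" and "\<not> safe G s y"
  shows "card M2 = 3" "is_module G ({s} \<union> M2)"
proof -
  have y: "y \<in> M2" using M2 by (auto simp: good_rep_def)
  obtain M where new: "new_module G s y M"
    using \<open>\<not> safe G s y\<close> not_new_module_source[OF s] by (auto simp: safe_def)
  obtain b where b: "b \<in> M2" "b \<noteq> y" "\<not> y \<rhd> b" using good_rep_not_dominating[OF M2] .
  note c = new_module_source_cases[OF s new M2(1,2) \<open>s \<notin> M2\<close> y b]
  show "is_module G ({s} \<union> M2)" using c(2) .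
  show "card M2 = 3" using c(1,3) M2(2,3) unfolding good_rep_def by force
qed

text \<open>The choice made by \<open>good_rep\<close> is not invariant under duality. This variant
  for arbitrary \<open>y\<close> is applied in \<open>dual G\<close>, where a sink becomes a
  source.\<close>

lemma not_safe_source_big:
  assumes s: "is_source s" and M2: "min_comodule G M2" "nontrivial_module G M2" "y \<in> M2" "3 \<le> card M2"
    and "s \<notin> M2" and "\<not> safe G s y"
  shows "is_module G ({s} \<union> M2)"
proof -
  obtain M where new: "new_module G s y M"
    using \<open>\<not> safe G s y\<close> not_new_module_source[OF s] by (auto simp: safe_def)
  obtain b where b: "b \<in> M2" "b \<noteq> y" "\<not> y \<rhd> b"
    using min_comodule_no_uniform[OF M2(1) nontrivial_moduleD(1)[OF M2(2)] M2(4,3)] by blast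
  show ?thesis using new_module_source_cases(2)[OF s new M2(1,2) \<open>s \<notin> M2\<close> M2(3) b] .
qed

text \<open>If the new set contains \<open>x\<close>, it is \<open>V - {y}\<close>; then
  \<open>y\<close> treats all vertices but \<open>x\<close> alike, and the vertex \<open>b\<close>
  of \<open>M2\<close> gives the direction. If it contains \<open>y\<close>, then \<open>M2\<close>
  has two elements and \<open>new_module_compl_right\<close> applies.\<close>

lemma not_safe_compl:
  assumes M1: "min_comodule G M1" "\<not> nontrivial_module G M1" "2 \<le> card M1" and x: "x \<in> M1"
    and M2: "min_comodule G M2" "nontrivial_module G M2" "good_rep G M2 y"
    and disj: "M1 \<inter> M2 = {}" and "\<not> safe G x y" and l: "l \<in> V - M1 - {y}"
  shows "l \<rhd> y"
proof -
  have y: "y \<in> M2" "y \<in> V - M1" using M2 disj min_comoduleD(2)[OF M2(1)] by (auto simp: good_rep_def)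
  have M2K: "M2 \<subseteq> V - M1" using min_comoduleD(2)[OF M2(1)] disj by blast
  obtain b where b: "b \<in> M2" "b \<noteq> y" "\<not> y \<rhd> b" using good_rep_not_dominating[OF M2] .
  consider M where "new_module G x y M" | M where "new_module G y x M"
    using \<open>\<not> safe G x y\<close> by (auto simp: safe_def)
  then show ?thesis
  proof cases
    case 1
    then have "M = V - {y}" using new_module_compl_left[OF M1 x y(2)] by blast
    then have *: "y \<rhd> z \<longleftrightarrow> x \<rhd> y" if "z \<in> V - {x, y}" for z
      using new_moduleD(9)[OF 1, of z] that by blast
    have "b \<in> V - {x, y}" "l \<in> V - {x, y}" using b l M2K x by blast+
    then have "\<not> y \<rhd> l" using * b by blast
    then show ?thesis using arc_total[of y l] l y by blast
  next
    case 2
    have "x \<notin> M2" using x disj by blast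
    then have "\<not> 3 \<le> card M2" using not_new_module_big[OF M2(1,2) _ y(1)] 2 by blast
    then have c: "card M2 = 2" using nontrivial_moduleD(2)[OF M2(2)] by simp
    obtain v where v: "M2 = {v, y}" "v \<rhd> y" using card_2_good_rep[OF M2(2) c M2(3)] .
    show ?thesis
      using new_module_compl_right(3)[OF M1(1,2) x _ _ v(2) _ 2 l] M2 v(1) disj by (simp add: Int_commute)
  qed
qed

text \<open>A vertex dominated by the rest of the module \<open>V - M1\<close> can be removed from
  it; with three elements at the start, two remain. The complement of what is left is the
  comodule.\<close>

lemma compl_type_insert_comodule:
  assumes M1: "min_comodule G M1" "\<not> nontrivial_module G M1"
    and K: "3 \<le> card (V - M1)" and y: "y \<in> V - M1" "\<And>l. l \<in> V - M1 - {y} \<Longrightarrow> l \<rhd> y"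
  shows "comodule G (insert y M1)"
proof -
  have "nontrivial_module G (V - M1)" using M1 by (auto simp: min_comodule_def comodule_def)
  then have "is_module G (V - M1 - {y})"
    using y arc_asym by (intro module_minus_uniform) (auto dest: nontrivial_moduleD)
  moreover have "2 \<le> card (V - M1 - {y})" using card_ge_3_minus[OF K y(1)] .
  ultimately have "comodule G (V - (V - M1 - {y}))"
    using y(1) by (intro nontrivial_compl_imp_comodule) (auto simp: nontrivial_module_def)
  moreover have "V - (V - M1 - {y}) = insert y M1" using y min_comoduleD(2)[OF M1(1)] by blast
  ultimately show ?thesis by simp
qed

text \<open>If two modules \<open>A\<close> and \<open>B\<close> overlap, then each vertex of \<open>A \<inter> B\<close> lies between those of
  \<open>A - B\<close> and \<open>B - A\<close>. Here this would place the four vertices in contradictory orders, which is a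
  propositional problem about their six arcs.\<close>

lemma no_three_comodules:
  assumes Q: "comodule G Q2" "comodule G Q3" "comodule G Q4"
    and w: "w1 \<in> Q2" "w1 \<in> Q3" "w1 \<in> Q4"
      "w2 \<in> Q2" "w2 \<notin> Q3" "w2 \<notin> Q4" "w2 \<in> V"
      "w3 \<notin> Q2" "w3 \<in> Q3" "w3 \<notin> Q4" "w3 \<in> V"
      "w4 \<notin> Q2" "w4 \<notin> Q3" "w4 \<in> Q4" "w4 \<in> V"
  shows False
proof -
  \<comment> \<open>Whichever of \<open>Q\<close> and \<open>V - Q\<close> is the module, its
    consequence for two vertices on each side is this disjunction. Together with totality of the
    arcs it is all that the contradiction uses.\<close>
  have *: "(c \<rhd> a \<longleftrightarrow> c \<rhd> b) \<and> (d \<rhd> a \<longleftrightarrow> d \<rhd> b) \<or> (a \<rhd> c \<longleftrightarrow> a \<rhd> d) \<and> (b \<rhd> c \<longleftrightarrow> b \<rhd> d)"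
    if Q: "comodule G Q" "a \<in> Q" "b \<in> Q" "c \<notin> Q" "d \<notin> Q" "c \<in> V" "d \<in> V" for Q a b c d
  proof -
    consider "is_module G Q" | "is_module G (V - Q)"
      using Q by (auto simp: comodule_def nontrivial_module_def)
    then show ?thesis
    proof cases
      case 1
      then show ?thesis using module_in[OF 1, of c a b] module_in[OF 1, of d a b] Q by blast
    next
      case 2
      have "a \<in> V" "b \<in> V" using Q comodule_subset by blast+
      then show ?thesis using module_in[OF 2, of a c d] module_in[OF 2, of b c d] Q by blast
    qed
  qed
  have V: "w1 \<in> V" using w Q comodule_subset by blast
  have ne: "w1 \<noteq> w2" "w1 \<noteq> w3" "w1 \<noteq> w4" "w2 \<noteq> w3" "w2 \<noteq> w4" "w3 \<noteq> w4" using w by auto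
  note t = arc_total[OF V w(7) ne(1)] arc_total[OF V w(11) ne(2)] arc_total[OF V w(15) ne(3)]
    arc_total[OF w(7,11) ne(4)] arc_total[OF w(7,15) ne(5)] arc_total[OF w(11,15) ne(6)]
  show False
    using *[OF Q(1), of w1 w2 w3 w4] *[OF Q(2), of w1 w3 w2 w4] *[OF Q(3), of w1 w4 w2 w3] w t
    by argo
qed

text \<open>If both pairs fail, there are new sets \<open>N1\<close> and \<open>N2\<close> that
  contain \<open>y\<close> and miss \<open>x1\<close> and \<open>x2\<close> respectively. Take
  \<open>z1\<close> and \<open>z2\<close> in them besides \<open>y\<close>: each is dominated by
  \<open>y\<close> and lies outside the other set, so neither can dominate the other.\<close>

lemma safe_small_compl_out:
  assumes M1: "min_comodule G M1" "\<not> nontrivial_module G M1" "2 \<le> card M1"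
    and K: "V - M1 = {v, y}" "v \<rhd> y"
    and x: "x1 \<in> M1" "x2 \<in> M1" "x1 \<noteq> x2" "x1 \<rhd> y" "x2 \<rhd> y"
  shows "safe G x1 y \<or> safe G x2 y"
proof (rule ccontr)
  assume a: "\<not> ?thesis"
  have nt: "nontrivial_module G {v, y}"
    using M1 K by (auto simp: min_comodule_def comodule_def)
  have yV: "y \<in> V - M1" "v \<in> V - M1" "v \<noteq> y" using K by auto
  have minK: "min_comodule G {v, y}"
  proof -
    obtain N where N: "N \<subseteq> {v, y}" "min_comodule G N"
      using ex_min_comodule[OF nontrivial_imp_comodule[OF nt]] .
    have "N \<noteq> M1" using N min_comoduleD(4)[OF M1(1)] K by blast
    then have "nontrivial_module G N" using compl_type_unique[OF M1 N(2)] by blast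
    then have "card {v, y} \<le> card N" using nontrivial_moduleD(2)[of N] yV by (simp add: numeral_2_eq_2)
    then have "N = {v, y}" using N(1) card_seteq[of "{v, y}" N] by simp
    then show ?thesis using N(2) by simp
  qed
  have disj: "{v, y} \<inter> M1 = {}" using K by blast
  \<comment> \<open>A new set containing \<open>x\<close> would be \<open>V - {y}\<close> and
    contain \<open>v\<close>, but \<open>v \<rhd> y\<close> contradicts \<open>x \<rhd> y\<close>
    there. So the new set contains \<open>y\<close>.\<close>
  have *: "\<exists>M. new_module G y x M" if x: "x \<in> M1" "x \<rhd> y" "\<not> safe G x y" for x
  proof -
    have "\<not> new_module G x y M" for M
    proof
      assume new: "new_module G x y M"
      have "v \<in> M" "v \<noteq> x" using new_module_compl_left[OF M1 x(1) yV(1) new] yV x by blast+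
      then show False using new_moduleD(9)[OF new] x(2) K(2) arc_asym by blast
    qed
    then show ?thesis using x by (auto simp: safe_def)
  qed
  have **: "\<exists>z\<in>M1. z \<in> M \<and> z \<noteq> y \<and> y \<rhd> z \<and> x' \<rhd> z \<and> x' \<notin> M" "\<And>z. z \<in> M \<Longrightarrow> z \<noteq> y \<Longrightarrow> \<not> x \<rhd> z"
    if h: "x \<in> M1" "x' \<in> M1" "x \<noteq> x'" "x \<rhd> y" "x' \<rhd> y" "new_module G y x M" for x x' M
  proof -
    note n = new_moduleD[OF h(6)]
    note r = new_module_compl_right[OF M1(1,2) h(1) minK nt K(2) disj h(6)]
    obtain z where z: "z \<in> M" "z \<noteq> y" using new_module_ex[OF h(6)] .
    have "x' \<notin> M" using r(2) h(5) arc_asym yV h(2) by blast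
    moreover have "x' \<rhd> z"
      using new_module_in[OF h(6), of x' y z] n z \<open>x' \<notin> M\<close> h min_comoduleD(2)[OF M1(1)] by blast
    ultimately show "\<exists>z\<in>M1. z \<in> M \<and> z \<noteq> y \<and> y \<rhd> z \<and> x' \<rhd> z \<and> x' \<notin> M"
      using z r by blast
    show "\<not> x \<rhd> z" if "z \<in> M" "z \<noteq> y" for z
      using n(9)[OF that] \<open>x \<rhd> y\<close> arc_asym by blast
  qed
  obtain N1 where N1: "new_module G y x1 N1" using * a x by blast
  obtain N2 where N2: "new_module G y x2 N2" using * a x by blast
  obtain z1 where z1: "z1 \<in> M1" "z1 \<in> N1" "z1 \<noteq> y" "y \<rhd> z1" "x2 \<rhd> z1" "x2 \<notin> N1"
    using **(1)[OF x(1,2,3,4,5) N1] by blast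
  obtain z2 where z2: "z2 \<in> M1" "z2 \<in> N2" "z2 \<noteq> y" "y \<rhd> z2" "x1 \<rhd> z2" "x1 \<notin> N2"
    using **(1)[OF x(2,1) _ x(5,4) N2] x(3) by blast
  have out: "z2 \<notin> N1" "z1 \<notin> N2"
    using **(2)[OF x(1,2,3,4,5) N1] **(2)[OF x(2,1) _ x(5,4) N2] x(3) z1 z2 by blast+
  have V: "z1 \<in> V" "z2 \<in> V" "z1 \<noteq> z2" "z2 \<noteq> x1" "z1 \<noteq> x2"
    using z1 z2 out min_comoduleD(2)[OF M1(1)] not_refl by blast+
  have "\<not> z2 \<rhd> z1" using new_module_in[OF N1, of z2 y z1] V out z1 z2 new_moduleD(2)[OF N1] arc_asym by blast
  moreover have "\<not> z1 \<rhd> z2" using new_module_in[OF N2, of z1 y z2] V out z1 z2 new_moduleD(2)[OF N2] arc_asym by blast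
  ultimately show False using arc_total V by blast
qed

end

text \<open>This serves when the module \<open>V - M1\<close> has just two elements, so that no
  vertex can be removed from it. Among three vertices of \<open>M1\<close>, two lie on the same side
  of \<open>y\<close>; duality exchanges the sides.\<close>

lemma (in tournament) safe_small_compl:
  assumes M1: "min_comodule G M1" "\<not> nontrivial_module G M1" "3 \<le> card M1"
    and K: "card (V - M1) = 2"
  shows "\<exists>x\<in>M1. \<exists>y\<in>V - M1. safe G x y"
proof -
  have nt: "nontrivial_module G (V - M1)"
    using M1 by (auto simp: min_comodule_def comodule_def)
  have M1V: "M1 \<subseteq> V" using min_comoduleD(2)[OF M1(1)] .
  obtain v y where "V - M1 = {v, y}" "v \<noteq> y" using K card_2_iff by metis
  then obtain v y where vy: "V - M1 = {v, y}" "v \<rhd> y" using arc_total[of v y] by (metis Diff_iff insert_commute insert_iff)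
  have c2: "2 \<le> card M1" using M1 by simp
  have V: "y \<in> V - M1" "v \<in> V - M1" using vy by auto
  define A where "A = {x \<in> M1. x \<rhd> y}"
  define B where "B = {x \<in> M1. \<not> x \<rhd> y}"
  have f: "finite M1" using min_comoduleD(3)[OF M1(1)] .
  have "card (A \<union> B) = card A + card B" by (intro card_Un_disjoint) (use f in \<open>auto simp: A_def B_def\<close>)
  also have "A \<union> B = M1" by (auto simp: A_def B_def)
  finally have "2 \<le> card A \<or> 2 \<le> card B" using M1(3) by linarith
  then show ?thesis
  proof
    assume "2 \<le> card A"
    then obtain x1 x2 where x: "x1 \<in> A" "x2 \<in> A" "x1 \<noteq> x2"
      using card_le_Suc0_iff_eq[of A] f by (auto simp: A_def numeral_2_eq_2)
    then show ?thesis using safe_small_compl_out[OF M1(1,2) c2 vy, of x1 x2] V by (auto simp: A_def)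
  next
    assume "2 \<le> card B"
    then obtain x1 x2 where x: "x1 \<in> B" "x2 \<in> B" "x1 \<noteq> x2"
      using card_le_Suc0_iff_eq[of B] f by (auto simp: B_def numeral_2_eq_2)
    \<comment> \<open>In the dual, \<open>v\<close> is the head of the arc of \<open>V - M1\<close>,
      and the vertices of \<open>B\<close> must be shown to dominate it.\<close>
    have "v \<rhd> b" if "b \<in> B" for b
    proof -
      have "b \<in> M1" "b \<noteq> y" "b \<in> V" "\<not> b \<rhd> y" using that V M1V by (auto simp: B_def)
      then have "y \<rhd> b" using arc_total[of b y] V by blast
      then show ?thesis using module_out[OF nontrivial_moduleD(1)[OF nt], of b y v] V \<open>b \<in> M1\<close> \<open>b \<in> V\<close> by blast
    qed
    then have "safe (dual G) x1 v \<or> safe (dual G) x2 v"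
      using tournament.safe_small_compl_out[OF tournament_dual, of M1 y v x1 x2] M1 c2 vy x
      by (auto simp: min_comodule_dual nontrivial_module_dual B_def insert_commute)
    then show ?thesis using x V by (auto simp: safe_dual B_def)
  qed
qed

section \<open>Hitting sets and the upper bound\<close>

definition hitting :: "'a pair_pre_digraph \<Rightarrow> 'a set \<Rightarrow> bool" where
  "hitting T H \<longleftrightarrow> (\<forall>Q. comodule T Q \<longrightarrow> Q \<inter> H \<noteq> {})"

text \<open>Such a family is a packing whose representatives form a hitting set, so its size is both
  the largest size of a packing and the least size of a hitting set.\<close>

definition canonical :: "'a pair_pre_digraph \<Rightarrow> 'a set set \<Rightarrow> ('a set \<Rightarrow> 'a) \<Rightarrow> bool" where
  "canonical T D r \<longleftrightarrow> (\<forall>M\<in>D. min_comodule T M \<and> good_rep T M (r M)) \<and>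
     (\<forall>M\<in>D. \<forall>N\<in>D. M \<noteq> N \<longrightarrow> M \<inter> N = {}) \<and> hitting T (r ` D)"

context tournament
begin

text \<open>Otherwise follow the witnesses from \<open>w\<close> to \<open>z1\<close>,
  \<open>z2\<close> and \<open>z3\<close>. Within \<open>M\<close> only \<open>w\<close> dominates
  \<open>z1\<close>, so \<open>z3 = w\<close>. The cycle \<open>w\<close>, \<open>z1\<close>,
  \<open>z2\<close> then dominates the rest of \<open>M\<close> and is a module with three
  elements.\<close>

lemma ex_good_rep_big:
  assumes M: "min_comodule G M" "nontrivial_module G M" "4 \<le> card M"
  shows "\<exists>y\<in>M. \<not> (\<exists>z\<in>M. y \<rhd> z \<and> (\<forall>b\<in>M - {y, z}. z \<rhd> b))"
proof (rule ccontr)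
  assume "\<not> ?thesis"
  then have *: "\<exists>z\<in>M. y \<rhd> z \<and> (\<forall>b\<in>M - {y, z}. z \<rhd> b)" if "y \<in> M" for y using that by blast
  note m = nontrivial_moduleD[OF M(2)]
  obtain w where w: "w \<in> M" using min_comoduleD(4)[OF M(1)] by blast
  obtain z1 where z1: "z1 \<in> M" "w \<rhd> z1" "\<And>b. b \<in> M - {w, z1} \<Longrightarrow> z1 \<rhd> b" using *[OF w] by blast
  obtain z2 where z2: "z2 \<in> M" "z1 \<rhd> z2" "\<And>b. b \<in> M - {z1, z2} \<Longrightarrow> z2 \<rhd> b" using *[OF z1(1)] by blast
  obtain z3 where z3: "z3 \<in> M" "z2 \<rhd> z3" "\<And>b. b \<in> M - {z2, z3} \<Longrightarrow> z3 \<rhd> b" using *[OF z2(1)] by blast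
  have ne: "w \<noteq> z1" "z1 \<noteq> z2" "z2 \<noteq> w" using z1(2) z2(2) arc_asym not_refl by blast+
  have "z3 \<noteq> z1" using z3(2) z2(2) arc_asym by blast
  then have "z3 \<rhd> z1" using z3(3)[of z1] z1(1) ne by blast
  then have "\<not> z1 \<rhd> z3" using arc_asym by blast
  then have "z3 = w" using z1(3)[of z3] z3(1) \<open>z3 \<noteq> z1\<close> by blast
  then have out: "x \<rhd> b" if "b \<in> M - {w, z1, z2}" "x \<in> {w, z1, z2}" for x b
    using that z1(3)[of b] z2(3)[of b] z3(3)[of b] by blast
  have "is_module G {w, z1, z2}"
  proof (rule is_moduleI)
    show "{w, z1, z2} \<subseteq> V" using w z1 z2 m by blast
    fix v a b assume v: "v \<in> V" "v \<notin> {w, z1, z2}" "a \<in> {w, z1, z2}" "b \<in> {w, z1, z2}" "v \<rhd> a"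
    show "v \<rhd> b"
    proof (cases "v \<in> M")
      case True
      then show ?thesis using out[of v a] v arc_asym by blast
    next
      case False
      have "a \<in> M" "b \<in> M" using v w z1 z2 by blast+
      then show ?thesis using module_in[OF m(1), of v a b] False v by blast
    qed
  qed
  moreover have "card {w, z1, z2} = 3" using ne by simp
  moreover have "{w, z1, z2} \<subset> M"
  proof -
    have "{w, z1, z2} \<noteq> M" using M(3) \<open>card {w, z1, z2} = 3\<close> by fastforce
    then show ?thesis using w z1(1) z2(1) by blast
  qed
  ultimately show False using module_in_min_comodule[OF M(1)] by fastforce
qed

lemma ex_good_rep:
  assumes M: "min_comodule G M"
  shows "\<exists>y. good_rep G M y"
proof -
  obtain x where x: "x \<in> M" using min_comoduleD(4)[OF M] by blast
  consider "\<not> nontrivial_module G M" | "nontrivial_module G M" "card M = 2"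
    | "nontrivial_module G M" "4 \<le> card M" | "nontrivial_module G M" "card M = 3"
    using nontrivial_moduleD(2)[of M] by linarith
  then show ?thesis
  proof cases
    case 1
    then show ?thesis using x by (auto simp: good_rep_def)
  next
    case 2
    then obtain a b where ab: "M = {a, b}" "a \<noteq> b" using card_2_iff by metis
    then have "a \<rhd> b \<or> b \<rhd> a" using arc_total[of a b] min_comoduleD(2)[OF M] by blast
    then show ?thesis
    proof
      assume "a \<rhd> b"
      then have "good_rep G M b" using ab 2 by (auto simp: good_rep_def)
      then show ?thesis ..
    next
      assume "b \<rhd> a"
      then have "good_rep G M a" using ab 2 by (auto simp: good_rep_def)
      then show ?thesis ..
    qed
  next
    case 3
    then show ?thesis using ex_good_rep_big[OF M] by (auto simp: good_rep_def)
  next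
    case 4
    then show ?thesis using x by (auto simp: good_rep_def)
  qed
qed

section \<open>Paths of two-element minimal comodules\<close>

definition twins :: "('a \<times> 'a) set" where
  "twins = {(u, v). u \<rhd> v \<and> min_comodule G {u, v} \<and> nontrivial_module G {u, v}}"

lemma twinsD:
  assumes "(u, v) \<in> twins"
  shows "u \<rhd> v" "min_comodule G {u, v}" "nontrivial_module G {u, v}" "is_module G {u, v}"
  using assms by (auto simp: twins_def dest: nontrivial_moduleD)

text \<open>Two predecessors of \<open>v\<close> would dominate each other, since each sees the
  other as it sees \<open>v\<close>.\<close>

lemma twins_unique_pred:
  assumes "(u, v) \<in> twins" "(u', v) \<in> twins"
  shows "u = u'"
proof (rule ccontr)
  assume ne: "u \<noteq> u'"
  note d = twinsD[OF assms(1)] twinsD[OF assms(2)]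
  have "u' \<notin> {u, v}" "u \<notin> {u', v}" "u \<in> V" "u' \<in> V" using ne d arc_V not_refl by blast+
  then have "u' \<rhd> u" "u \<rhd> u'"
    using module_in[OF d(4), of u' u v] module_in[OF d(8), of u u' v] d(1,5) by blast+
  then show False using arc_asym by blast
qed

lemma twins_unique_succ:
  assumes "(u, v) \<in> twins" "(u, v') \<in> twins"
  shows "v = v'"
proof (rule ccontr)
  assume ne: "v \<noteq> v'"
  note d = twinsD[OF assms(1)] twinsD[OF assms(2)]
  have V: "v' \<notin> {u, v}" "v \<notin> {u, v'}" "v \<in> V" "v' \<in> V" using ne d arc_V not_refl by blast+
  then have "\<not> v' \<rhd> v" "\<not> v \<rhd> v'"
    using module_in[OF d(4), of v' u v] module_in[OF d(8), of v u v'] d(1,5) arc_asym by blast+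
  then show False using arc_total V by blast
qed

text \<open>In particular \<open>twins\<close> has no cycles, so no vertex is counted among its own
  predecessors.\<close>

lemma twins_trancl_arc: "(u, v) \<in> twins\<^sup>+ \<Longrightarrow> u \<rhd> v"
proof (induction rule: trancl_induct)
  case (base v)
  then show ?case using twinsD by blast
next
  case (step w v)
  note d = twinsD[OF step(2)]
  have "u \<notin> {w, v}" "u \<in> V" using step(3) d(1) arc_asym arc_V not_refl by blast+
  then show ?case using module_in[OF d(4), of u w v] step(3) by blast
qed

text \<open>The 2-element minimal comodules form the edges of disjoint paths. Numbering the vertices of
  each path from 0, the vertices in odd position hit all edges of the path, and the edges
  entering them are pairwise disjoint.\<close>

definition pos :: "'a \<Rightarrow> nat" where
  "pos v = card {u. (u, v) \<in> twins\<^sup>+}"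

lemma pos_Suc:
  assumes "(u, v) \<in> twins"
  shows "pos v = Suc (pos u)"
proof -
  have "{w. (w, v) \<in> twins\<^sup>+} = insert u {w. (w, u) \<in> twins\<^sup>+}"
  proof (intro set_eqI iffI)
    fix w assume "w \<in> {w. (w, v) \<in> twins\<^sup>+}"
    then obtain z where "(w, z) \<in> twins\<^sup>*" "(z, v) \<in> twins" using tranclD2[of w v] by blast
    then have "(w, u) \<in> twins\<^sup>*" using twins_unique_pred[OF assms] by blast
    then show "w \<in> insert u {w. (w, u) \<in> twins\<^sup>+}" by (auto dest: rtranclD)
  next
    fix w assume "w \<in> insert u {w. (w, u) \<in> twins\<^sup>+}"
    then show "w \<in> {w. (w, v) \<in> twins\<^sup>+}" using assms by (auto intro: trancl_into_trancl)
  qed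
  moreover have "u \<notin> {w. (w, u) \<in> twins\<^sup>+}" using twins_trancl_arc not_refl by blast
  moreover have "finite {w. (w, u) \<in> twins\<^sup>+}"
    using twins_trancl_arc arc_V by (intro finite_subV) blast
  ultimately show ?thesis by (simp add: pos_def)
qed

lemma odd_pos_pred:
  assumes "odd (pos v)"
  obtains u where "(u, v) \<in> twins"
proof -
  have "{u. (u, v) \<in> twins\<^sup>+} \<noteq> {}"
  proof
    assume "{u. (u, v) \<in> twins\<^sup>+} = {}"
    then show False using assms by (simp add: pos_def del: Collect_empty_eq)
  qed
  then show ?thesis using that tranclD2 by fast
qed

text \<open>All minimal comodules other than two-element modules are kept, and of the paths the
  edges with odd head. An omitted edge has an even head, so its tail is odd and represents the
  preceding edge.\<close>

lemma ex_canonical: "\<exists>D r. canonical G D r"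
proof -
  define D where "D = {M. min_comodule G M \<and> \<not> (nontrivial_module G M \<and> card M = 2)}
    \<union> {{u, v} | u v. (u, v) \<in> twins \<and> odd (pos v)}"
  define r where "r M = (SOME y. good_rep G M y)" for M
  have mc: "min_comodule G M" if "M \<in> D" for M using that twinsD by (auto simp: D_def)
  have gr: "good_rep G M (r M)" if "M \<in> D" for M
    unfolding r_def using ex_good_rep[OF mc[OF that]] by (rule someI_ex)
  have r_twin: "r {u, v} = v" if tw: "(u, v) \<in> twins" and uvD: "{u, v} \<in> D" for u v
  proof -
    have "u \<noteq> v" using twinsD[OF tw] by auto
    then obtain w where w: "{u, v} = {w, r {u, v}}" "w \<rhd> r {u, v}"
      using card_2_good_rep[OF twinsD(3)[OF tw] _ gr[OF uvD]] by auto
    then show ?thesis using twinsD(1)[OF tw] arc_asym by (metis doubleton_eq_iff)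
  qed
  have disj: "M \<inter> N = {}" if MN: "M \<in> D" "N \<in> D" "M \<noteq> N" for M N
  proof (rule ccontr)
    assume "M \<inter> N \<noteq> {}"
    note meet = min_comodules_meet[OF mc[OF MN(1)] mc[OF MN(2)] MN(3) this]
    obtain u v where uv: "M = {u, v}" "(u, v) \<in> twins" "odd (pos v)" using meet MN(1) by (auto simp: D_def)
    obtain u' v' where uv': "N = {u', v'}" "(u', v') \<in> twins" "odd (pos v')" using meet MN(2) by (auto simp: D_def)
    have "v \<noteq> v'" using twins_unique_pred uv uv' MN by blast
    moreover have "u \<noteq> u'" using twins_unique_succ uv uv' MN by blast
    \<comment> \<open>Heads of chosen edges have odd position and tails even position.\<close>
    moreover have "v \<noteq> u'" "u \<noteq> v'" using pos_Suc[OF uv(2)] pos_Suc[OF uv'(2)] uv(3) uv'(3) by auto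
    ultimately show False using \<open>M \<inter> N \<noteq> {}\<close> uv(1) uv'(1) by blast
  qed
  have hit: "Q \<inter> r ` D \<noteq> {}" if Q: "comodule G Q" for Q
  proof -
    obtain M where M: "M \<subseteq> Q" "min_comodule G M" using ex_min_comodule[OF Q] .
    show ?thesis
    proof (cases "M \<in> D")
      case True
      then have "r M \<in> M" using gr by (auto simp: good_rep_def)
      then show ?thesis using M True by blast
    next
      case False
      then have nt: "nontrivial_module G M" "card M = 2" using M by (auto simp: D_def)
      then obtain y where y: "good_rep G M y" using ex_good_rep[OF M(2)] by blast
      obtain u where u: "M = {u, y}" "u \<rhd> y" using card_2_good_rep[OF nt y] .
      then have tw: "(u, y) \<in> twins" using M nt by (simp add: twins_def)
      then have "even (pos y)" using False u by (auto simp: D_def)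
      then have "odd (pos u)" using pos_Suc[OF tw] by simp
      then obtain w where w: "(w, u) \<in> twins" using odd_pos_pred by blast
      then have "{w, u} \<in> D" using \<open>odd (pos u)\<close> by (auto simp: D_def)
      then have "u \<in> r ` D" using r_twin[OF w] by (metis imageI)
      then show ?thesis using u M by blast
    qed
  qed
  have "canonical G D r" unfolding canonical_def hitting_def using mc gr disj hit by blast
  then show ?thesis by blast
qed

lemma canonicalD:
  assumes "canonical G D r"
  shows "\<And>M. M \<in> D \<Longrightarrow> min_comodule G M" "\<And>M. M \<in> D \<Longrightarrow> good_rep G M (r M)"
    "\<And>M. M \<in> D \<Longrightarrow> r M \<in> M" "\<And>M. M \<in> D \<Longrightarrow> r M \<in> V"
    "\<And>M N. M \<in> D \<Longrightarrow> N \<in> D \<Longrightarrow> M \<noteq> N \<Longrightarrow> M \<inter> N = {}" "hitting G (r ` D)" "finite D" "inj_on r D"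
proof -
  show mc: "min_comodule G M" if "M \<in> D" for M using assms that by (auto simp: canonical_def)
  show gr: "good_rep G M (r M)" if "M \<in> D" for M using assms that by (auto simp: canonical_def)
  show rM: "r M \<in> M" if "M \<in> D" for M using gr[OF that] by (simp add: good_rep_def)
  show "r M \<in> V" if "M \<in> D" for M using rM[OF that] min_comoduleD(2)[OF mc[OF that]] by blast
  show disj: "M \<inter> N = {}" if "M \<in> D" "N \<in> D" "M \<noteq> N" for M N
    using assms that unfolding canonical_def by blast
  show "hitting G (r ` D)" using assms by (simp add: canonical_def)
  have "D \<subseteq> Pow V" using mc min_comoduleD(2) by blast
  then show "finite D" using pair_finite_verts finite_subset by blast
  show "inj_on r D" using rM disj by (intro inj_onI) (metis disjoint_iff)
qed

lemma canonical_card_le: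
  assumes D: "canonical G D r" and H: "hitting G H" "finite H"
  shows "card D \<le> card H"
proof -
  note c = canonicalD[OF D]
  have "\<exists>h. h \<in> M \<and> h \<in> H" if "M \<in> D" for M
    using H(1) min_comoduleD(1)[OF c(1)[OF that]] unfolding hitting_def by blast
  then obtain f where f: "\<And>M. M \<in> D \<Longrightarrow> f M \<in> M \<and> f M \<in> H" by metis
  then have "inj_on f D" using c(5) by (intro inj_onI) (metis disjoint_iff)
  then show ?thesis using f H(2) by (intro card_inj_on_le[of f]) auto
qed

text \<open>A comodule of the new tournament is an old one containing both or neither of
  \<open>x\<close> and \<open>y\<close>. The last hypothesis is about the first kind; the second
  kind meets \<open>H\<close> because the larger set is hitting.\<close>

lemma hitting_flip:
  assumes xy: "x \<in> V" "y \<in> V" "x \<noteq> y" "safe G x y" and H: "hitting G (insert x (insert y H))"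
    and Q: "\<And>Q. comodule G Q \<Longrightarrow> x \<in> Q \<Longrightarrow> y \<in> Q \<Longrightarrow> Q \<inter> H \<noteq> {}"
  shows "hitting (flip G x y) H"
  unfolding hitting_def
proof (intro allI impI)
  fix Q' assume "comodule (flip G x y) Q'"
  then have "comodule G Q'" "x \<in> Q' \<longleftrightarrow> y \<in> Q'" using flip_comodule xy by blast+
  then show "Q' \<inter> H \<noteq> {}" using Q H unfolding hitting_def by blast
qed

section \<open>The leading block of a canonical family\<close>

lemma is_source_comodule:
  assumes "is_source s" "3 \<le> card V"
  shows "comodule G {s}"
proof -
  have "is_module G (V - {s})"
    using assms by (intro is_moduleI) (auto simp: is_source_def)
  moreover have "2 \<le> card (V - {s})" using assms card_ge_3_minus by (auto simp: is_source_def)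
  ultimately have "comodule G (V - (V - {s}))"
    using assms by (intro nontrivial_compl_imp_comodule) (auto simp: nontrivial_module_def is_source_def)
  then show ?thesis using assms by (simp add: is_source_def double_diff)
qed

lemma min_comodule_card_1:
  assumes "min_comodule G M" "\<not> nontrivial_module G M" "\<not> 2 \<le> card M"
  obtains t where "M = {t}" "t \<in> V" "is_source t \<or> (\<forall>v\<in>V - {t}. v \<rhd> t)"
proof -
  note m = min_comoduleD[OF assms(1)]
  have "card M \<noteq> 0" using m by simp
  then have "card M = 1" using assms(3) by linarith
  then obtain t where t: "M = {t}" by (auto simp: card_1_singleton_iff)
  have "is_source t \<or> (\<forall>v\<in>V - {t}. v \<rhd> t)"
  proof (cases "\<exists>a\<in>V - {t}. t \<rhd> a")
    case True
    then obtain a where a: "a \<in> V - {t}" "t \<rhd> a" by blast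
    have "t \<rhd> v" if "v \<in> V - {t}" for v
      using singleton_comodule_uniform[of t a v] m(1) t a that by simp
    then show ?thesis using m(2) t by (simp add: is_source_def)
  next
    case False
    then have "v \<rhd> t" if "v \<in> V - {t}" for v using arc_total[of t v] that m(2) t by auto
    then show ?thesis by blast
  qed
  then show ?thesis using that t m(2) by blast
qed

text \<open>The block with which the others are paired. A large complement block or a source is
  preferred, so that every partner is a module or a sink. A sink in place of a source is handled by
  duality.\<close>

definition leading :: "'a set set \<Rightarrow> 'a set \<Rightarrow> bool" where
  "leading D M1 \<longleftrightarrow> (\<not> nontrivial_module G M1 \<and> 2 \<le> card M1) \<or> (\<exists>s. M1 = {s} \<and> is_source s) \<or>
     (\<forall>M\<in>D. nontrivial_module G M)"

lemma ex_leading: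
  assumes D: "canonical G D r" "D \<noteq> {}" and V: "3 \<le> card V"
    and sink: "\<And>t. t \<in> V \<Longrightarrow> \<forall>v\<in>V - {t}. v \<rhd> t \<Longrightarrow> \<exists>s. is_source s"
  obtains M1 where "M1 \<in> D" "leading D M1"
proof (cases "\<forall>M\<in>D. nontrivial_module G M \<or> 2 \<le> card M")
  case True
  then show ?thesis using that D(2) unfolding leading_def by blast
next
  case False
  note c = canonicalD[OF D(1)]
  obtain M where M: "M \<in> D" "\<not> nontrivial_module G M" "\<not> 2 \<le> card M" using False by blast
  obtain t where "t \<in> V" "is_source t \<or> (\<forall>v\<in>V - {t}. v \<rhd> t)"
    by (rule min_comodule_card_1[OF c(1)[OF M(1)] M(2,3)])
  then obtain s where s: "is_source s" using sink by blast
  have "comodule G {s}" using is_source_comodule[OF s V] .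
  then obtain N where N: "N \<in> D" "r N = s" using c(6) unfolding hitting_def by blast
  then have "{s} = N"
    using min_comoduleD(5)[OF c(1)[OF N(1)] \<open>comodule G {s}\<close>] c(3) by blast
  then show ?thesis using that[of "{s}"] N s unfolding leading_def by blast
qed

section \<open>One reversal step, by the size of the canonical family\<close>

lemma canonical_Int:
  assumes D: "canonical G D r" and M: "M1 \<in> D" "M2 \<in> D"
    and Q: "Q \<subseteq> M1 \<union> M2" "r M1 \<in> Q" "r M2 \<in> Q"
  shows "Q \<inter> r ` D = {r M1, r M2}"
proof -
  note c = canonicalD[OF D]
  have "M = M1 \<or> M = M2" if "M \<in> D" "r M \<in> Q" for M
    using that c(3)[OF that(1)] c(5)[OF that(1)] Q(1) M by blast
  then show ?thesis using Q M by blast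
qed

text \<open>Every conflict exhibits a comodule inside the two blocks: the complement block enlarged
  by one vertex, a source with a 3-cycle, a source with a sink, or a two-element module with a
  3-cycle. Since the blocks are disjoint, it contains no third representative.\<close>

lemma safe_or_comodule:
  assumes D: "canonical G D r" and M: "M1 \<in> D" "M2 \<in> D" "M1 \<noteq> M2" and lead: "leading D M1"
    and V: "6 \<le> card V" and K: "\<not> nontrivial_module G M1 \<Longrightarrow> 2 \<le> card M1 \<Longrightarrow> 3 \<le> card (V - M1)"
  shows "safe G (r M1) (r M2) \<or> (\<exists>Q. comodule G Q \<and> Q \<inter> r ` D = {r M1, r M2})"
proof -
  note c = canonicalD[OF D]
  note mc = c(1)[OF M(1)] c(1)[OF M(2)] and gr = c(2)[OF M(1)] c(2)[OF M(2)]
  note rM = c(3)[OF M(1)] c(3)[OF M(2)]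
  have disj: "M1 \<inter> M2 = {}" using c(5) M by blast
  have sub: "M1 \<subseteq> V" "M2 \<subseteq> V" using mc min_comoduleD(2) by blast+
  have fin: "finite M1" "finite M2" using mc min_comoduleD(3) by blast+
  have goal: ?thesis if "comodule G Q" "Q \<subseteq> M1 \<union> M2" "r M1 \<in> Q" "r M2 \<in> Q" for Q
    using canonical_Int[OF D M(1,2)] that by blast
  \<comment> \<open>The conflicting unions have at most \<open>2 + 3\<close> elements, so they are
    proper subsets of \<open>V\<close>.\<close>
  have Un: ?thesis if "is_module G (M1 \<union> M2)" "card (M1 \<union> M2) < 6"
  proof (rule goal[of "M1 \<union> M2"])
    have "{r M1, r M2} \<subseteq> M1 \<union> M2" using rM by blast
    moreover have "finite (M1 \<union> M2)" using fin by simp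
    ultimately have "card {r M1, r M2} \<le> card (M1 \<union> M2)" by (intro card_mono)
    moreover have "r M1 \<noteq> r M2" using rM disj by (metis disjoint_iff)
    ultimately have "2 \<le> card (M1 \<union> M2)" by simp
    then show "comodule G (M1 \<union> M2)"
      using that V by (intro nontrivial_imp_comodule) (auto simp: nontrivial_module_def)
  qed (use rM in auto)
  from lead consider "\<not> nontrivial_module G M1" "2 \<le> card M1" | s where "M1 = {s}" "is_source s"
    | "\<forall>M\<in>D. nontrivial_module G M"
    unfolding leading_def by blast
  then show ?thesis
  proof cases
    case 1
    have nt2: "nontrivial_module G M2" using compl_type_unique[OF mc(1) 1 mc(2)] M by blast
    show ?thesis
    proof (cases "safe G (r M1) (r M2)")
      case False
      have "l \<rhd> r M2" if "l \<in> V - M1 - {r M2}" for l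
        using not_safe_compl[OF mc(1) 1 rM(1) mc(2) nt2 gr(2) disj False that] .
      then have "comodule G (insert (r M2) M1)"
        using compl_type_insert_comodule[OF mc(1) 1(1) K[OF 1]] rM disj sub by blast
      then show ?thesis using rM by (intro goal[of "insert (r M2) M1"]) auto
    qed simp
  next
    case (2 s)
    have rs: "r M1 = s" using rM 2 by simp
    show ?thesis
    proof (cases "nontrivial_module G M2")
      case True
      have "s \<notin> M2" using disj 2 by blast
      show ?thesis
      proof (cases "safe G s (r M2)")
        case False
        then show ?thesis
          using not_safe_source[OF 2(2) mc(2) True gr(2) \<open>s \<notin> M2\<close>] 2(1) \<open>s \<notin> M2\<close> fin
          by (intro Un) simp_all
      qed (use rs in simp)
    next
      case False
      have nt1: "\<not> nontrivial_module G M1" using 2 by (simp add: nontrivial_module_def)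
      have "\<not> 2 \<le> card M2" using compl_type_unique[OF mc(2) False _ mc(1) nt1] M by blast
      then obtain t where t: "M2 = {t}" "t \<in> V" using min_comodule_card_1[OF mc(2) False] by blast
      have com: "comodule G {s}" "comodule G {t}" using mc min_comoduleD(1) 2(1) t by blast+
      have st: "s \<noteq> t" "s \<in> V" using disj 2 t sub by auto
      \<comment> \<open>For a source and a sink, safety is not examined: \<open>{s, t}\<close> is a
        comodule in any case.\<close>
      have "is_module G (V - {s, t})"
      proof (rule is_moduleI)
        fix v a b assume v: "v \<in> V" "v \<notin> V - {s, t}" "a \<in> V - {s, t}" "b \<in> V - {s, t}" "v \<rhd> a"
        then show "v \<rhd> b"
          using singleton_comodule_uniform[OF com(1), of a b] singleton_comodule_uniform[OF com(2), of a b]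
          by blast
      qed auto
      moreover have "card (V - {s, t}) = card V - 2"
        using st t(2) by (simp add: card_Diff_subset)
      ultimately have "comodule G (V - (V - {s, t}))"
        using V st by (intro nontrivial_compl_imp_comodule) (auto simp: nontrivial_module_def)
      moreover have "V - (V - {s, t}) = {s, t}" using st t by blast
      ultimately have "comodule G {s, t}" by simp
      then show ?thesis using 2 t rM by (intro goal[of "{s, t}"]) auto
    qed
  next
    case 3
    then have nt: "nontrivial_module G M1" "nontrivial_module G M2" using M by blast+
    have disj': "M2 \<inter> M1 = {}" using disj by blast
    have cU: "card (M1 \<union> M2) = card M1 + card M2" using card_Un_disjoint fin disj by blast
    consider "card M1 = 2 \<longleftrightarrow> card M2 = 2" | "card M1 = 2" "card M2 \<noteq> 2" | "card M1 \<noteq> 2" "card M2 = 2"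
      by blast
    then show ?thesis
    proof cases
      case 1
      then show ?thesis using safe_modules_same_kind[OF mc(1) nt(1) gr(1) mc(2) nt(2) gr(2) disj] by blast
    next
      case 2
      show ?thesis
      proof (cases "safe G (r M1) (r M2)")
        case False
        then show ?thesis
          using not_safe_twin_big(1,2)[OF mc(1) nt(1) gr(1) 2(1) mc(2) nt(2) gr(2) 2(2) disj] cU 2
          by (intro Un) auto
      qed simp
    next
      case 3
      show ?thesis
      proof (cases "safe G (r M1) (r M2)")
        case False
        then show ?thesis
          using not_safe_twin_big(1,2)[OF mc(2) nt(2) gr(2) 3(2) mc(1) nt(1) gr(1) 3(1) disj'] cU 3
          by (intro Un) (auto simp: safe_commute Un_commute)
      qed simp
    qed
  qed
qed

lemma safe_step_ge_4:
  assumes D: "canonical G D r" and c4: "4 \<le> card D" and M1: "M1 \<in> D" and lead: "leading D M1"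
    and V: "6 \<le> card V"
  shows "\<exists>x\<in>V. \<exists>y\<in>V. x \<noteq> y \<and> (\<exists>H. finite H \<and> hitting (flip G x y) H \<and> card H + 2 \<le> card D)"
proof -
  note c = canonicalD[OF D]
  have "3 \<le> card (D - {M1})" using c4 M1 c(7) by simp
  then obtain S where S: "S \<subseteq> D - {M1}" "card S = 3" using obtain_subset_with_card_n by metis
  then obtain M2 M3 M4 where M': "S = {M2, M3, M4}" "M2 \<noteq> M3" "M2 \<noteq> M4" "M3 \<noteq> M4"
    by (auto simp: card_3_iff)
  then have M: "M2 \<in> D" "M3 \<in> D" "M4 \<in> D" "M1 \<noteq> M2" "M1 \<noteq> M3" "M1 \<noteq> M4" using S by auto
  have inj: "r N = r N' \<longleftrightarrow> N = N'" if "N \<in> D" "N' \<in> D" for N N'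
    using c(8) that by (auto dest: inj_onD)
  \<comment> \<open>The representatives of the three other blocks lie outside
    \<open>M1\<close>.\<close>
  have K: "3 \<le> card (V - M1)"
  proof -
    have "{r M2, r M3, r M4} \<subseteq> V - M1"
      using c(3,4)[OF M(1)] c(3,4)[OF M(2)] c(3,4)[OF M(3)] c(5)[OF M1 M(1) M(4)]
        c(5)[OF M1 M(2) M(5)] c(5)[OF M1 M(3) M(6)] by blast
    moreover have "card {r M2, r M3, r M4} = 3" using inj M M' by simp
    ultimately show ?thesis using card_mono[of "V - M1" "{r M2, r M3, r M4}"] finite_subV by auto
  qed
  define bad where "bad N \<longleftrightarrow> (\<exists>Q. comodule G Q \<and> Q \<inter> r ` D = {r M1, r N})" for N
  have "\<not> (bad M2 \<and> bad M3 \<and> bad M4)"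
  proof
    assume "bad M2 \<and> bad M3 \<and> bad M4"
    then obtain Q2 Q3 Q4 where Q: "comodule G Q2" "comodule G Q3" "comodule G Q4"
      "Q2 \<inter> r ` D = {r M1, r M2}" "Q3 \<inter> r ` D = {r M1, r M3}" "Q4 \<inter> r ` D = {r M1, r M4}"
      unfolding bad_def by blast
    have iff: "r N \<in> Q \<longleftrightarrow> N = M1 \<or> N = L" if "Q \<inter> r ` D = {r M1, r L}" "N \<in> D" "L \<in> D" for Q N L
      using that inj M1 by blast
    show False
      by (rule no_three_comodules[OF Q(1-3), of "r M1" "r M2" "r M3" "r M4"])
        (use iff[OF Q(4)] iff[OF Q(5)] iff[OF Q(6)] M M1 M' c(4) in auto)
  qed
  then obtain N where N: "N \<in> D" "M1 \<noteq> N" "\<not> bad N" using M by blast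
  define H where "H = r ` (D - {M1, N})"
  have WH: "r ` D = insert (r M1) (insert (r N) H)" using M1 N by (auto simp: H_def)
  have H2: "r M1 \<notin> H" "r N \<notin> H" using c(8) M1 N by (auto simp: H_def dest: inj_onD)
  have "safe G (r M1) (r N)"
    using safe_or_comodule[OF D M1 N(1,2) lead V K] N(3) unfolding bad_def by blast
  moreover have "Q \<inter> H \<noteq> {}" if "comodule G Q" "r M1 \<in> Q" "r N \<in> Q" for Q
    using that N(3) unfolding bad_def WH by blast
  ultimately have "hitting (flip G (r M1) (r N)) H"
    using hitting_flip[of "r M1" "r N" H] c(4,6) M1 N inj WH by auto
  moreover have "card H = card D - 2"
  proof -
    have "card H = card (D - {M1, N})" unfolding H_def
      using c(8) by (intro card_image) (auto intro: inj_on_subset)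
    then show ?thesis using M1 N c(7) by (simp add: card_Diff_subset)
  qed
  moreover have "finite H" using c(7) by (simp add: H_def)
  ultimately show ?thesis using c4 c(4) M1 N inj by (intro bexI[of _ "r M1"] bexI[of _ "r N"]) auto
qed

text \<open>A comodule containing both chosen vertices would have a complement missing the hitting
  set, so safety is all that matters. The case not covered by \<open>safe_or_comodule\<close> is a
  complement of two elements, where \<open>safe_small_compl\<close> chooses the vertices instead of
  \<open>r\<close>.\<close>

lemma safe_step_2:
  assumes D: "canonical G D r" and c2: "card D = 2" and M1: "M1 \<in> D" and lead: "leading D M1"
    and V: "6 \<le> card V"
  shows "\<exists>x\<in>V. \<exists>y\<in>V. x \<noteq> y \<and> hitting (flip G x y) {}"
proof -
  note c = canonicalD[OF D]
  obtain A B where "D = {A, B}" "A \<noteq> B" using c2 card_2_iff by metis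
  then obtain M2 where M2: "D = {M1, M2}" "M1 \<noteq> M2" using M1 by blast
  have M2D: "M2 \<in> D" using M2 by simp
  have disj: "M1 \<inter> M2 = {}" using c(5) M1 M2 by blast
  have goal: ?thesis if xy: "x \<in> V" "y \<in> V" "x \<noteq> y" "safe G x y" "hitting G {x, y}" for x y
  proof -
    have "hitting (flip G x y) {}"
    proof (rule hitting_flip[OF xy])
      fix Q assume "comodule G Q" "x \<in> Q" "y \<in> Q"
      then have "(V - Q) \<inter> {x, y} \<noteq> {}" using xy(5) comodule_compl unfolding hitting_def by blast
      then show "Q \<inter> {} \<noteq> {}" using \<open>x \<in> Q\<close> \<open>y \<in> Q\<close> by blast
    qed
    then show ?thesis using xy by blast
  qed
  show ?thesis
  proof (cases "\<not> nontrivial_module G M1 \<and> 2 \<le> card M1 \<and> \<not> 3 \<le> card (V - M1)")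
    case True
    have nt: "nontrivial_module G (V - M1)"
      using c(1)[OF M1] True by (auto simp: min_comodule_def comodule_def)
    then have K: "card (V - M1) = 2" using nontrivial_moduleD(2) True by fastforce
    have "card (V - M1) = card V - card M1"
      using min_comoduleD(2,3)[OF c(1)[OF M1]] by (simp add: card_Diff_subset)
    then have "3 \<le> card M1" using K V by linarith
    then obtain x y where xy: "x \<in> M1" "y \<in> V - M1" "safe G x y"
      using safe_small_compl[OF c(1)[OF M1] _ _ K] True by blast
    \<comment> \<open>Besides \<open>M1\<close>, the only possible minimal comodule is the
      two-element set \<open>V - M1\<close>, so any two vertices on the two sides hit
      everything.\<close>
    have "Q \<inter> {x, y} \<noteq> {}" if Q: "comodule G Q" for Q
    proof -
      obtain M where M: "M \<subseteq> Q" "min_comodule G M" using ex_min_comodule[OF Q] .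
      show ?thesis
      proof (cases "M = M1")
        case True
        then show ?thesis using M xy by blast
      next
        case False
        then have "M1 \<inter> M = {}" using min_comodules_meet(1)[OF c(1)[OF M1] M(2)] True by blast
        then have sub: "M \<subseteq> V - M1" using min_comoduleD(2)[OF M(2)] by blast
        have "nontrivial_module G M" using compl_type_unique[OF c(1)[OF M1] _ _ M(2)] True False by blast
        then have "card (V - M1) \<le> card M" using K nontrivial_moduleD(2) by simp
        then have "M = V - M1" using sub card_seteq[of "V - M1" M] finite_subV by blast
        then show ?thesis using M xy by blast
      qed
    qed
    then show ?thesis using goal[of x y] xy min_comoduleD(2)[OF c(1)[OF M1]]
      unfolding hitting_def by blast
  next
    case False
    have h: "hitting G {r M1, r M2}" using c(6) M2 by simp
    have "\<not> (comodule G Q \<and> Q \<inter> r ` D = {r M1, r M2})" for Q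
    proof
      assume Q: "comodule G Q \<and> Q \<inter> r ` D = {r M1, r M2}"
      then have "(V - Q) \<inter> {r M1, r M2} \<noteq> {}" using h comodule_compl unfolding hitting_def by blast
      then show False using Q by blast
    qed
    then have "safe G (r M1) (r M2)"
      using safe_or_comodule[OF D M1 M2D M2(2) lead V] False by blast
    moreover have "r M1 \<noteq> r M2" using disj c(3)[OF M1] c(3)[OF M2D] by auto
    ultimately show ?thesis using goal[of "r M1" "r M2"] h c(4) M1 M2D by blast
  qed
qed

text \<open>Two modules that agree on having two elements are safe together, and so are a source and
  a two-element module. In the remaining cases, simultaneous conflicts force opposite arcs.\<close>

lemma safe_pair_3:
  assumes D: "canonical G D r" and c3: "card D = 3" and M1: "M1 \<in> D" and lead: "leading D M1"
    and V: "6 \<le> card V"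
  shows "\<exists>M\<in>D. \<exists>N\<in>D. M \<noteq> N \<and> safe G (r M) (r N)"
proof -
  note c = canonicalD[OF D]
  have "card (D - {M1}) = 2" using c3 M1 c(7) by simp
  then obtain A B where "D - {M1} = {A, B}" "A \<noteq> B" by (auto simp: card_2_iff)
  then have AB: "D = {M1, A, B}" "A \<noteq> B" "M1 \<noteq> A" "M1 \<noteq> B" "A \<in> D" "B \<in> D" using M1 by auto
  have same: "safe G (r M) (r N)"
    if "M \<in> D" "N \<in> D" "M \<noteq> N" "nontrivial_module G M" "nontrivial_module G N" "card M = 2 \<longleftrightarrow> card N = 2" for M N
    using safe_modules_same_kind[OF c(1)[OF that(1)] that(4) c(2)[OF that(1)]
        c(1)[OF that(2)] that(5) c(2)[OF that(2)] c(5)[OF that(1-3)] that(6)] .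
  have two: ?thesis if nt: "nontrivial_module G A" "nontrivial_module G B"
    and h: "\<not> nontrivial_module G M1 \<and> 2 \<le> card M1 \<or> (\<exists>s. M1 = {s} \<and> is_source s)"
  proof (cases "card A = 2 \<longleftrightarrow> card B = 2")
    case True
    have "safe G (r A) (r B)" using same[OF AB(5,6,2) nt True] .
    then show ?thesis using AB(2,5,6) by blast
  next
    case False
    then obtain M N where MN: "M \<in> {A, B}" "N \<in> {A, B}" "M \<noteq> N" "card M = 2" "card N \<noteq> 2" using AB by blast
    then have ntMN: "nontrivial_module G M" "nontrivial_module G N" "M \<in> D" "N \<in> D" "M1 \<noteq> M" "M1 \<noteq> N"
      using nt AB by auto
    have d: "M1 \<inter> M = {}" "M1 \<inter> N = {}" "M \<inter> N = {}" using c(5) ntMN M1 MN by blast+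
    from h show ?thesis
    proof
      assume P: "\<not> nontrivial_module G M1 \<and> 2 \<le> card M1"
      show ?thesis
      proof (rule ccontr)
        assume a: "\<not> ?thesis"
        \<comment> \<open>The two-element module \<open>M\<close> is in conflict with
          \<open>N\<close> and with the complement block, and these conflicts orient the arc between
          \<open>r M\<close> and \<open>r N\<close> oppositely.\<close>
        have "r M \<rhd> r N"
          using not_safe_twin_big(3)[OF c(1)[OF ntMN(3)] ntMN(1) c(2)[OF ntMN(3)] MN(4)
              c(1)[OF ntMN(4)] ntMN(2) c(2)[OF ntMN(4)] MN(5) d(3)] a ntMN MN by blast
        moreover have "r N \<in> V - M1 - {r M}"
        proof -
          have "r N \<noteq> r M" using c(3)[OF ntMN(3)] c(3)[OF ntMN(4)] d(3) by (metis disjoint_iff)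
          moreover have "r N \<notin> M1" using c(3)[OF ntMN(4)] d(2) by blast
          ultimately show ?thesis using c(4)[OF ntMN(4)] by simp
        qed
        then have "r N \<rhd> r M"
          using not_safe_compl[OF c(1)[OF M1] _ _ c(3)[OF M1] c(1)[OF ntMN(3)] ntMN(1) c(2)[OF ntMN(3)] d(1)]
            P a M1 ntMN by blast
        ultimately show False using arc_asym by blast
      qed
    next
      assume "\<exists>s. M1 = {s} \<and> is_source s"
      then obtain s where s: "M1 = {s}" "is_source s" by blast
      have "s \<notin> M" using d s by blast
      then have "safe G s (r M)"
        using not_safe_source(1)[OF s(2) c(1)[OF ntMN(3)] ntMN(1) c(2)[OF ntMN(3)]] MN(4) by linarith
      moreover have "r M1 = s" using c(3)[OF M1] s by simp
      ultimately show ?thesis using M1 ntMN by blast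
    qed
  qed
  from lead consider "\<forall>M\<in>D. nontrivial_module G M" | "\<not> nontrivial_module G M1" "2 \<le> card M1"
    | s where "M1 = {s}" "is_source s" unfolding leading_def by blast
  then show ?thesis
  proof cases
    case 1
    consider "card M1 = 2 \<longleftrightarrow> card A = 2" | "card M1 = 2 \<longleftrightarrow> card B = 2" | "card A = 2 \<longleftrightarrow> card B = 2" by blast
    then have "safe G (r M1) (r A) \<or> safe G (r M1) (r B) \<or> safe G (r A) (r B)"
      using same[OF M1 AB(5,3)] same[OF M1 AB(6,4)] same[OF AB(5,6,2)] 1 M1 AB(5,6) by cases blast+
    then show ?thesis using AB(2-6) M1 by blast
  next
    case 2
    then show ?thesis using two compl_type_unique[OF c(1)[OF M1] 2] c(1) AB by blast
  next
    case (3 s)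
    have nt1: "\<not> nontrivial_module G M1" using 3 by (simp add: nontrivial_module_def)
    have sink: "\<exists>t. M = {t} \<and> t \<in> V \<and> (\<forall>v\<in>V - {t}. v \<rhd> t)"
      if M: "M \<in> D" "M \<noteq> M1" "\<not> nontrivial_module G M" for M
    proof -
      have "\<not> 2 \<le> card M" using compl_type_unique[OF c(1)[OF M(1)] M(3) _ c(1)[OF M1] nt1] M by blast
      then obtain t where t: "M = {t}" "t \<in> V" "is_source t \<or> (\<forall>v\<in>V - {t}. v \<rhd> t)"
        using min_comodule_card_1[OF c(1)[OF M(1)] M(3)] by blast
      have "t \<noteq> s" using t 3 M by blast
      then have "\<not> is_source t" using 3(2) t(2) arc_asym by (auto simp: is_source_def)
      then show ?thesis using t by blast
    qed
    have one: ?thesis if MN: "{M, N} = {A, B}" "\<not> nontrivial_module G M" for M N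
    proof (rule ccontr)
      assume a: "\<not> ?thesis"
      have MN': "M \<in> D" "N \<in> D" "M \<noteq> M1" "N \<noteq> M1" "M \<noteq> N" using MN AB by (auto simp: doubleton_eq_iff)
      obtain t where t: "M = {t}" "t \<in> V" "\<And>v. v \<in> V - {t} \<Longrightarrow> v \<rhd> t" using sink[OF MN'(1,3) MN(2)] by blast
      have nt: "nontrivial_module G N"
      proof (rule ccontr)
        assume "\<not> nontrivial_module G N"
        then obtain t' where t': "N = {t'}" "t' \<in> V" "\<And>v. v \<in> V - {t'} \<Longrightarrow> v \<rhd> t'"
          using sink[OF MN'(2,4)] by blast
        then have "t \<noteq> t'" using t MN' by blast
        then show False using t t' arc_asym by blast
      qed
      have sN: "s \<notin> N" and tN: "t \<notin> N" using c(5)[OF M1 MN'(2)] c(5)[OF MN'(1,2)] MN' 3 t by blast+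
      have r: "r M1 = s" "r M = t" using c(3)[OF M1] c(3)[OF MN'(1)] 3 t by auto
      have uns: "\<not> safe G s (r N)" "\<not> safe G t (r N)" using a r M1 MN' by auto
      note q = not_safe_source[OF 3(2) c(1)[OF MN'(2)] nt c(2)[OF MN'(2)] sN uns(1)]
      have "tournament.is_source (dual G) t"
        unfolding tournament.is_source_def[OF tournament_dual] using t by auto
      then have q': "is_module G ({t} \<union> N)"
        using tournament.not_safe_source_big[OF tournament_dual, of t N "r N"]
          c(1,3)[OF MN'(2)] nt q(1) tN uns(2)
        by (simp add: min_comodule_dual nontrivial_module_dual safe_dual is_module_dual)
      have "card ({s, t} \<union> N) \<le> card {s, t} + card N" by (rule card_Un_le)
      also have "card {s, t} \<le> 2" by (simp add: card_insert_if)
      \<comment> \<open>These are at most five vertices. A further vertex \<open>v\<close> is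
        dominated by \<open>N\<close> because \<open>s\<close> dominates it, and dominates
        \<open>N\<close> because it dominates \<open>t\<close>.\<close>
      finally have "card ({s, t} \<union> N) < card V" using q(1) V by linarith
      moreover have sub: "{s, t} \<union> N \<subseteq> V" using 3 t nontrivial_moduleD(4)[OF nt] by (auto simp: is_source_def)
      ultimately have "{s, t} \<union> N \<noteq> V" by auto
      then obtain v where v: "v \<in> V" "v \<notin> {s, t} \<union> N" using sub by blast
      obtain n where n: "n \<in> N" using c(3)[OF MN'(2)] by blast
      have "n \<rhd> v" using module_out[OF q(2), of v s n] v n 3(2) by (auto simp: is_source_def)
      moreover have "v \<rhd> n" using module_in[OF q', of v t n] v n t(3)[of v] by auto
      ultimately show False using arc_asym by blast
    qed
    show ?thesis
    proof (cases "nontrivial_module G A \<and> nontrivial_module G B")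
      case True
      then show ?thesis using two 3 by blast
    next
      case False
      then show ?thesis using one[of A B] one[of B A] by (auto simp: insert_commute)
    qed
  qed
qed

text \<open>A nontrivial module and its complement contain different representatives, so the
  canonical family of a decomposable tournament has at least two members.\<close>

lemma flip_step_source:
  assumes V: "6 \<le> card V" and dec: "\<not> indecomposable G" and H: "hitting G H" "finite H"
    and sink: "\<And>t. t \<in> V \<Longrightarrow> \<forall>v\<in>V - {t}. v \<rhd> t \<Longrightarrow> \<exists>s. is_source s"
  shows "\<exists>x\<in>V. \<exists>y\<in>V. x \<noteq> y \<and> (\<exists>H'. finite H' \<and> hitting (flip G x y) H' \<and>
    (card H' + 2 \<le> card H \<or> card H = 3 \<and> card H' \<le> 2))"
proof -
  obtain D r where D: "canonical G D r" using ex_canonical by blast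
  note c = canonicalD[OF D]
  have le: "card D \<le> card H" using canonical_card_le[OF D H] .
  obtain M where "nontrivial_module G M" using dec indecomposable_iff by blast
  then have "comodule G M" "comodule G (V - M)"
    using nontrivial_imp_comodule nontrivial_compl_imp_comodule by blast+
  then obtain A B where AB: "A \<in> D" "B \<in> D" "r A \<in> M" "r B \<in> V - M"
    using c(6) unfolding hitting_def by blast
  then have "A \<noteq> B" by blast
  then have c2: "2 \<le> card D" using card_mono[of D "{A, B}"] c(7) AB by simp
  have "D \<noteq> {}" "3 \<le> card V" using AB V by auto
  obtain M1 where M1: "M1 \<in> D" "leading D M1"
    by (rule ex_leading[OF D \<open>D \<noteq> {}\<close> \<open>3 \<le> card V\<close> sink])
  consider "4 \<le> card D" | "card D = 2" | "card D = 3" using c2 by linarith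
  then show ?thesis
  proof cases
    case 1
    then obtain x y H' where "x \<in> V" "y \<in> V" "x \<noteq> y" "finite H'" "hitting (flip G x y) H'" "card H' + 2 \<le> card D"
      using safe_step_ge_4[OF D 1 M1 V] by blast
    then show ?thesis using le by (intro bexI[of _ x] bexI[of _ y] conjI exI[of _ H']) auto
  next
    case 2
    then obtain x y where "x \<in> V" "y \<in> V" "x \<noteq> y" "hitting (flip G x y) {}"
      using safe_step_2[OF D 2 M1 V] by blast
    then show ?thesis using le 2 by (intro bexI[of _ x] bexI[of _ y] conjI exI[of _ "{}"]) auto
  next
    case 3
    obtain A B where AB: "A \<in> D" "B \<in> D" "A \<noteq> B" "safe G (r A) (r B)"
      using safe_pair_3[OF D 3 M1 V] by blast
    have ne: "r A \<noteq> r B" using c(8) AB by (auto dest: inj_onD)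
    have W: "r ` D = insert (r A) (insert (r B) (r ` D - {r A}))" using AB by blast
    \<comment> \<open>With three blocks, \<open>r B\<close> stays in the hitting set, so a comodule
      containing both ends of the arc is still hit.\<close>
    have "r B \<in> r ` D - {r A}" using AB ne by (simp add: image_iff) blast
    then have "hitting (flip G (r A) (r B)) (r ` D - {r A})"
      using hitting_flip[OF c(4)[OF AB(1)] c(4)[OF AB(2)] ne AB(4), of "r ` D - {r A}"] c(6) W by auto
    moreover have "card (r ` D - {r A}) = 2" using card_image[OF c(8)] 3 AB c(7) by simp
    moreover have "finite (r ` D - {r A})" using c(7) by simp
    ultimately show ?thesis using le 3 c(4) AB ne
      by (intro bexI[of _ "r A"] bexI[of _ "r B"] conjI exI[of _ "r ` D - {r A}"]) auto
  qed
qed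

lemma flip_dual:
  assumes "x \<in> V" "y \<in> V" "x \<noteq> y"
  shows "flip (dual G) x y = dual (flip G x y)"
proof -
  have "parcs (flip (dual G) x y) = parcs (dual (flip G x y))"
    using tournament.arcs_flip[OF tournament_dual, of x y] arcs_flip[OF assms] assms
    by (auto simp: set_eq_iff)
  then show ?thesis by (simp add: pair_pre_digraph.equality)
qed

lemma hitting_dual: "hitting (dual G) H \<longleftrightarrow> hitting G H"
  by (simp add: hitting_def comodule_dual)

lemma indecomposable_dual: "indecomposable (dual G) \<longleftrightarrow> indecomposable G"
  by (simp add: indecomposable_def is_module_dual)

text \<open>If there is a sink but no source, the step is made in the dual.\<close>

lemma flip_step:
  assumes V: "6 \<le> card V" and dec: "\<not> indecomposable G" and H: "hitting G H" "finite H"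
  shows "\<exists>x\<in>V. \<exists>y\<in>V. x \<noteq> y \<and> (\<exists>H'. finite H' \<and> hitting (flip G x y) H' \<and>
    (card H' + 2 \<le> card H \<or> card H = 3 \<and> card H' \<le> 2))"
proof (cases "(\<exists>t\<in>V. \<forall>v\<in>V - {t}. v \<rhd> t) \<longrightarrow> (\<exists>s. is_source s)")
  case True
  then show ?thesis using flip_step_source[OF V dec H] by blast
next
  case False
  have src: "\<exists>s. tournament.is_source (dual G) s"
    unfolding tournament.is_source_def[OF tournament_dual] using False by auto
  have "\<exists>x\<in>V. \<exists>y\<in>V. x \<noteq> y \<and> (\<exists>H'. finite H' \<and> hitting (flip (dual G) x y) H' \<and>
      (card H' + 2 \<le> card H \<or> card H = 3 \<and> card H' \<le> 2))"
    using tournament.flip_step_source[OF tournament_dual, of H] V dec H src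
    by (simp add: indecomposable_dual hitting_dual)
  moreover have "hitting (flip (dual G) x y) H' \<longleftrightarrow> hitting (flip G x y) H'"
    if "x \<in> V" "y \<in> V" "x \<noteq> y" for x y H'
    using flip_dual[OF that] tournament.hitting_dual[OF tournament_flip, of x y H'] by simp
  ultimately show ?thesis by meson
qed

lemma Inv_flip:
  assumes xy: "x \<in> V" "y \<in> V" "x \<noteq> y" and B: "B \<subseteq> parcs (flip G x y)"
  shows "\<exists>B'\<subseteq>parcs G. card B' \<le> Suc (card B) \<and> Inv G B' = Inv (flip G x y) B"
proof -
  define B0 where "B0 = parcs G \<inter> {(x, y), (y, x)}"
  \<comment> \<open>If \<open>B\<close> reverses the same arc again, the two reversals cancel: the
    arc disappears from \<open>B0\<close>, and its reverse, which is not an arc of \<open>G\<close>,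
    disappears from \<open>B\<close>.\<close>
  define B' where "B' = (B0 - B\<inverse>) \<union> (B \<inter> parcs G)"
  interpret F: tournament "flip G x y" by (rule tournament_flip)
  have "finite B" using B F.pair_finite_arcs finite_subset by blast
  have "card B0 \<le> 1" using arc_asym by (auto simp: B0_def card_le_Suc0_iff_eq)
  moreover have "card B' \<le> card (B0 - B\<inverse>) + card (B \<inter> parcs G)" unfolding B'_def by (rule card_Un_le)
  moreover have "card (B0 - B\<inverse>) \<le> card B0" "card (B \<inter> parcs G) \<le> card B"
    using \<open>finite B\<close> by (auto intro!: card_mono simp: B0_def)
  ultimately have "card B' \<le> Suc (card B)" by linarith
  moreover have "B' \<subseteq> parcs G" by (auto simp: B'_def B0_def)
  moreover have "Inv G B' = Inv (flip G x y) B"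
  proof -
    have "(a, b) \<in> parcs (Inv G B') \<longleftrightarrow> (a, b) \<in> parcs (Inv (flip G x y) B)" for a b
    proof -
      have 1: "(a, b) \<in> B \<Longrightarrow> (a, b) \<in> parcs (flip G x y)" "(b, a) \<in> B \<Longrightarrow> (b, a) \<in> parcs (flip G x y)"
        using B by blast+
      note 2 = arc_asym[of a b] arc_asym[of b a]
      note 3 = arcs_flip[OF xy, of a b] arcs_flip[OF xy, of b a]
      show ?thesis
      proof (cases "a = x \<and> b = y \<or> a = y \<and> b = x")
        case True
        then show ?thesis using 1 2 3 by (auto simp: Inv_def B'_def B0_def)
      next
        case False
        then have "(a, b) \<notin> B0" "(b, a) \<notin> B0" by (auto simp: B0_def)
        then show ?thesis using False 1 2 3 by (auto simp: Inv_def B'_def)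
      qed
    qed
    then have "parcs (Inv G B') = parcs (Inv (flip G x y) B)" by auto
    then show ?thesis by (intro pair_pre_digraph.equality) (auto simp: Inv_def flip_def)
  qed
  ultimately show ?thesis by blast
qed

end

text \<open>Induction on the size of the hitting set. One reversal saves two of its vertices, except
  that a set of three may shrink only to two. Reversals keep the vertex set, so the bound 6
  persists.\<close>

theorem indecomposable_by_reversals:
  fixes T :: "'a pair_pre_digraph"
  assumes "tournament T" "6 \<le> card (pverts T)" "hitting T H" "finite H"
  shows "\<exists>B\<subseteq>parcs T. card B \<le> (card H + 1) div 2 \<and> indecomposable (Inv T B)"
  using assms
proof (induction "card H" arbitrary: T H rule: less_induct)
  case less
  interpret tournament T by fact
  show ?case
  proof (cases "indecomposable T")
    case True
    moreover have "Inv T {} = T" by (intro pair_pre_digraph.equality) (simp_all add: Inv_def)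
    ultimately have "indecomposable (Inv T {})" by simp
    then show ?thesis by (intro exI[of _ "{}"]) simp
  next
    case False
    obtain x y H' where xy: "x \<in> V" "y \<in> V" "x \<noteq> y" and H': "finite H'" "hitting (flip T x y) H'"
      "card H' + 2 \<le> card H \<or> card H = 3 \<and> card H' \<le> 2"
      using flip_step[OF less(3) False less(4,5)] by blast
    have "card H' < card H" using H'(3) by linarith
    then obtain B where B: "B \<subseteq> parcs (flip T x y)" "card B \<le> (card H' + 1) div 2"
      "indecomposable (Inv (flip T x y) B)"
      using less(1)[of H' "flip T x y"] H' tournament_flip less(3) by auto
    obtain B' where "B' \<subseteq> parcs T" "card B' \<le> Suc (card B)" "Inv T B' = Inv (flip T x y) B"
      using Inv_flip[OF xy B(1)] by blast
    \<comment> \<open>In the exceptional case \<open>card H = 3\<close> and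
      \<open>card H' = 2\<close>, both sides are 2.\<close>
    moreover have "Suc ((card H' + 1) div 2) \<le> (card H + 1) div 2" using H'(3) by presburger
    ultimately show ?thesis using B by (intro exI[of _ B']) auto
  qed
qed

section \<open>Packings and the lower bound\<close>

definition packing :: "'a pair_pre_digraph \<Rightarrow> 'a set set \<Rightarrow> bool" where
  "packing T F \<longleftrightarrow> finite F \<and> pairwise disjnt F \<and> (\<forall>Q\<in>F. comodule T Q)"

lemma pairwise_disjnt_card_le:
  assumes F: "pairwise disjnt F" "\<And>M. M \<in> F \<Longrightarrow> M \<inter> H \<noteq> {}" and H: "finite H"
  shows "card F \<le> card H"
proof -
  have "\<exists>h. h \<in> M \<and> h \<in> H" if "M \<in> F" for M using F(2)[OF that] by blast
  then obtain f where f: "\<And>M. M \<in> F \<Longrightarrow> f M \<in> M \<and> f M \<in> H" by metis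
  have "inj_on f F"
    using F(1) f unfolding pairwise_def disjnt_def by (intro inj_onI) (metis disjoint_iff)
  then show ?thesis using f H by (intro card_inj_on_le[of f]) auto
qed

context tournament
begin

lemma nontrivial_module_Inv:
  assumes M: "nontrivial_module G M"
    and B: "\<And>a b. (a, b) \<in> B \<Longrightarrow> a \<in> M \<longleftrightarrow> b \<in> M"
  shows "nontrivial_module (Inv G B) M"
proof -
  have *: "(v, a) \<in> parcs (Inv G B) \<longleftrightarrow> v \<rhd> a" if "v \<notin> M" "a \<in> M" for v a
    using B[of v a] B[of a v] that by (auto simp: Inv_def)
  note m = nontrivial_moduleD[OF M]
  have [simp]: "pverts (Inv G B) = V" by (simp add: Inv_def)
  have "is_module (Inv G B) M"
    unfolding is_module_def
  proof (intro conjI ballI)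
    show "(v, a) \<in> parcs (Inv G B) \<longleftrightarrow> (v, b) \<in> parcs (Inv G B)"
      if "a \<in> M" "b \<in> M" "v \<in> pverts (Inv G B) - M" for a b v
      using that module_in[OF m(1), of v a b] *[of v a] *[of v b] by simp
  qed (use m in simp)
  then show ?thesis using m by (simp add: nontrivial_module_def)
qed

text \<open>The factor 2 counts the two ends of an arc: a member of \<open>F\<close> containing no
  end of an arc of \<open>B\<close> would remain a nontrivial module or the complement of
  one.\<close>

lemma card_packing_le:
  assumes F: "packing G F" and B: "B \<subseteq> parcs G" "indecomposable (Inv G B)"
  shows "card F \<le> 2 * card B"
proof -
  have finB: "finite B" using B(1) pair_finite_arcs finite_subset by blast
  have none: "\<not> nontrivial_module (Inv G B) M" for M
    using tournament.indecomposable_iff[OF tournament_Inv[OF B(1)]] B(2) by blast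
  have "M \<inter> (fst ` B \<union> snd ` B) \<noteq> {}" if M: "M \<in> F" for M
  proof
    assume a: "M \<inter> (fst ` B \<union> snd ` B) = {}"
    have "nontrivial_module G M \<or> nontrivial_module G (V - M)"
      using F M by (auto simp: packing_def comodule_def)
    moreover have "a \<notin> M \<and> b \<notin> M \<and> a \<in> V \<and> b \<in> V" if "(a, b) \<in> B" for a b
    proof -
      have "a \<in> fst ` B" "b \<in> snd ` B" using that by force+
      then show ?thesis using a that B(1) arc_V by blast
    qed
    ultimately show False using none nontrivial_module_Inv by (metis Diff_iff)
  qed
  then have "card F \<le> card (fst ` B \<union> snd ` B)"
    using F finB by (intro pairwise_disjnt_card_le) (auto simp: packing_def)
  also have "\<dots> \<le> card (fst ` B) + card (snd ` B)" by (rule card_Un_le)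
  also have "\<dots> \<le> 2 * card B" using card_image_le[OF finB, of fst] card_image_le[OF finB, of snd] by linarith
  finally show ?thesis .
qed

lemma decomposability_index_le:
  assumes "B \<subseteq> parcs G" "indecomposable (Inv G B)"
  shows "decomposability_index G \<le> card B"
  unfolding decomposability_index_def using assms by (intro Least_le) blast

lemma decomposability_index_le_hitting:
  assumes "6 \<le> card V" "hitting G H" "finite H"
  shows "decomposability_index G \<le> (card H + 1) div 2"
proof -
  obtain B where "B \<subseteq> parcs G" "card B \<le> (card H + 1) div 2" "indecomposable (Inv G B)"
    using indecomposable_by_reversals[OF tournament_axioms assms] by blast
  then show ?thesis using decomposability_index_le[of B] by linarith
qed

text \<open>To read off a property of the \<open>LEAST\<close> value, some \<open>B\<close> must be
  known to make the tournament indecomposable. The upper bound with the hitting set \<open>V\<close>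
  supplies one.\<close>

lemma card_packing_le_index:
  assumes "6 \<le> card V" "packing G F"
  shows "card F \<le> 2 * decomposability_index G"
proof -
  have "hitting G V" unfolding hitting_def using comodule_subset comodule_nonempty by blast
  then obtain B where "B \<subseteq> parcs G" "indecomposable (Inv G B)"
    using indecomposable_by_reversals[OF tournament_axioms assms(1) _ pair_finite_verts] by blast
  then have "\<exists>m. \<exists>B\<subseteq>parcs G. card B = m \<and> indecomposable (Inv G B)" by blast
  then have "\<exists>B\<subseteq>parcs G. card B = decomposability_index G \<and> indecomposable (Inv G B)"
    unfolding decomposability_index_def by (rule LeastI_ex)
  then show ?thesis using card_packing_le[OF assms(2)] by metis
qed

lemma decomposability_index_le_canonical:
  assumes "6 \<le> card V" "canonical G D r"
  shows "decomposability_index G \<le> (card D + 1) div 2"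
proof -
  note c = canonicalD[OF assms(2)]
  show ?thesis
    using decomposability_index_le_hitting[OF assms(1) c(6)] c(7) card_image[OF c(8)] by simp
qed

end

section \<open>Disjoint families with few elements beyond two per block\<close>

lemma card_Union_ge:
  assumes "finite X" "\<Union>F \<subseteq> X" "pairwise disjnt F" "\<forall>M\<in>F. 2 \<le> card M"
  shows "finite F" "2 * card F \<le> card (\<Union>F)" "2 * card F \<le> card X"
proof -
  have "F \<subseteq> Pow X" using assms(2) by blast
  then show fin: "finite F" using assms(1) finite_subset by blast
  have "card (\<Union>F) = sum card F"
    using assms(1,2,3) by (intro card_Union_disjoint) (auto intro: finite_subset)
  moreover have "(\<Sum>M\<in>F. 2) \<le> sum card F" using assms(4) by (intro sum_mono) auto
  ultimately show "2 * card F \<le> card (\<Union>F)" by simp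
  moreover have "card (\<Union>F) \<le> card X" using assms card_mono by blast
  ultimately show "2 * card F \<le> card X" by linarith
qed

lemma card_Union_pairs:
  assumes "finite X" "\<Union>F \<subseteq> X" "pairwise disjnt F" "\<forall>M\<in>F. card M = 2"
  shows "card (\<Union>F) = 2 * card F"
proof -
  have "card (\<Union>F) = sum card F"
    using assms(1,2,3) by (intro card_Union_disjoint) (auto intro: finite_subset)
  then show ?thesis using assms(4) by simp
qed

lemma remove_block:
  assumes "finite X" "\<Union>F \<subseteq> X" "pairwise disjnt F" "M \<in> F"
  shows "finite (X - M)" "\<Union>(F - {M}) \<subseteq> X - M" "pairwise disjnt (F - {M})"
    "card (X - M) = card X - card M" "card M \<le> card X"
proof -
  show "finite (X - M)" using assms by simp
  show "pairwise disjnt (F - {M})" using assms(3) by (rule pairwise_subset) auto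
  show "\<Union>(F - {M}) \<subseteq> X - M"
  proof
    fix z assume "z \<in> \<Union>(F - {M})"
    then obtain N where "N \<in> F" "N \<noteq> M" "z \<in> N" by blast
    moreover have "disjnt N M" using assms(3,4) calculation by (simp add: pairwiseD)
    ultimately show "z \<in> X - M" using assms(2) unfolding disjnt_iff by blast
  qed
  have "M \<subseteq> X" using assms(2,4) by blast
  moreover have "finite M" using calculation assms(1) by (rule finite_subset)
  ultimately
  show "card (X - M) = card X - card M" "card M \<le> card X"
    using assms(1) by (auto simp: card_Diff_subset card_mono)
qed

text \<open>Removing a block with more than two elements would leave too few elements for the other
  blocks.\<close>

lemma surplus_0:
  assumes "finite X" "\<Union>F \<subseteq> X" "pairwise disjnt F" "\<forall>M\<in>F. 2 \<le> card M"
    and "card X \<le> 2 * card F"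
  shows "\<forall>M\<in>F. card M = 2" "X = \<Union>F"
proof -
  have g: "finite F" "2 * card F \<le> card (\<Union>F)" using card_Union_ge(1,2)[OF assms(1-4)] by simp_all
  then have "card X \<le> card (\<Union>F)" using assms(5) by linarith
  then show "X = \<Union>F" using card_seteq[OF assms(1,2)] by simp
  show "\<forall>M\<in>F. card M = 2"
  proof
    fix M assume M: "M \<in> F"
    note r = remove_block[OF assms(1-3) M]
    have "2 * card (F - {M}) \<le> card (X - M)"
      using card_Union_ge(3)[OF r(1-3)] assms(4) by simp
    moreover have "card (F - {M}) = card F - 1" "1 \<le> card F"
      using M g(1) by (auto simp: Suc_le_eq card_gt_0_iff)
    moreover have "2 \<le> card M" using assms(4) M by blast
    ultimately show "card M = 2" using r(4,5) assms(5) by linarith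
  qed
qed

text \<open>A block that is not a pair takes up the whole surplus, so the rest falls under
  \<open>surplus_0\<close>.\<close>

lemma surplus_1:
  assumes "finite X" "\<Union>F \<subseteq> X" "pairwise disjnt F" "\<forall>M\<in>F. 2 \<le> card M"
    and "card X = 2 * card F + 1"
  obtains (point) z where "z \<in> X" "z \<notin> \<Union>F" "X = insert z (\<Union>F)" "\<forall>M\<in>F. card M = 2"
  | (triple) M where "M \<in> F" "card M = 3" "X = \<Union>F" "\<forall>N\<in>F - {M}. card N = 2"
proof (cases "\<forall>M\<in>F. card M = 2")
  case True
  have "card (X - \<Union>F) = 1"
    using card_Union_pairs[OF assms(1-3)] True assms(1,2,5)
    by (simp add: card_Diff_subset finite_subset)
  then obtain z where "X - \<Union>F = {z}" by (auto simp: card_1_singleton_iff)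
  then show ?thesis using point[of z] assms(2) True by blast
next
  case False
  then obtain M where M: "M \<in> F" "card M \<noteq> 2" by blast
  note r = remove_block[OF assms(1-3) M(1)]
  have c: "card (F - {M}) = card F - 1" "1 \<le> card F"
    using M card_Union_ge(1)[OF assms(1-4)] by (auto simp: Suc_le_eq card_gt_0_iff)
  have "2 * card (F - {M}) \<le> card (X - M)"
    using card_Union_ge(3)[OF r(1-3)] assms(4) by simp
  then have M3: "card M = 3" using r(4,5) c assms(5) bspec[OF assms(4) M(1)] M(2) by linarith
  then have "card (X - M) \<le> 2 * card (F - {M})" using r c assms(5) by linarith
  moreover have "\<forall>N\<in>F - {M}. 2 \<le> card N" using assms(4) by blast
  ultimately have s: "\<forall>N\<in>F - {M}. card N = 2" "X - M = \<Union>(F - {M})"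
    using surplus_0[OF r(1-3)] by blast+
  have "X = \<Union>F" using s(2) assms(2,4) M(1) by blast
  then show ?thesis using triple[OF M(1) M3] s(1) assms(4) by blast
qed

text \<open>A block of four elements could absorb the whole surplus; for minimal comodules that are
  modules this size is impossible. So a block that is not a pair has three elements, and the rest
  falls under \<open>surplus_1\<close>.\<close>

lemma surplus_2:
  assumes "finite X" "\<Union>F \<subseteq> X" "pairwise disjnt F" "\<forall>M\<in>F. 2 \<le> card M" "\<forall>M\<in>F. card M \<noteq> 4"
    and "card X = 2 * card F + 2"
  obtains (points) z z' where "z \<noteq> z'" "z \<in> X - \<Union>F" "z' \<in> X - \<Union>F" "X = insert z (insert z' (\<Union>F))"
      "\<forall>M\<in>F. card M = 2"
  | (triple) M z where "M \<in> F" "card M = 3" "z \<in> X - \<Union>F" "X = insert z (\<Union>F)" "\<forall>N\<in>F - {M}. card N = 2"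
  | (triples) M M' where "M \<in> F" "M' \<in> F" "M \<noteq> M'" "card M = 3" "card M' = 3" "X = \<Union>F"
      "\<forall>N\<in>F - {M, M'}. card N = 2"
proof (cases "\<forall>M\<in>F. card M = 2")
  case True
  have "card (X - \<Union>F) = 2"
    using card_Union_pairs[OF assms(1-3)] True assms(1,2,6)
    by (simp add: card_Diff_subset finite_subset)
  then obtain z z' where z: "X - \<Union>F = {z, z'}" "z \<noteq> z'" by (auto simp: card_2_iff)
  then have "X = insert z (insert z' (\<Union>F))" using assms(2) by blast
  then show ?thesis using points[OF z(2)] z(1) True by blast
next
  case False
  then obtain M where M: "M \<in> F" "card M \<noteq> 2" by blast
  note r = remove_block[OF assms(1-3) M(1)]
  have c: "card (F - {M}) = card F - 1" "1 \<le> card F"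
    using M card_Union_ge(1)[OF assms(1-4)] by (auto simp: Suc_le_eq card_gt_0_iff)
  have "2 * card (F - {M}) \<le> card (X - M)"
    using card_Union_ge(3)[OF r(1-3)] assms(4) by simp
  then have M3: "card M = 3" using r(4,5) c assms(6) bspec[OF assms(4) M(1)] bspec[OF assms(5) M(1)] M(2) by linarith
  then have e: "card (X - M) = 2 * card (F - {M}) + 1" using r c assms(6) by linarith
  have g: "\<forall>N\<in>F - {M}. 2 \<le> card N" using assms(4) by blast
  have MF: "\<Union>F = M \<union> \<Union>(F - {M})" "M \<subseteq> X" using M assms(2) by blast+
  consider (point') z where "z \<in> X - M" "z \<notin> \<Union>(F - {M})" "X - M = insert z (\<Union>(F - {M}))"
      "\<forall>N\<in>F - {M}. card N = 2"
    | (triple') M' where "M' \<in> F - {M}" "card M' = 3" "X - M = \<Union>(F - {M})"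
      "\<forall>N\<in>F - {M} - {M'}. card N = 2"
    using surplus_1[OF r(1-3) g e] by metis
  then show ?thesis
  proof cases
    case (point' z)
    have "z \<in> X - \<Union>F" "X = insert z (\<Union>F)" using point'(1-3) MF by blast+
    then show ?thesis using triple[OF M(1) M3] point'(4) by blast
  next
    case (triple' M')
    have "X = \<Union>F" using triple'(3) MF by blast
    moreover have "F - {M} - {M'} = F - {M, M'}" by blast
    ultimately show ?thesis using triples[OF M(1), of M'] triple' M3 by auto
  qed
qed

section \<open>Lexicographic sums\<close>

text \<open>Isomorphism of \<open>H\<close> with the subdigraph induced on \<open>X\<close>, stated
  without forming the latter, so that blocks can be treated separately and then glued.\<close>

definition sub_iso :: "'a pair_pre_digraph \<Rightarrow> 'a set \<Rightarrow> 'b pair_pre_digraph \<Rightarrow> bool" where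
  "sub_iso T X H \<longleftrightarrow> (\<exists>f. bij_betw f X (pverts H) \<and>
     (\<forall>a\<in>X. \<forall>b\<in>X. (a, b) \<in> parcs T \<longleftrightarrow> (f a, f b) \<in> parcs H))"

lemma sub_iso_dual: "sub_iso (dual T) X H \<longleftrightarrow> sub_iso T X (dual H)"
  unfolding sub_iso_def pverts_dual parcs_dual by blast

lemma isomorphicI:
  assumes T: "pair_wf_digraph T" and H: "pair_wf_digraph H" and iso: "sub_iso T (pverts T) H"
  shows "T \<simeq> H"
proof -
  interpret T: pair_wf_digraph T by fact
  interpret H: pair_wf_digraph H by fact
  obtain f where f: "bij_betw f (pverts T) (pverts H)"
    "\<And>a b. a \<in> pverts T \<Longrightarrow> b \<in> pverts T \<Longrightarrow> (a, b) \<in> parcs T \<longleftrightarrow> (f a, f b) \<in> parcs H"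
    using iso unfolding sub_iso_def by blast
  \<comment> \<open>In \<open>with_proj\<close>, arcs are pairs with tail \<open>fst\<close> and
    head \<open>snd\<close>. So the arc map is \<open>map_prod f f\<close>, and the projections are
    kept.\<close>
  define h where "h = \<lparr>iso_verts = f, iso_arcs = map_prod f f, iso_head = snd, iso_tail = fst\<rparr>"
  have inj: "inj_on f (pverts T)" and im: "f ` pverts T = pverts H"
    using f(1) by (auto simp: bij_betw_def)
  have "inj_on (map_prod f f) (parcs T)"
    using map_prod_inj_on[OF inj inj] T.wellformed' by (auto intro: inj_on_subset)
  then have "pre_digraph.digraph_isomorphism (with_proj T) h"
    using inj T.wf_digraph_axioms unfolding pre_digraph.digraph_isomorphism_def by (simp add: h_def)
  moreover have "map_prod f f ` parcs T = parcs H"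
  proof (intro equalityI subsetI)
    fix e assume "e \<in> map_prod f f ` parcs T"
    then obtain a b where ab: "e = (f a, f b)" "(a, b) \<in> parcs T" by auto
    then show "e \<in> parcs H" using f(2)[OF T.wellformed'[OF ab(2)]] by simp
  next
    fix e assume e: "e \<in> parcs H"
    then obtain a b where ab: "e = (f a, f b)" "a \<in> pverts T" "b \<in> pverts T"
    proof -
      have "fst e \<in> f ` pverts T" "snd e \<in> f ` pverts T" using H.wellformed'[of "fst e" "snd e"] e im by auto
      then show ?thesis using that by (metis imageE prod.collapse)
    qed
    then have "(a, b) \<in> parcs T" using f(2) e by blast
    then show "e \<in> map_prod f f ` parcs T" using ab(1) by force
  qed
  then have "with_proj H = app_iso h (with_proj T)"
    by (simp add: app_iso_def h_def im with_proj_def)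
  ultimately show ?thesis unfolding digraph_iso_def by blast
qed

text \<open>The image is again of the form \<open>with_proj H\<close>, so its tail and head maps are
  \<open>fst\<close> and \<open>snd\<close>. This forces the arc map to act componentwise.\<close>

lemma isomorphicD:
  assumes "T \<simeq> H"
  shows "pair_wf_digraph T" "sub_iso T (pverts T) H"
proof -
  obtain h where h: "pre_digraph.digraph_isomorphism (with_proj T) h" "with_proj H = app_iso h (with_proj T)"
    using assms unfolding digraph_iso_def by blast
  have wf: "wf_digraph (with_proj T)" using h(1) by (simp add: pre_digraph.digraph_isomorphism_def)
  then show "pair_wf_digraph T" by (simp add: wf_digraph_wp_iff)
  then interpret T: pair_wf_digraph T .
  define f where "f = iso_verts h"
  have eq: "pverts H = f ` pverts T" "parcs H = iso_arcs h ` parcs T" "fst = iso_tail h" "snd = iso_head h"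
    using h(2) by (auto simp: app_iso_def with_proj_def f_def)
  have inj: "inj_on f (pverts T)"
    using h(1) by (simp add: pre_digraph.digraph_isomorphism_def f_def)
  have arcs: "iso_arcs h (a, b) = (f a, f b)" if "(a, b) \<in> parcs T" for a b
    using h(1) that eq(3,4) by (auto simp: pre_digraph.digraph_isomorphism_def f_def prod_eq_iff)
  have "(a, b) \<in> parcs T \<longleftrightarrow> (f a, f b) \<in> parcs H" if ab: "a \<in> pverts T" "b \<in> pverts T" for a b
  proof
    assume "(a, b) \<in> parcs T"
    then show "(f a, f b) \<in> parcs H" using arcs eq(2) by force
  next
    assume "(f a, f b) \<in> parcs H"
    then obtain c d where cd: "(c, d) \<in> parcs T" "(f a, f b) = (f c, f d)"
      using eq(2) arcs by fastforce
    then have "a = c" "b = d" using inj ab T.wellformed'[OF cd(1)] by (auto dest: inj_onD)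
    then show "(a, b) \<in> parcs T" using cd by simp
  qed
  then show "sub_iso T (pverts T) H" unfolding sub_iso_def bij_betw_def using eq(1) inj by blast
qed

section \<open>Transport along an isomorphism\<close>

context
  fixes T :: "'a pair_pre_digraph" and H :: "'b pair_pre_digraph"
  assumes H: "tournament H" and iso: "T \<simeq> H"
begin

interpretation H: tournament H by (rule H)
interpretation T: pair_wf_digraph T by (rule isomorphicD(1)[OF iso])

text \<open>Preimages carry modules and comodules of \<open>H\<close> to those of \<open>T\<close>.
  Transporting packings is enough to bound the index of \<open>T\<close> from below.\<close>

lemma isomorphic_tournament: "tournament T"
  and isomorphic_card: "card (pverts T) = card (pverts H)"
  and isomorphic_packing: "packing H F \<Longrightarrow> \<exists>F'. packing T F' \<and> card F' = card F"
proof -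
  obtain f where f: "bij_betw f (pverts T) (pverts H)"
    "\<And>a b. a \<in> pverts T \<Longrightarrow> b \<in> pverts T \<Longrightarrow> (a, b) \<in> parcs T \<longleftrightarrow> (f a, f b) \<in> parcs H"
    using isomorphicD(2)[OF iso] unfolding sub_iso_def by blast
  show c: "card (pverts T) = card (pverts H)" using f(1) by (rule bij_betw_same_card)
  have inj: "inj_on f (pverts T)" and im: "f ` pverts T = pverts H"
    using f(1) by (auto simp: bij_betw_def)
  have fin: "finite (pverts T)" using f(1) H.pair_finite_verts by (simp add: bij_betw_finite)
  show "tournament T"
  proof unfold_locales
    show "finite (pverts T)" by (rule fin)
    have "parcs T \<subseteq> pverts T \<times> pverts T" using T.wellformed' by auto
    then show "finite (parcs T)" using fin finite_subset by blast
    show "fst e \<noteq> snd e" if e: "e \<in> parcs T" for e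
    proof
      assume "fst e = snd e"
      then have "(fst e, fst e) \<in> parcs T" using e by (metis prod.collapse)
      then show False using f(2)[of "fst e" "fst e"] T.wellformed' H.not_refl by blast
    qed
    show "(x, y) \<in> parcs T \<longleftrightarrow> (y, x) \<notin> parcs T" if xy: "x \<in> pverts T" "y \<in> pverts T" "x \<noteq> y" for x y
    proof -
      have "f x \<noteq> f y" "f x \<in> pverts H" "f y \<in> pverts H" using inj im xy by (auto dest: inj_onD)
      then show ?thesis using f(2)[OF xy(1,2)] f(2)[OF xy(2,1)] H.arc_iff_not_converse[of "f x" "f y"] by blast
    qed
  qed
  define g where "g Q = {a \<in> pverts T. f a \<in> Q}" for Q
  have cg: "card (g Q) = card Q" if "Q \<subseteq> pverts H" for Q
  proof -
    have "f ` g Q = Q" using im that by (auto simp: g_def)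
    moreover have "inj_on f (g Q)" using inj by (auto simp: g_def intro: inj_on_subset)
    ultimately show ?thesis using card_image by metis
  qed
  have nt: "nontrivial_module T (g M)" if M: "nontrivial_module H M" for M
  proof -
    note m = H.nontrivial_moduleD[OF M]
    have "is_module T (g M)"
      unfolding is_module_def
    proof (intro conjI ballI)
      show "g M \<subseteq> pverts T" by (auto simp: g_def)
      fix a b v assume "a \<in> g M" "b \<in> g M" "v \<in> pverts T - g M"
      then have "a \<in> pverts T" "b \<in> pverts T" "f a \<in> M" "f b \<in> M" "v \<in> pverts T" "f v \<notin> M" "f v \<in> pverts H"
        using im by (auto simp: g_def)
      then show "(v, a) \<in> parcs T \<longleftrightarrow> (v, b) \<in> parcs T"
        using H.module_in[OF m(1), of "f v" "f a" "f b"] f(2) by simp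
    qed
    moreover have "g M \<noteq> pverts T"
    proof
      assume "g M = pverts T"
      then have "f ` pverts T \<subseteq> M" by (auto simp: g_def)
      then show False using im m by auto
    qed
    ultimately show ?thesis using cg[OF m(4)] m by (simp add: nontrivial_module_def)
  qed
  have com: "comodule T (g Q)" if "comodule H Q" for Q
  proof -
    have "g (pverts H - Q) = pverts T - g Q" using im by (auto simp: g_def)
    then show ?thesis using that nt[of Q] nt[of "pverts H - Q"]
      by (auto simp: comodule_def) (auto simp: g_def)
  qed
  show "\<exists>F'. packing T F' \<and> card F' = card F" if F: "packing H F"
  proof (intro exI conjI)
    have sub: "Q \<subseteq> pverts H" if "Q \<in> F" for Q using that F H.comodule_subset by (auto simp: packing_def)
    have "inj_on g F"
    proof (rule inj_onI)
      fix A B assume AB: "A \<in> F" "B \<in> F" "g A = g B"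
      have "f ` g Q = Q" if "Q \<in> F" for Q using im sub[OF that] by (auto simp: g_def)
      then show "A = B" using AB by metis
    qed
    then show "card (g ` F) = card F" by (rule card_image)
    have "disjnt (g A) (g B)" if "A \<in> F" "B \<in> F" "g A \<noteq> g B" for A B
    proof -
      have "A \<noteq> B" using that by auto
      then have "disjnt A B" using F that by (auto simp: packing_def pairwise_def)
      then show ?thesis by (auto simp: disjnt_iff g_def)
    qed
    then show "packing T (g ` F)" using F com by (auto simp: packing_def pairwise_def)
  qed
qed

end

section \<open>Lexicographic sums as tournaments\<close>

lemma tournament_transitive: "tournament_on k (transitive_tournament k)"
  unfolding tournament_on_def
proof
  have sub: "{(i, j). i < j \<and> j < k} \<subseteq> {..<k} \<times> {..<k}" by auto
  have "finite {(i, j). i < j \<and> j < k}" by (rule finite_subset[OF sub]) simp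
  then show "tournament (transitive_tournament k)"
    by unfold_locales (auto simp: transitive_tournament_def)
qed (simp add: transitive_tournament_def)

lemma tournament_C3: "tournament_on 3 C3"
  unfolding tournament_on_def
proof
  show "tournament C3" by unfold_locales (auto simp: C3_def)
  show "pverts C3 = {..<3}" by (auto simp: C3_def)
qed

lemma parcs_transitive: "(i, j) \<in> parcs (transitive_tournament k) \<longleftrightarrow> i < j \<and> j < k"
  by (simp add: transitive_tournament_def)

lemma pverts_transitive [simp]: "pverts (transitive_tournament k) = {..<k}"
  by (simp add: transitive_tournament_def)

lemma pverts_C3 [simp]: "pverts C3 = {..<3}"
  using tournament_C3 by (simp add: tournament_on_def)

lemma pverts_lex_sum:
  "pverts (lex_sum R Hs) = prod_encode ` (SIGMA i:{..<length Hs}. pverts (Hs ! i))"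
  by (auto simp: lex_sum_def)

lemma pverts_lex_sum_iff [simp]:
  "prod_encode (i, x) \<in> pverts (lex_sum R Hs) \<longleftrightarrow> i < length Hs \<and> x \<in> pverts (Hs ! i)"
  by (auto simp: pverts_lex_sum)

lemma parcs_lex_sum_iff [simp]:
  "(prod_encode (i, x), prod_encode (j, y)) \<in> parcs (lex_sum R Hs) \<longleftrightarrow>
     i < length Hs \<and> x \<in> pverts (Hs ! i) \<and> j < length Hs \<and> y \<in> pverts (Hs ! j) \<and>
     (i = j \<and> (x, y) \<in> parcs (Hs ! i) \<or> i \<noteq> j \<and> (i, j) \<in> parcs R)"
  by (auto simp: lex_sum_def)

lemma pverts_lex_sumE:
  assumes "v \<in> pverts (lex_sum R Hs)"
  obtains i x where "v = prod_encode (i, x)" "i < length Hs" "x \<in> pverts (Hs ! i)"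
  using assms by (auto simp: pverts_lex_sum)

lemma tournament_lex_sum:
  assumes R: "tournament_on (length Hs) R" and Hs: "\<And>H. H \<in> set Hs \<Longrightarrow> tournament H"
  shows "tournament (lex_sum R Hs)"
proof -
  interpret R: tournament R using R by (simp add: tournament_on_def)
  have H: "tournament (Hs ! i)" if "i < length Hs" for i using Hs that by simp
  have RV: "pverts R = {..<length Hs}" using R by (simp add: tournament_on_def)
  have arcs: "\<exists>i x j y. e = (prod_encode (i, x), prod_encode (j, y))" if "e \<in> parcs (lex_sum R Hs)" for e
    using that by (auto simp: lex_sum_def)
  have "finite (pverts (Hs ! i))" if "i < length Hs" for i
    using tournament.finite_subV[OF H[OF that]] by blast
  then have fin: "finite (pverts (lex_sum R Hs))"
    unfolding pverts_lex_sum by (intro finite_imageI finite_SigmaI) auto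
  have sub: "parcs (lex_sum R Hs) \<subseteq> pverts (lex_sum R Hs) \<times> pverts (lex_sum R Hs)"
    using arcs by fastforce
  show ?thesis
  proof unfold_locales
    show "finite (pverts (lex_sum R Hs))" by (rule fin)
    show "finite (parcs (lex_sum R Hs))" using sub fin finite_subset by blast
    show "\<And>e. e \<in> parcs (lex_sum R Hs) \<Longrightarrow> fst e \<in> pverts (lex_sum R Hs)"
      "\<And>e. e \<in> parcs (lex_sum R Hs) \<Longrightarrow> snd e \<in> pverts (lex_sum R Hs)" using sub by auto
    show "fst e \<noteq> snd e" if e: "e \<in> parcs (lex_sum R Hs)" for e
    proof -
      obtain i x j y where ij: "e = (prod_encode (i, x), prod_encode (j, y))" using arcs[OF e] by blast
      then show ?thesis using e tournament.not_refl[OF H, of i x] by auto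
    qed
    show "(u, v) \<in> parcs (lex_sum R Hs) \<longleftrightarrow> (v, u) \<notin> parcs (lex_sum R Hs)"
      if uv: "u \<in> pverts (lex_sum R Hs)" "v \<in> pverts (lex_sum R Hs)" "u \<noteq> v" for u v
    proof -
      obtain i x where u: "u = prod_encode (i, x)" "i < length Hs" "x \<in> pverts (Hs ! i)"
        using uv(1) by (rule pverts_lex_sumE)
      obtain j y where v: "v = prod_encode (j, y)" "j < length Hs" "y \<in> pverts (Hs ! j)"
        using uv(2) by (rule pverts_lex_sumE)
      show ?thesis
      proof (cases "i = j")
        case True
        then have "x \<noteq> y" using u v uv by auto
        then show ?thesis using tournament.arc_iff_not_converse[OF H[OF u(2)], of x y] True u v by simp
      next
        case False
        then show ?thesis using R.arc_iff_not_converse[of i j] RV u v by auto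
      qed
    qed
  qed
qed

lemma card_lex_sum:
  assumes "\<And>H. H \<in> set Hs \<Longrightarrow> finite (pverts H)"
  shows "card (pverts (lex_sum R Hs)) = (\<Sum>H\<leftarrow>Hs. card (pverts H))"
proof -
  have "card (pverts (lex_sum R Hs)) = card (SIGMA i:{..<length Hs}. pverts (Hs ! i))"
    unfolding pverts_lex_sum by (intro card_image inj_prod_encode)
  also have "\<dots> = (\<Sum>i<length Hs. card (pverts (Hs ! i)))"
    using assms by (intro card_SigmaI) auto
  also have "\<dots> = (\<Sum>H\<leftarrow>Hs. card (pverts H))"
    by (simp add: sum_list_sum_nth atLeast0LessThan)
  finally show ?thesis .
qed

lemma sub_iso_lex_sum:
  assumes len: "length Bs = length Hs" and X: "X = \<Union>(set Bs)"
    and disj: "\<And>i j. i < length Hs \<Longrightarrow> j < length Hs \<Longrightarrow> i \<noteq> j \<Longrightarrow> Bs ! i \<inter> Bs ! j = {}"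
    and iso: "\<And>i. i < length Hs \<Longrightarrow> sub_iso T (Bs ! i) (Hs ! i)"
    and R: "\<And>i j a b. i < length Hs \<Longrightarrow> j < length Hs \<Longrightarrow> i \<noteq> j \<Longrightarrow> a \<in> Bs ! i \<Longrightarrow> b \<in> Bs ! j \<Longrightarrow>
      (a, b) \<in> parcs T \<longleftrightarrow> (i, j) \<in> parcs R"
  shows "sub_iso T X (lex_sum R Hs)"
proof -
  have "\<forall>i\<in>{..<length Hs}. \<exists>f. bij_betw f (Bs ! i) (pverts (Hs ! i)) \<and>
      (\<forall>a\<in>Bs ! i. \<forall>b\<in>Bs ! i. (a, b) \<in> parcs T \<longleftrightarrow> (f a, f b) \<in> parcs (Hs ! i))"
    using iso unfolding sub_iso_def by blast
  then obtain g where g: "\<forall>i\<in>{..<length Hs}. bij_betw (g i) (Bs ! i) (pverts (Hs ! i)) \<and>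
      (\<forall>a\<in>Bs ! i. \<forall>b\<in>Bs ! i. (a, b) \<in> parcs T \<longleftrightarrow> (g i a, g i b) \<in> parcs (Hs ! i))"
    by (auto simp: bchoice_iff)
  have "\<forall>x\<in>X. \<exists>i. i < length Hs \<and> x \<in> Bs ! i" using X len by (auto simp: in_set_conv_nth)
  then obtain ix where ix: "\<And>x. x \<in> X \<Longrightarrow> ix x < length Hs \<and> x \<in> Bs ! ix x" by metis
  have ixI: "ix x = i" if "i < length Hs" "x \<in> Bs ! i" for x i
  proof -
    have "x \<in> X" using that X len by auto
    then show ?thesis using ix[of x] disj[of i "ix x"] that by blast
  qed
  have ginj: "g i a = g i b \<longleftrightarrow> a = b" if "i < length Hs" "a \<in> Bs ! i" "b \<in> Bs ! i" for i a b
    using g that by (auto simp: bij_betw_def dest: inj_onD)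
  have gin: "g i a \<in> pverts (Hs ! i)" if "i < length Hs" "a \<in> Bs ! i" for i a
    using g that by (auto simp: bij_betw_def)
  define f where "f x = prod_encode (ix x, g (ix x) x)" for x
  have "inj_on f X"
  proof (rule inj_onI)
    fix a b assume ab: "a \<in> X" "b \<in> X" "f a = f b"
    then have "ix a = ix b" "g (ix a) a = g (ix a) b" by (auto simp: f_def)
    then show "a = b" using ginj[of "ix a" a b] ix[OF ab(1)] ix[OF ab(2)] by simp
  qed
  moreover have "f ` X = pverts (lex_sum R Hs)"
  proof (intro equalityI subsetI)
    fix v assume "v \<in> f ` X"
    then show "v \<in> pverts (lex_sum R Hs)" using ix gin by (auto simp: f_def)
  next
    fix v assume "v \<in> pverts (lex_sum R Hs)"
    then obtain i y where v: "v = prod_encode (i, y)" "i < length Hs" "y \<in> pverts (Hs ! i)"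
      by (rule pverts_lex_sumE)
    have "g i ` (Bs ! i) = pverts (Hs ! i)" using g v(2) by (simp add: bij_betw_def)
    then obtain x where x: "x \<in> Bs ! i" "y = g i x" using v(3) by blast
    then have "x \<in> X" "f x = v" using v X len ixI[OF v(2) x(1)] by (auto simp: f_def)
    then show "v \<in> f ` X" by blast
  qed
  moreover have "(a, b) \<in> parcs T \<longleftrightarrow> (f a, f b) \<in> parcs (lex_sum R Hs)" if ab: "a \<in> X" "b \<in> X" for a b
  proof (cases "ix a = ix b")
    case True
    then show ?thesis using g ix[OF ab(1)] ix[OF ab(2)] gin by (simp add: f_def)
  next
    case False
    then show ?thesis using R[of "ix a" "ix b" a b] ix[OF ab(1)] ix[OF ab(2)] gin by (simp add: f_def)
  qed
  ultimately show ?thesis unfolding sub_iso_def bij_betw_def by blast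
qed

definition module_family :: "'a pair_pre_digraph \<Rightarrow> 'a set set \<Rightarrow> bool" where
  "module_family T F \<longleftrightarrow> finite F \<and> pairwise disjnt F \<and> (\<forall>M\<in>F. is_module T M \<and> 2 \<le> card M)"

definition block :: "nat pair_pre_digraph list \<Rightarrow> nat \<Rightarrow> nat set \<Rightarrow> nat set" where
  "block Hs i M = (\<lambda>x. prod_encode (i, x)) ` M"

lemma card_block [simp]: "card (block Hs i M) = card M"
  unfolding block_def by (intro card_image) (auto simp: inj_on_def)

lemma block_iff [simp]: "prod_encode (j, x) \<in> block Hs i M \<longleftrightarrow> j = i \<and> x \<in> M"
  by (auto simp: block_def)

lemma is_module_block:
  assumes "i < length Hs" "is_module (Hs ! i) M"
  shows "is_module (lex_sum R Hs) (block Hs i M)"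
  unfolding is_module_def
proof (intro conjI ballI)
  have M: "M \<subseteq> pverts (Hs ! i)" using assms by (simp add: is_module_def)
  then show "block Hs i M \<subseteq> pverts (lex_sum R Hs)" using assms by (auto simp: block_def)
  fix a b v assume ab: "a \<in> block Hs i M" "b \<in> block Hs i M" and v: "v \<in> pverts (lex_sum R Hs) - block Hs i M"
  obtain x y where xy: "a = prod_encode (i, x)" "b = prod_encode (i, y)" "x \<in> M" "y \<in> M"
    using ab by (auto simp: block_def)
  obtain j w where w: "v = prod_encode (j, w)" "j < length Hs" "w \<in> pverts (Hs ! j)"
    using v by (auto elim: pverts_lex_sumE)
  show "(v, a) \<in> parcs (lex_sum R Hs) \<longleftrightarrow> (v, b) \<in> parcs (lex_sum R Hs)"
  proof (cases "j = i")
    case True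
    then have "w \<notin> M" using v w by auto
    then have "(w, x) \<in> parcs (Hs ! i) \<longleftrightarrow> (w, y) \<in> parcs (Hs ! i)"
      using assms(2) w xy True unfolding is_module_def by blast
    then show ?thesis using xy w M assms True by auto
  next
    case False
    then show ?thesis using xy w M assms by auto
  qed
qed

lemma module_family_lex_sum:
  "\<exists>F. module_family (lex_sum R Hs) F \<and> card F = length (filter (\<lambda>H. 2 \<le> card (pverts H)) Hs)"
proof (intro exI conjI)
  define I where "I = {i. i < length Hs \<and> 2 \<le> card (pverts (Hs ! i))}"
  define g where "g i = block Hs i (pverts (Hs ! i))" for i
  have "g i \<noteq> g j" if "i \<in> I" "j \<in> I" "i \<noteq> j" for i j
  proof -
    have "pverts (Hs ! i) \<noteq> {}" using that by (auto simp: I_def)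
    then obtain x where "x \<in> pverts (Hs ! i)" by blast
    then have "prod_encode (i, x) \<in> g i" "prod_encode (i, x) \<notin> g j" using that by (auto simp: g_def)
    then show ?thesis by blast
  qed
  then have "inj_on g I" by (auto simp: inj_on_def)
  then have "card (g ` I) = card I" by (rule card_image)
  then show "card (g ` I) = length (filter (\<lambda>H. 2 \<le> card (pverts H)) Hs)"
    by (simp add: I_def length_filter_conv_card)
  have "is_module (lex_sum R Hs) (g i)" if "i \<in> I" for i
    unfolding g_def using that by (intro is_module_block) (auto simp: I_def is_module_def)
  moreover have "pairwise disjnt (g ` I)"
    by (auto simp: pairwise_def disjnt_iff g_def block_def)
  ultimately show "module_family (lex_sum R Hs) (g ` I)"
    by (auto simp: module_family_def I_def) (auto simp: g_def I_def)
qed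

lemma module_family_block:
  assumes F: "module_family (Hs ! i) F" and i: "i < length Hs"
  shows "module_family (lex_sum R Hs) (block Hs i ` F)" "card (block Hs i ` F) = card F"
    "\<Union>(block Hs i ` F) \<subseteq> block Hs i (pverts (Hs ! i))"
proof -
  have eq: "block Hs i A = block Hs i B \<longleftrightarrow> A = B" for A B
    by (auto simp: block_def inj_image_eq_iff inj_on_def)
  then have "inj_on (block Hs i) F" by (auto simp: inj_on_def)
  then show "card (block Hs i ` F) = card F" by (rule card_image)
  have "disjnt (block Hs i A) (block Hs i B)" if "A \<in> F" "B \<in> F" "A \<noteq> B" for A B
  proof -
    have "disjnt A B" using F that by (auto simp: module_family_def pairwise_def)
    then show ?thesis by (auto simp: disjnt_iff block_def)
  qed
  then have "pairwise disjnt (block Hs i ` F)" by (auto simp: pairwise_def)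
  then show "module_family (lex_sum R Hs) (block Hs i ` F)"
    using F is_module_block[OF i] by (auto simp: module_family_def)
  show "\<Union>(block Hs i ` F) \<subseteq> block Hs i (pverts (Hs ! i))"
  proof -
    have "M \<subseteq> pverts (Hs ! i)" if "M \<in> F" for M
      using F that by (simp add: module_family_def is_module_def)
    then show ?thesis by (auto simp: block_def)
  qed
qed

section \<open>The maximum of the decomposability index\<close>

context tournament
begin

lemma packing_dual: "packing (dual G) F \<longleftrightarrow> packing G F"
  by (simp add: packing_def comodule_dual)

text \<open>A second member is nonempty and disjoint from the first, so no member is the whole
  vertex set.\<close>

lemma module_family_packing:
  assumes F: "module_family G F" "2 \<le> card F"
  shows "packing G F"
proof -
  have "comodule G M" if M: "M \<in> F" for M
  proof -
    obtain N where N: "N \<in> F" "N \<noteq> M" using card_ge_2E[OF F(2) M] .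
    have "disjnt M N" "N \<subseteq> V" "2 \<le> card N"
      using F(1) M N by (auto simp: module_family_def is_module_def pairwise_def)
    then have "M \<noteq> V" by (auto simp: disjnt_def Int_absorb1)
    then show ?thesis
      using F(1) M by (intro nontrivial_imp_comodule) (auto simp: module_family_def nontrivial_module_def)
  qed
  then show ?thesis using F by (auto simp: packing_def module_family_def)
qed

text \<open>The complement of \<open>K\<close> is one more comodule, disjoint from everything inside
  \<open>K\<close>.\<close>

lemma module_family_packing_compl:
  assumes F: "module_family G F" "\<Union>F \<subseteq> K" and K: "nontrivial_module G K"
  shows "packing G (insert (V - K) F)" "card (insert (V - K) F) = Suc (card F)"
proof -
  note k = nontrivial_moduleD[OF K]
  have "comodule G M" if "M \<in> F" for M
    using F that k by (intro nontrivial_imp_comodule) (auto simp: module_family_def nontrivial_module_def)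
  moreover have "comodule G (V - K)" using nontrivial_compl_imp_comodule[OF K] .
  moreover have "disjnt (V - K) M" if "M \<in> F" for M using F(2) that by (auto simp: disjnt_iff)
  ultimately show "packing G (insert (V - K) F)"
    using F(1) by (auto simp: packing_def module_family_def pairwise_insert disjnt_sym)
  have "V - K \<notin> F"
  proof
    assume "V - K \<in> F"
    then have "V - K = {}" "2 \<le> card (V - K)" using F by (auto simp: module_family_def)
    then have "2 \<le> card ({} :: 'a set)" by metis
    then show False by simp
  qed
  then show "card (insert (V - K) F) = Suc (card F)" using F(1) by (simp add: module_family_def)
qed

lemma packing_insert_singleton:
  assumes F: "packing G F" "\<Union>F \<subseteq> V - {s}" and s: "comodule G {s}"
  shows "packing G (insert {s} F)" "card (insert {s} F) = Suc (card F)"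
proof -
  show "packing G (insert {s} F)"
    using F s by (auto simp: packing_def pairwise_insert disjnt_iff)
  have "{s} \<notin> F" using F(2) by auto
  then show "card (insert {s} F) = Suc (card F)" using F(1) by (simp add: packing_def)
qed

end

text \<open>The size \<open>2 * n + 1\<close> is the threshold: from
  \<open>2 * card B \<ge> 2 * n + 1\<close> it follows that \<open>n + 1\<close> reversals are
  needed, the largest possible index.\<close>

definition saturated :: "nat \<Rightarrow> 'a pair_pre_digraph \<Rightarrow> bool" where
  "saturated n H \<longleftrightarrow> tournament H \<and> card (pverts H) = 4 * n + 2 \<and> (\<exists>F. packing H F \<and> card F = 2 * n + 1)"

lemma saturated_dual:
  assumes "saturated n H"
  shows "saturated n (dual H)"
proof -
  interpret tournament H using assms by (simp add: saturated_def)
  show ?thesis using assms tournament_dual by (simp add: saturated_def packing_dual)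
qed

section \<open>Large packings in the listed forms\<close>

lemma tournament_summands: "tournament one" "tournament two" "tournament C3"
  using tournament_transitive tournament_C3 by (auto simp: tournament_on_def)

text \<open>Summand \<open>i\<close> is a proper module, so its complement supplies the extra
  comodule.\<close>

lemma outer_packing:
  assumes T: "tournament (lex_sum R Hs)" and i: "i < length Hs" "finite (pverts (Hs ! i))"
    and F: "module_family (Hs ! i) F" "F \<noteq> {}"
    and j: "j < length Hs" "j \<noteq> i" "pverts (Hs ! j) \<noteq> {}"
  shows "\<exists>F'. packing (lex_sum R Hs) F' \<and> card F' = Suc (card F)"
proof -
  interpret tournament "lex_sum R Hs" by fact
  define K where "K = block Hs i (pverts (Hs ! i))"
  obtain M where M: "M \<in> F" using F by blast
  have "card M \<le> card (pverts (Hs ! i))" "2 \<le> card M"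
    using F M i by (auto simp: module_family_def is_module_def intro: card_mono)
  then have "2 \<le> card K" by (simp add: K_def)
  moreover have "is_module (lex_sum R Hs) K"
    unfolding K_def by (intro is_module_block i) (simp add: is_module_def)
  moreover have "K \<noteq> V"
  proof -
    obtain x where "x \<in> pverts (Hs ! j)" using j by blast
    then have "prod_encode (j, x) \<in> V - K" using j by (simp add: K_def)
    then show ?thesis by blast
  qed
  ultimately have "nontrivial_module (lex_sum R Hs) K" by (simp add: nontrivial_module_def)
  then show ?thesis
    using module_family_packing_compl[of "block Hs i ` F" K] module_family_block[OF F(1) i(1)]
    by (metis K_def)
qed

text \<open>The source and the sink count as two singleton comodules, whereas the complement of the
  middle summand would count only once.\<close>

lemma outer_packing_three:
  assumes L: "tournament L" and F: "module_family L F" "F \<noteq> {}"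
  shows "\<exists>F'. packing (lex_sum three [one, L, one]) F' \<and> card F' = card F + 2"
proof -
  define Hs where "Hs = [one, L, one]"
  have Hs: "length Hs = 3" "Hs ! 0 = one" "Hs ! Suc 0 = L" "Hs ! 2 = one" by (simp_all add: Hs_def)
  have "tournament (lex_sum three Hs)"
    using L tournament_summands(1) tournament_transitive[of 3] by (intro tournament_lex_sum) (auto simp: Hs_def numeral_3_eq_3)
  then interpret tournament "lex_sum three Hs" .
  define K where "K = block Hs 1 (pverts L)"
  have Fi: "module_family (Hs ! 1) F" "1 < length Hs" using F by (simp_all add: Hs)
  note fb = module_family_block(1)[OF Fi, of three] module_family_block(2,3)[OF Fi]
  obtain M where M: "M \<in> F" using F by blast
  have finL: "finite (pverts L)" using tournament.finite_subV[OF L] by blast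
  then have "card M \<le> card (pverts L)" "2 \<le> card M"
    using F M by (auto simp: module_family_def is_module_def intro: card_mono)
  then have cK: "2 \<le> card K" by (simp add: K_def)
  define s where "s = prod_encode (0::nat, 0::nat)"
  define t where "t = prod_encode (2::nat, 0::nat)"
  have V: "V = insert s (insert t K)"
  proof (intro equalityI subsetI)
    fix v assume "v \<in> V"
    then obtain i x where ix: "v = prod_encode (i, x)" "i < length Hs" "x \<in> pverts (Hs ! i)"
      by (rule pverts_lex_sumE)
    then consider "i = 0" | "i = 1" | "i = 2" using Hs(1) by linarith
    then show "v \<in> insert s (insert t K)" using ix by cases (auto simp: s_def t_def K_def Hs)
  next
    fix v assume "v \<in> insert s (insert t K)"
    then show "v \<in> V" by (auto simp: s_def t_def K_def block_def Hs)
  qed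
  have stK: "s \<noteq> t" "s \<notin> K" "t \<notin> K" by (auto simp: s_def t_def K_def)
  have finK: "finite K" using finL by (simp add: K_def block_def)
  have arcs: "(s, t) \<in> parcs (lex_sum three Hs)" "\<And>k. k \<in> K \<Longrightarrow> (s, k) \<in> parcs (lex_sum three Hs)"
    "\<And>k. k \<in> K \<Longrightarrow> (k, t) \<in> parcs (lex_sum three Hs)"
    by (auto simp: s_def t_def K_def block_def parcs_transitive Hs)
  have s: "is_source s" using V arcs by (auto simp: is_source_def)
  have t: "tournament.is_source (dual (lex_sum three Hs)) t"
    unfolding tournament.is_source_def[OF tournament_dual] using V arcs by auto
  have "card V = card K + 2" using V stK finK by simp
  then have c3: "3 \<le> card V" using cK by linarith
  have com: "comodule (lex_sum three Hs) {s}" "comodule (lex_sum three Hs) {t}"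
    using is_source_comodule[OF s c3] tournament.is_source_comodule[OF tournament_dual t] c3
    by (simp_all add: comodule_dual)
  let ?F = "block Hs 1 ` F"
  have sub: "\<Union>?F \<subseteq> K" using fb(3) by (simp add: K_def Hs)
  have "comodule (lex_sum three Hs) M" if "M \<in> ?F" for M
  proof -
    have "M \<noteq> V" using that sub stK V by blast
    then show ?thesis using fb(1) that
      by (intro nontrivial_imp_comodule) (auto simp: module_family_def nontrivial_module_def)
  qed
  then have p: "packing (lex_sum three Hs) ?F" using fb(1) by (simp add: packing_def module_family_def)
  have "\<Union>?F \<subseteq> V - {t}" using sub stK V by blast
  note q = packing_insert_singleton[OF p this com(2)]
  have "\<Union>(insert {t} ?F) \<subseteq> V - {s}" using sub stK V by blast
  note q' = packing_insert_singleton[OF q(1) this com(1)]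
  have "card (insert {s} (insert {t} ?F)) = card F + 2" using q'(2) q(2) fb(2) by simp
  then show ?thesis using q'(1) unfolding Hs_def by blast
qed

lemma inner_sum:
  assumes R: "tournament_on (length Hs) R" and Hs: "set Hs \<subseteq> {one, two, C3}"
  shows "tournament (lex_sum R Hs)" "finite (pverts (lex_sum R Hs))"
    "card (pverts (lex_sum R Hs)) = (\<Sum>H\<leftarrow>Hs. card (pverts H))"
proof -
  have t: "tournament H" if "H \<in> set Hs" for H
    using that Hs tournament_summands by blast
  show *: "tournament (lex_sum R Hs)" using R t by (rule tournament_lex_sum)
  show "finite (pverts (lex_sum R Hs))" using tournament.finite_subV[OF *] by blast
  show "card (pverts (lex_sum R Hs)) = (\<Sum>H\<leftarrow>Hs. card (pverts H))"
    using tournament.finite_subV[OF t] by (intro card_lex_sum) auto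
qed

lemma saturated_F4:
  assumes "tournament_on (2 * n + 1) R" "1 \<le> n"
  shows "saturated n (lex_sum R (replicate (2 * n + 1) two))"
proof -
  let ?Hs = "replicate (2 * n + 1) two"
  have R: "tournament_on (length ?Hs) R" using assms by simp
  have "set ?Hs \<subseteq> {one, two, C3}" by auto
  note i = inner_sum[OF R this]
  obtain F where F: "module_family (lex_sum R ?Hs) F" "card F = length (filter (\<lambda>H. 2 \<le> card (pverts H)) ?Hs)"
    using module_family_lex_sum by blast
  then have c: "card F = 2 * n + 1" by simp
  have "packing (lex_sum R ?Hs) F" using tournament.module_family_packing[OF i(1) F(1)] c assms by simp
  moreover have "card (pverts (lex_sum R ?Hs)) = 4 * n + 2" using i(3) by (simp add: sum_list_replicate)
  ultimately show ?thesis using i(1) c unfolding saturated_def by blast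
qed

text \<open>The packing consists of \<open>2 * n\<close> inner modules and the pair formed by the
  two outer points.\<close>

lemma saturated_C3:
  assumes R: "tournament_on (length Hs) R" and Hs: "set Hs \<subseteq> {one, two, C3}"
    and c: "(\<Sum>H\<leftarrow>Hs. card (pverts H)) = 4 * n" "length (filter (\<lambda>H. 2 \<le> card (pverts H)) Hs) = 2 * n" "1 \<le> n"
  shows "saturated n (lex_sum C3 [one, one, lex_sum R Hs])"
proof -
  let ?Gs = "[one, one, lex_sum R Hs]"
  note i = inner_sum[OF R Hs]
  have T: "tournament (lex_sum C3 ?Gs)"
    using i(1) tournament_summands(1) tournament_C3 by (intro tournament_lex_sum) (auto simp: numeral_3_eq_3)
  obtain F where F: "module_family (lex_sum R Hs) F" "card F = 2 * n"
    using module_family_lex_sum[of R Hs] c by auto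
  then have "F \<noteq> {}" using c by auto
  then obtain F' where "packing (lex_sum C3 ?Gs) F'" "card F' = Suc (card F)"
    using outer_packing[OF T, of 2 F 0] F i(2) by auto
  moreover have "card (pverts (lex_sum C3 ?Gs)) = 4 * n + 2"
    using i(2,3) c by (subst card_lex_sum) auto
  ultimately show ?thesis using T F(2) unfolding saturated_def by auto
qed

text \<open>The packing consists of \<open>2 * n\<close> inner modules and the source.\<close>

lemma saturated_two:
  assumes R: "tournament_on (length Hs) R" and Hs: "set Hs \<subseteq> {one, two, C3}"
    and c: "(\<Sum>H\<leftarrow>Hs. card (pverts H)) = 4 * n + 1" "length (filter (\<lambda>H. 2 \<le> card (pverts H)) Hs) = 2 * n" "1 \<le> n"
  shows "saturated n (lex_sum two [one, lex_sum R Hs])"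
proof -
  let ?Gs = "[one, lex_sum R Hs]"
  note i = inner_sum[OF R Hs]
  have T: "tournament (lex_sum two ?Gs)"
    using i(1) tournament_summands(1) tournament_transitive[of 2] by (intro tournament_lex_sum) (auto simp: numeral_2_eq_2)
  obtain F where F: "module_family (lex_sum R Hs) F" "card F = 2 * n"
    using module_family_lex_sum[of R Hs] c by auto
  then have "F \<noteq> {}" using c by auto
  then obtain F' where "packing (lex_sum two ?Gs) F'" "card F' = Suc (card F)"
    using outer_packing[OF T, of 1 F 0] F i(2) by auto
  moreover have "card (pverts (lex_sum two ?Gs)) = 4 * n + 2"
    using i(2,3) c by (subst card_lex_sum) auto
  ultimately show ?thesis using T F(2) unfolding saturated_def by auto
qed

text \<open>The packing consists of \<open>2 * n - 1\<close> inner modules, the source and the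
  sink.\<close>

lemma saturated_three:
  assumes R: "tournament_on (length Hs) R" and Hs: "set Hs \<subseteq> {one, two, C3}"
    and c: "(\<Sum>H\<leftarrow>Hs. card (pverts H)) = 4 * n" "length (filter (\<lambda>H. 2 \<le> card (pverts H)) Hs) + 1 = 2 * n"
  shows "saturated n (lex_sum three [one, lex_sum R Hs, one])"
proof -
  let ?Gs = "[one, lex_sum R Hs, one]"
  note i = inner_sum[OF R Hs]
  have T: "tournament (lex_sum three ?Gs)"
    using i(1) tournament_summands(1) tournament_transitive[of 3] by (intro tournament_lex_sum) (auto simp: numeral_3_eq_3)
  obtain F where F: "module_family (lex_sum R Hs) F" "card F + 1 = 2 * n"
    using module_family_lex_sum[of R Hs] c by auto
  have "F \<noteq> {}"
  proof
    assume "F = {}"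
    then have "1 = 2 * n" using F(2) by simp
    then show False by presburger
  qed
  then obtain F' where F': "packing (lex_sum three ?Gs) F'" "card F' = card F + 2"
    using outer_packing_three[OF i(1) F(1)] by blast
  moreover have "card (pverts (lex_sum three ?Gs)) = 4 * n + 2"
    using i(2,3) c by (subst card_lex_sum) auto
  moreover have "card F' = 2 * n + 1" using F' F(2) by linarith
  ultimately show ?thesis using T unfolding saturated_def by blast
qed

context tournament
begin

definition is_sink :: "'a \<Rightarrow> bool" where
  "is_sink t \<longleftrightarrow> t \<in> V \<and> (\<forall>v\<in>V - {t}. v \<rhd> t)"

lemma is_source_dual: "tournament.is_source (dual G) t \<longleftrightarrow> is_sink t"
  unfolding tournament.is_source_def[OF tournament_dual] is_sink_def by simp

text \<open>\<open>D1\<close> collects the singleton members. If it is nonempty,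
  \<open>compl_type_unique\<close> makes all other members modules; if it is empty, \<open>F\<close>
  may contain one complement of a module.\<close>

lemma canonical_split:
  assumes D: "canonical G D r" and V: "3 \<le> card V"
  obtains D1 F where "\<Union>F \<subseteq> V - \<Union>D1" "pairwise disjnt F" "\<forall>M\<in>F. 2 \<le> card M" "\<forall>M\<in>F. min_comodule G M"
    "card (V - \<Union>D1) = card V - card D1" "card D = card D1 + card F"
    "D1 \<noteq> {} \<longrightarrow> (\<forall>M\<in>F. nontrivial_module G M)"
    "D1 = {} \<or> (\<exists>s. D1 = {{s}} \<and> (is_source s \<or> is_sink s)) \<or>
      (\<exists>s t. D1 = {{s}, {t}} \<and> s \<noteq> t \<and> is_source s \<and> is_sink t)"
proof -
  note c = canonicalD[OF D]
  define D1 where "D1 = {M \<in> D. card M = 1}"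
  define F where "F = D - D1"
  have c0: "card M \<noteq> 0" if "M \<in> D" for M using c(1)[OF that] min_comoduleD(3,4) by auto
  have F2: "2 \<le> card M" if "M \<in> F" for M
  proof -
    have "card M \<noteq> 0" "card M \<noteq> 1" using c0[of M] that by (auto simp: F_def D1_def)
    then show ?thesis by linarith
  qed
  have single: "\<not> nontrivial_module G M \<and> (\<exists>t. M = {t} \<and> (is_source t \<or> is_sink t))" if M1: "M \<in> D1" for M
  proof -
    have M: "M \<in> D" "card M = 1" using M1 by (auto simp: D1_def)
    then have nt: "\<not> nontrivial_module G M" "\<not> 2 \<le> card M" by (auto simp: nontrivial_module_def)
    obtain t where "M = {t}" "t \<in> V" "is_source t \<or> (\<forall>v\<in>V - {t}. v \<rhd> t)"
      by (rule min_comodule_card_1[OF c(1)[OF M(1)] nt])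
    then show ?thesis using nt by (auto simp: is_sink_def)
  qed
  have so: "s = s'" if "is_source s" "is_source s'" for s s'
    using that arc_asym unfolding is_source_def by blast
  have si: "s = s'" if "is_sink s" "is_sink s'" for s s'
    using that arc_asym unfolding is_sink_def by blast
  have ss: "\<not> (is_source s \<and> is_sink s)" for s
  proof
    assume a: "is_source s \<and> is_sink s"
    have "V \<noteq> {s}" using V by auto
    then obtain v where "v \<in> V - {s}" using a by (auto simp: is_source_def)
    then show False using a arc_asym unfolding is_source_def is_sink_def by blast
  qed
  have cases: "D1 = {} \<or> (\<exists>s. D1 = {{s}} \<and> (is_source s \<or> is_sink s)) \<or>
      (\<exists>s t. D1 = {{s}, {t}} \<and> s \<noteq> t \<and> is_source s \<and> is_sink t)"
  proof (cases "\<exists>s t. {s} \<in> D1 \<and> {t} \<in> D1 \<and> is_source s \<and> is_sink t")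
    case True
    then obtain s t where st: "{s} \<in> D1" "{t} \<in> D1" "is_source s" "is_sink t" by blast
    have "M = {s} \<or> M = {t}" if "M \<in> D1" for M using single[OF that] so si st by blast
    then have "D1 = {{s}, {t}}" using st by blast
    moreover have "s \<noteq> t" using st ss by blast
    ultimately show ?thesis using st by blast
  next
    case no: False
    show ?thesis
    proof (cases "D1 = {}")
      case False
      then obtain M where M: "M \<in> D1" by blast
      then obtain s where s: "M = {s}" "is_source s \<or> is_sink s" using single by blast
      have "N = M" if N: "N \<in> D1" for N
      proof -
        obtain t where t: "N = {t}" "is_source t \<or> is_sink t" using single[OF N] by blast
        have "\<not> (is_source s \<and> is_sink t)" "\<not> (is_source t \<and> is_sink s)" using no M N s(1) t(1) by blast+
        then have "s = t" using s(2) t(2) so si by blast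
        then show ?thesis using t s by simp
      qed
      then have "D1 = {{s}}" using M s by blast
      then show ?thesis using s by blast
    qed simp
  qed
  have nt: "nontrivial_module G M" if "D1 \<noteq> {}" and MF: "M \<in> F" for M
  proof (rule ccontr)
    assume a: "\<not> nontrivial_module G M"
    obtain N where N: "N \<in> D1" using \<open>D1 \<noteq> {}\<close> by blast
    then have "M = N"
      using compl_type_unique[OF _ a F2[OF MF]] single[OF N] c(1) MF by (auto simp: F_def D1_def)
    then show False using N MF by (auto simp: F_def)
  qed
  have disj: "pairwise disjnt D" using c(5) by (auto simp: pairwise_def disjnt_def)
  have sub: "M \<subseteq> V" if "M \<in> D" for M using c(1)[OF that] min_comoduleD(2) by blast
  have U: "\<Union>F \<subseteq> V - \<Union>D1"
  proof
    fix x assume "x \<in> \<Union>F"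
    then obtain M where M: "M \<in> F" "x \<in> M" by blast
    have "x \<notin> N" if "N \<in> D1" for N
    proof -
      have "M \<inter> N = {}" using c(5)[of M N] M that by (auto simp: F_def D1_def)
      then show ?thesis using M by blast
    qed
    then show "x \<in> V - \<Union>D1" using M sub by (auto simp: F_def)
  qed
  have dF: "pairwise disjnt F" using disj by (rule pairwise_subset) (auto simp: F_def)
  have cV: "card (V - \<Union>D1) = card V - card D1"
  proof -
    have U: "\<Union>D1 \<subseteq> V" using sub by (auto simp: D1_def)
    have "pairwise disjnt D1" using disj by (rule pairwise_subset) (auto simp: D1_def)
    moreover have "finite M" if "M \<in> D1" for M using that c(1) min_comoduleD(3) by (auto simp: D1_def)
    ultimately have "card (\<Union>D1) = sum card D1" by (intro card_Union_disjoint) auto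
    also have "\<dots> = card D1" by (simp add: D1_def)
    finally show ?thesis using card_Diff_subset[OF finite_subV[OF U] U] by simp
  qed
  have cD: "card D = card D1 + card F"
  proof -
    have "card (D1 \<union> F) = card D1 + card F"
      using c(7) by (intro card_Un_disjoint) (auto simp: D1_def F_def)
    moreover have "D1 \<union> F = D" by (auto simp: D1_def F_def)
    ultimately show ?thesis by simp
  qed
  have m: "\<forall>M\<in>F. min_comodule G M" using c(1) by (auto simp: F_def)
  have "\<forall>M\<in>F. 2 \<le> card M" using F2 by blast
  moreover have "D1 \<noteq> {} \<longrightarrow> (\<forall>M\<in>F. nontrivial_module G M)" using nt by blast
  ultimately show ?thesis using that[OF U dF _ m cV cD _ cases] by blast
qed

text \<open>A singleton uses one vertex where other members use at least two, so \<open>k\<close>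
  singletons raise the bound \<open>2 * n + 1\<close> by \<open>k / 2\<close>, and \<open>k\<close>
  is at most 2.\<close>

lemma card_canonical_le:
  assumes D: "canonical G D r" and V: "card V = 4 * n + 2" "1 \<le> n"
  shows "card D \<le> 2 * n + 2"
proof -
  have V3: "3 \<le> card V" using V by linarith
  show ?thesis
  proof (rule canonical_split[OF D V3])
    fix D1 F assume s: "\<Union>F \<subseteq> V - \<Union>D1" "pairwise disjnt F" "\<forall>M\<in>F. 2 \<le> card M"
      "card (V - \<Union>D1) = card V - card D1" "card D = card D1 + card F"
      "D1 = {} \<or> (\<exists>s. D1 = {{s}} \<and> (is_source s \<or> is_sink s)) \<or>
        (\<exists>s t. D1 = {{s}, {t}} \<and> s \<noteq> t \<and> is_source s \<and> is_sink t)"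
    have "card D1 \<le> 2" using s(6) by auto
    moreover have "2 * card F \<le> card (V - \<Union>D1)"
      using card_Union_ge(3)[OF _ s(1-3)] finite_subV by blast
    ultimately show ?thesis using s(4,5) V by linarith
  qed
qed

end

text \<open>The upper bound is \<open>(2 * n + 3) div 2\<close>. It is attained by the form (F4)
  over a transitive tournament.\<close>

lemma max_decomposability_index_eq:
  assumes n: "1 \<le> n"
  shows "max_decomposability_index (4 * n + 2) = n + 1"
  unfolding max_decomposability_index_def
proof (rule Max_eqI)
  let ?S = "{decomposability_index T | T :: nat pair_pre_digraph. tournament T \<and> card (pverts T) = 4 * n + 2}"
  have le: "k \<le> n + 1" if k: "k \<in> ?S" for k
  proof -
    obtain T :: "nat pair_pre_digraph" where T: "k = decomposability_index T" "tournament T" "card (pverts T) = 4 * n + 2"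
      using k by blast
    interpret tournament T by (rule T(2))
    obtain D r where D: "canonical T D r" using ex_canonical by blast
    have "k \<le> (card D + 1) div 2" using decomposability_index_le_canonical[OF _ D] T n by simp
    then show ?thesis using card_canonical_le[OF D T(3) n] by linarith
  qed
  then show "\<And>k. k \<in> ?S \<Longrightarrow> k \<le> n + 1" .
  have "?S \<subseteq> {..n + 1}" using le by blast
  then show "finite ?S" using finite_subset by blast
  let ?T = "lex_sum (transitive_tournament (2 * n + 1)) (replicate (2 * n + 1) two)"
  have f: "saturated n ?T" using saturated_F4[OF tournament_transitive n] .
  then interpret tournament ?T by (simp add: saturated_def)
  obtain F where F: "packing ?T F" "card F = 2 * n + 1" using f by (auto simp: saturated_def)
  have "6 \<le> card V" using f n by (simp add: saturated_def)
  then have "card F \<le> 2 * decomposability_index ?T" using card_packing_le_index[OF _ F(1)] by blast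
  then have "n + 1 \<le> decomposability_index ?T" using F by linarith
  have "tournament ?T" "card (pverts ?T) = 4 * n + 2" using f unfolding saturated_def by blast+
  then have S: "decomposability_index ?T \<in> ?S" by blast
  have "n + 1 = decomposability_index ?T" using le[OF S] \<open>n + 1 \<le> _\<close> by (rule antisym[rotated])
  then show "n + 1 \<in> ?S" using S by (simp only:)
qed

text \<open>The packing is carried over from \<open>H\<close>, while the upper bound is proved for
  \<open>T\<close> itself, so the two vertex types may differ.\<close>

lemma saturated_imp_delta_maximal:
  assumes "saturated n H" "1 \<le> n" "T \<simeq> H"
  shows "T \<in> delta_maximal (4 * n + 2)"
proof -
  have H: "tournament H" using assms by (simp add: saturated_def)
  obtain F where F: "packing H F" "card F = 2 * n + 1" using assms by (auto simp: saturated_def)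
  interpret tournament T by (rule isomorphic_tournament[OF H assms(3)])
  have c: "card V = 4 * n + 2" using isomorphic_card[OF H assms(3)] assms(1) by (simp add: saturated_def)
  obtain F' where F': "packing T F'" "card F' = 2 * n + 1"
    using isomorphic_packing[OF H assms(3) F(1)] F(2) by auto
  have "2 * n + 1 \<le> 2 * decomposability_index T"
    using card_packing_le_index[OF _ F'(1)] c F'(2) assms(2) by simp
  moreover obtain D r where D: "canonical T D r" using ex_canonical by blast
  have "decomposability_index T \<le> (card D + 1) div 2"
    using decomposability_index_le_canonical[OF _ D] c assms(2) by simp
  moreover have "card D \<le> 2 * n + 2" using card_canonical_le[OF D c assms(2)] .
  ultimately have "decomposability_index T = n + 1" by linarith
  then show ?thesis using c tournament_axioms max_decomposability_index_eq[OF assms(2)]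
    by (simp add: delta_maximal_def)
qed

section \<open>The extremal tournaments\<close>

context tournament
begin

section \<open>Blocks of at most four elements\<close>

lemma sub_iso_one: "sub_iso G {a} one"
  unfolding sub_iso_def
  by (rule exI[of _ "\<lambda>_. 0"]) (auto simp: bij_betw_def parcs_transitive)

lemma sub_iso_two:
  assumes "card M = 2" "M \<subseteq> V"
  shows "sub_iso G M two"
proof -
  obtain a b where ab: "M = {a, b}" "a \<rhd> b"
  proof -
    obtain a b where "M = {a, b}" "a \<noteq> b" using assms(1) card_2_iff by metis
    then show ?thesis using that[of a b] that[of b a] arc_total[of a b] assms(2) by auto
  qed
  have ne: "a \<noteq> b" "\<not> b \<rhd> a" using ab arc_asym by auto
  have "bij_betw (\<lambda>x. if x = a then 0 else 1) M (pverts two)"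
    using ab ne by (auto simp: bij_betw_def inj_on_def)
  moreover have "\<forall>x\<in>M. \<forall>y\<in>M. x \<rhd> y \<longleftrightarrow>
      ((if x = a then 0 else 1), (if y = a then 0 else 1)) \<in> parcs two"
    using ab ne by (auto simp: parcs_transitive)
  ultimately show ?thesis unfolding sub_iso_def by blast
qed

text \<open>A transitive triple that is a module contains two-element modules of \<open>G\<close>,
  which minimality excludes.\<close>

lemma sub_iso_C3:
  assumes M: "min_comodule G M" "nontrivial_module G M" "card M = 3"
  shows "sub_iso G M C3"
proof -
  note m = nontrivial_moduleD[OF M(2)]
  have sep: "(\<forall>v\<in>M - {x, y}. v \<rhd> x \<longleftrightarrow> v \<rhd> y) \<Longrightarrow> False" if xy: "x \<in> M" "y \<in> M" "x \<noteq> y" for x y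
  proof -
    assume *: "\<forall>v\<in>M - {x, y}. v \<rhd> x \<longleftrightarrow> v \<rhd> y"
    have "is_module G {x, y}"
    proof (rule is_moduleI)
      fix v a b assume v: "v \<in> V" "v \<notin> {x, y}" "a \<in> {x, y}" "b \<in> {x, y}" "v \<rhd> a"
      show "v \<rhd> b"
        using * v module_in[OF m(1), of v a b] xy by (cases "v \<in> M") auto
    qed (use xy m in auto)
    moreover have "card {x, y} = 2" using xy by simp
    moreover from this have "{x, y} \<subset> M" using xy M(3) by auto
    ultimately show False using module_in_min_comodule[OF M(1)] by fastforce
  qed
  obtain a b c where abc: "M = {a, b, c}" "a \<rhd> b" "a \<noteq> b" "b \<noteq> c" "a \<noteq> c"
  proof -
    obtain a b c where abc: "M = {a, b, c}" "a \<noteq> b" "b \<noteq> c" "a \<noteq> c" using M(3) by (auto simp: card_3_iff)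
    then have "a \<rhd> b \<or> b \<rhd> a" using arc_total[of a b] m by blast
    then show ?thesis
    proof
      assume "a \<rhd> b"
      then show ?thesis using that[of a b c] abc by blast
    next
      assume "b \<rhd> a"
      then show ?thesis using that[of b a c] abc by blast
    qed
  qed
  have MV: "a \<in> V" "b \<in> V" "c \<in> V" using abc m by blast+
  have "\<not> (c \<rhd> a \<longleftrightarrow> c \<rhd> b)" using sep[of a b] abc by auto
  moreover have "\<not> (a \<rhd> b \<longleftrightarrow> a \<rhd> c)" using sep[of b c] abc by auto
  ultimately have arcs: "c \<rhd> a" "b \<rhd> c" "\<not> a \<rhd> c" "\<not> c \<rhd> b" "\<not> b \<rhd> a"
    using arc_total[of a c] arc_total[of b c] arc_asym abc MV by blast+
  have "bij_betw (\<lambda>x. if x = a then 0 else if x = b then 1 else 2) M (pverts C3)"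
    using abc by (auto simp: bij_betw_def inj_on_def)
  moreover have "\<forall>x\<in>M. \<forall>y\<in>M. x \<rhd> y \<longleftrightarrow> ((if x = a then 0 else if x = b then 1 else 2),
      (if y = a then 0 else if y = b then 1 else 2)) \<in> parcs C3"
    using abc arcs by (auto simp: C3_def)
  ultimately show ?thesis unfolding sub_iso_def by blast
qed

text \<open>Every tournament on four vertices is decomposable, and a nontrivial module of the one
  induced on \<open>M\<close> would be a smaller comodule of \<open>G\<close>.\<close>

lemma min_comodule_card_neq_4:
  assumes M: "min_comodule G M" "nontrivial_module G M"
  shows "card M \<noteq> 4"
proof
  assume c: "card M = 4"
  note m = nontrivial_moduleD[OF M(2)]
  have sep: False if N: "N \<subset> M" "2 \<le> card N" "\<forall>v\<in>M - N. \<forall>x\<in>N. \<forall>y\<in>N. v \<rhd> x \<longleftrightarrow> v \<rhd> y" for N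
  proof -
    have "is_module G N"
    proof (rule is_moduleI)
      show "N \<subseteq> V" using N m by blast
      fix v a b assume v: "v \<in> V" "v \<notin> N" "a \<in> N" "b \<in> N" "v \<rhd> a"
      show "v \<rhd> b"
      proof (cases "v \<in> M")
        case True
        then show ?thesis using N(3) v by blast
      next
        case False
        then show ?thesis using module_in[OF m(1), of v a b] v N(1) by blast
      qed
    qed
    then show False using module_in_min_comodule[OF M(1)] N by fastforce
  qed
  have p2: "\<not> ((w \<rhd> x \<longleftrightarrow> w \<rhd> y) \<and> (z \<rhd> x \<longleftrightarrow> z \<rhd> y))"
    if "M = {x, y, w, z}" "x \<noteq> y" for w x y z
  proof
    assume "(w \<rhd> x \<longleftrightarrow> w \<rhd> y) \<and> (z \<rhd> x \<longleftrightarrow> z \<rhd> y)"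
    moreover have c2: "card {x, y} = 2" using that(2) by simp
    moreover have "{x, y} \<subset> M"
    proof -
      have "{x, y} \<noteq> M" using c c2 by auto
      then show ?thesis using that(1) by blast
    qed
    ultimately show False using sep[of "{x, y}"] that(1) by auto
  qed
  have p3: "\<not> ((z \<rhd> x \<longleftrightarrow> z \<rhd> y) \<and> (z \<rhd> y \<longleftrightarrow> z \<rhd> w))"
    if "M = {x, y, w, z}" "x \<noteq> y" "y \<noteq> w" "x \<noteq> w" for w x y z
  proof
    assume "(z \<rhd> x \<longleftrightarrow> z \<rhd> y) \<and> (z \<rhd> y \<longleftrightarrow> z \<rhd> w)"
    moreover have c3: "card {x, y, w} = 3" using that(2-4) by simp
    moreover have "{x, y, w} \<subset> M"
    proof -
      have "{x, y, w} \<noteq> M" using c c3 by auto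
      then show ?thesis using that(1) by blast
    qed
    ultimately show False using sep[of "{x, y, w}"] that(1) by auto
  qed
  obtain x where "x \<in> M" using c by fastforce
  then have "card (M - {x}) = 3" using c by simp
  then obtain y w z where yzw: "M - {x} = {y, w, z}" "y \<noteq> w" "w \<noteq> z" "y \<noteq> z" by (auto simp: card_3_iff)
  then have eq: "M = {x, y, w, z}" and ne: "x \<noteq> y" "x \<noteq> w" "x \<noteq> z" using \<open>x \<in> M\<close> by blast+
  have V: "x \<in> V" "y \<in> V" "w \<in> V" "z \<in> V" using eq m by blast+
  have eqs: "M = {x, w, y, z}" "M = {x, z, y, w}" "M = {y, w, x, z}" "M = {y, z, x, w}" "M = {w, z, x, y}"
    "M = {x, y, z, w}" "M = {x, w, z, y}" "M = {y, w, z, x}" using eq by auto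
  note t = arc_total[OF V(1,2) ne(1)] arc_total[OF V(1,3) ne(2)] arc_total[OF V(1,4) ne(3)]
    arc_total[OF V(2,3) yzw(2)] arc_total[OF V(2,4) yzw(4)] arc_total[OF V(3,4) yzw(3)]
  \<comment> \<open>No orientation of the six arcs satisfies the six conditions on pairs and the
    four on triples.\<close>
  show False
    using p2[OF eq ne(1)] p2[OF eqs(1) ne(2)] p2[OF eqs(2) ne(3)] p2[OF eqs(3) yzw(2)]
      p2[OF eqs(4) yzw(4)] p2[OF eqs(5) yzw(3)]
      p3[OF eq ne(1) yzw(2) ne(2)] p3[OF eqs(6) ne(1) yzw(4) ne(3)]
      p3[OF eqs(7) ne(2) yzw(3) ne(3)] p3[OF eqs(8) yzw(2,3,4)] t
    by argo
qed

lemma singleton_module: "a \<in> V \<Longrightarrow> is_module G {a}"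
  by (simp add: is_module_def)

text \<open>\<open>L\<close> lists the exceptional blocks (points or 3-cycles) with their types
  \<open>Ls\<close>, and \<open>F\<close> holds the pairs. Since blocks are modules, all arcs
  between two of them have the same direction, so the quotient \<open>R\<close> is read off one
  vertex \<open>p i\<close> of each block.\<close>

lemma inner_form:
  assumes F: "finite F" "pairwise disjnt F" "\<And>M. M \<in> F \<Longrightarrow> is_module G M" "\<And>M. M \<in> F \<Longrightarrow> card M = 2"
    and L: "distinct L" "pairwise disjnt (set L)" "\<And>B. B \<in> set L \<Longrightarrow> is_module G B"
      "{} \<notin> set L" "list_all2 (sub_iso G) L Ls"
    and LF: "\<And>B. B \<in> set L \<Longrightarrow> disjnt B (\<Union>F)"
    and X: "X = \<Union>(set L) \<union> \<Union>F" and k: "card F = k"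
  shows "\<exists>R. tournament_on (length Ls + k) R \<and> sub_iso G X (lex_sum R (Ls @ replicate k two))"
proof -
  obtain Fs where Fs: "set Fs = F" "distinct Fs" using finite_distinct_list[OF F(1)] by blast
  then have lenF: "length Fs = k" using k distinct_card by force
  have lenL: "length L = length Ls" using L(5) by (rule list_all2_lengthD)
  define Bs where "Bs = L @ Fs"
  define m where "m = length Ls + k"
  have lenB: "length Bs = m" by (simp add: Bs_def m_def lenL lenF)
  have F0: "M \<noteq> {}" if "M \<in> F" for M using F(4)[OF that] by auto
  have LF': "disjnt B M" if "B \<in> set L" "M \<in> F" for B M using LF[OF that(1)] that(2) by (auto simp: disjnt_iff)
  have "set L \<inter> set Fs = {}"
  proof (rule ccontr)
    assume "set L \<inter> set Fs \<noteq> {}"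
    then obtain B where "B \<in> set L" "B \<in> F" using Fs by blast
    then show False using LF'[of B B] F0 by auto
  qed
  then have dB: "distinct Bs" using L(1) Fs by (simp add: Bs_def)
  have pB: "pairwise disjnt (set Bs)"
  proof (rule pairwiseI)
    fix A B assume "A \<in> set Bs" "B \<in> set Bs" "A \<noteq> B"
    then consider "A \<in> set L" "B \<in> set L" | "A \<in> F" "B \<in> F" | "A \<in> set L" "B \<in> F" | "A \<in> F" "B \<in> set L"
      using Fs(1) by (auto simp: Bs_def)
    then show "disjnt A B"
    proof cases
      case 1
      then show ?thesis using L(2) \<open>A \<noteq> B\<close> by (simp add: pairwiseD)
    next
      case 2
      then show ?thesis using F(2) \<open>A \<noteq> B\<close> by (simp add: pairwiseD)
    next
      case 3
      then show ?thesis by (rule LF')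
    next
      case 4
      then show ?thesis using LF'[of B A] disjnt_sym by blast
    qed
  qed
  have mB: "is_module G B" "B \<noteq> {}" if "B \<in> set Bs" for B
    using that L(3,4) F(3) F0 Fs(1) by (auto simp: Bs_def)
  have nth: "Bs ! i \<in> set Bs" if "i < m" for i using that lenB by simp
  have disj: "Bs ! i \<inter> Bs ! j = {}" if "i < m" "j < m" "i \<noteq> j" for i j
  proof -
    have "Bs ! i \<noteq> Bs ! j" using dB that lenB nth_eq_iff_index_eq by blast
    then have "disjnt (Bs ! i) (Bs ! j)" using pB nth that by (simp add: pairwise_def)
    then show ?thesis by (simp add: disjnt_def)
  qed
  define p where "p i = (SOME x. x \<in> Bs ! i)" for i
  have p: "p i \<in> Bs ! i" if "i < m" for i
    unfolding p_def using mB(2)[OF nth[OF that]] by (simp add: some_in_eq)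
  have pV: "p i \<in> V" if "i < m" for i using p[OF that] mB(1)[OF nth[OF that]] module_subset by blast
  have pne: "p i \<noteq> p j" if "i < m" "j < m" "i \<noteq> j" for i j using p disj[OF that] that by (metis disjoint_iff)
  define R where "R = \<lparr>pverts = {..<m}, parcs = {(i, j). i < m \<and> j < m \<and> i \<noteq> j \<and> p i \<rhd> p j}\<rparr>"
  have R: "tournament_on m R"
    unfolding tournament_on_def
  proof
    have "parcs R \<subseteq> {..<m} \<times> {..<m}" by (auto simp: R_def)
    then have "finite (parcs R)" using finite_subset by blast
    then show "tournament R"
      using arc_total[OF pV pV pne] by unfold_locales (auto simp: R_def)
  qed (simp add: R_def)
  have "sub_iso G X (lex_sum R (Ls @ replicate k two))"
  proof (rule sub_iso_lex_sum)
    have len: "length (Ls @ replicate k two) = m" by (simp add: m_def)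
    show "length Bs = length (Ls @ replicate k two)" using lenB len by simp
    show "X = \<Union>(set Bs)" using X Fs by (auto simp: Bs_def)
    fix i assume i: "i < length (Ls @ replicate k two)"
    show "sub_iso G (Bs ! i) ((Ls @ replicate k two) ! i)"
    proof (cases "i < length Ls")
      case True
      then show ?thesis using L(5) lenL by (simp add: Bs_def nth_append list_all2_nthD2)
    next
      case False
      then have "Fs ! (i - length Ls) \<in> F" using i Fs lenF by auto
      then show ?thesis
        using False i lenL sub_iso_two F(4) module_subset[OF F(3)] by (simp add: Bs_def nth_append)
    qed
    fix j assume j: "j < length (Ls @ replicate k two)" and ij: "i \<noteq> j"
    have im: "i < m" and jm: "j < m" using i j len by simp_all
    show "Bs ! i \<inter> Bs ! j = {}" using disj im jm ij by blast
    fix a b assume ab: "a \<in> Bs ! i" "b \<in> Bs ! j"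
    have ni: "p i \<notin> Bs ! j" "b \<notin> Bs ! i" using disj[OF im jm ij] p[OF im] ab by blast+
    have bV: "b \<in> V" using ab mB(1)[OF nth[OF jm]] module_subset by blast
    have "a \<rhd> b \<longleftrightarrow> p i \<rhd> b"
      using module_out[OF mB(1)[OF nth[OF im]] bV ni(2) ab(1) p[OF im]] .
    also have "\<dots> \<longleftrightarrow> p i \<rhd> p j"
      using module_in[OF mB(1)[OF nth[OF jm]] pV[OF im] ni(1) ab(2) p[OF jm]] .
    finally show "a \<rhd> b \<longleftrightarrow> (i, j) \<in> parcs R" using im jm ij by (simp add: R_def)
  qed
  then show ?thesis using R unfolding m_def by blast
qed

section \<open>Recognition of the outer sums\<close>

lemma outer_two:
  assumes s: "is_source s" and L: "sub_iso G (V - {s}) L"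
  shows "sub_iso G V (lex_sum two [one, L])"
proof (rule sub_iso_lex_sum[of "[{s}, V - {s}]"])
  have 2: "i = 0 \<or> i = 1" if "i < length [one, L]" for i using that by auto
  have sV: "s \<in> V" "\<And>v. v \<in> V \<Longrightarrow> v \<noteq> s \<Longrightarrow> s \<rhd> v \<and> \<not> v \<rhd> s"
    using s arc_asym by (auto simp: is_source_def)
  show "V = \<Union>(set [{s}, V - {s}])" using sV by auto
  fix i assume i: "i < length [one, L]"
  show "sub_iso G ([{s}, V - {s}] ! i) ([one, L] ! i)" using 2[OF i] L sub_iso_one by auto
  fix j assume j: "j < length [one, L]" and ij: "i \<noteq> j"
  show "[{s}, V - {s}] ! i \<inter> [{s}, V - {s}] ! j = {}" using 2[OF i] 2[OF j] ij by auto
  fix a b assume "a \<in> [{s}, V - {s}] ! i" "b \<in> [{s}, V - {s}] ! j"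
  then show "a \<rhd> b \<longleftrightarrow> (i, j) \<in> parcs two" using 2[OF i] 2[OF j] ij sV by (auto simp: parcs_transitive)
qed simp

lemma outer_three:
  assumes s: "is_source s" and t: "is_sink t" and st: "s \<noteq> t" and L: "sub_iso G (V - {s, t}) L"
  shows "sub_iso G V (lex_sum three [one, L, one])"
proof (rule sub_iso_lex_sum[of "[{s}, V - {s, t}, {t}]"])
  have 3: "i = 0 \<or> i = 1 \<or> i = 2" if "i < length [one, L, one]" for i using that by auto
  have sV: "s \<in> V" "\<And>v. v \<in> V \<Longrightarrow> v \<noteq> s \<Longrightarrow> s \<rhd> v \<and> \<not> v \<rhd> s"
    using s arc_asym by (auto simp: is_source_def)
  have tV: "t \<in> V" "\<And>v. v \<in> V \<Longrightarrow> v \<noteq> t \<Longrightarrow> v \<rhd> t \<and> \<not> t \<rhd> v"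
    using t arc_asym by (auto simp: is_sink_def)
  show "V = \<Union>(set [{s}, V - {s, t}, {t}])" using sV tV by auto
  fix i assume i: "i < length [one, L, one]"
  show "sub_iso G ([{s}, V - {s, t}, {t}] ! i) ([one, L, one] ! i)" using 3[OF i] L sub_iso_one by auto
  fix j assume j: "j < length [one, L, one]" and ij: "i \<noteq> j"
  show "[{s}, V - {s, t}, {t}] ! i \<inter> [{s}, V - {s, t}, {t}] ! j = {}" using 3[OF i] 3[OF j] ij st by auto
  fix a b assume "a \<in> [{s}, V - {s, t}, {t}] ! i" "b \<in> [{s}, V - {s, t}, {t}] ! j"
  then show "a \<rhd> b \<longleftrightarrow> (i, j) \<in> parcs three"
    using 3[OF i] 3[OF j] ij sV tV st by (auto simp: parcs_transitive)
qed simp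

lemma outer_C3:
  assumes ab: "a \<rhd> b" and K: "V = insert a (insert b K)" "a \<notin> K" "b \<notin> K"
    and arcs: "\<And>k. k \<in> K \<Longrightarrow> b \<rhd> k" "\<And>k. k \<in> K \<Longrightarrow> k \<rhd> a" and L: "sub_iso G K L"
  shows "sub_iso G V (lex_sum C3 [one, one, L])"
proof (rule sub_iso_lex_sum[of "[{a}, {b}, K]"])
  have 3: "i = 0 \<or> i = 1 \<or> i = 2" if "i < length [one, one, L]" for i using that by auto
  have ne: "a \<noteq> b" "\<not> b \<rhd> a" using ab arc_asym by auto
  show "V = \<Union>(set [{a}, {b}, K])" using K by auto
  fix i assume i: "i < length [one, one, L]"
  show "sub_iso G ([{a}, {b}, K] ! i) ([one, one, L] ! i)" using 3[OF i] L sub_iso_one by auto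
  fix j assume j: "j < length [one, one, L]" and ij: "i \<noteq> j"
  show "[{a}, {b}, K] ! i \<inter> [{a}, {b}, K] ! j = {}" using 3[OF i] 3[OF j] ij ne K by auto
  fix x y assume "x \<in> [{a}, {b}, K] ! i" "y \<in> [{a}, {b}, K] ! j"
  then show "x \<rhd> y \<longleftrightarrow> (i, j) \<in> parcs C3"
    using 3[OF i] 3[OF j] ij ne ab arcs arc_asym by (auto simp: C3_def)
qed simp

text \<open>Outside the source there are \<open>4 * n + 1\<close> vertices and exactly
  \<open>2 * n\<close> blocks, hence one surplus vertex: a single point or the third vertex of a
  3-cycle.\<close>

lemma source_form:
  assumes n: "1 \<le> n" and V: "card V = 4 * n + 2" and s: "is_source s"
    and F: "\<Union>F \<subseteq> V - {s}" "pairwise disjnt F" "\<forall>M\<in>F. min_comodule G M" "\<forall>M\<in>F. nontrivial_module G M"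
    and c: "2 * n \<le> card F"
  shows "(\<exists>R. tournament_on (2 * n + 1) R \<and>
       sub_iso G V (lex_sum two [one, lex_sum R (one # replicate (2 * n) two)])) \<or>
    (\<exists>R. tournament_on (2 * n) R \<and>
       sub_iso G V (lex_sum two [one, lex_sum R (C3 # replicate (2 * n - 1) two)]))"
proof -
  let ?X = "V - {s}"
  have finX: "finite ?X" using pair_finite_verts by simp
  have cX: "card ?X = 4 * n + 1" using s V by (simp add: is_source_def)
  have g2: "\<forall>M\<in>F. 2 \<le> card M" using F(4) nontrivial_moduleD(2) by blast
  note ge = card_Union_ge[OF finX F(1,2) g2]
  have cF: "card F = 2 * n" using c ge(3) cX by linarith
  have mod: "is_module G M" if "M \<in> F" for M using F(4) that nontrivial_moduleD(1) by blast
  have e: "card ?X = 2 * card F + 1" using cX cF by simp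
  consider (point) z where "z \<in> ?X" "z \<notin> \<Union>F" "?X = insert z (\<Union>F)" "\<forall>M\<in>F. card M = 2"
    | (triple) M where "M \<in> F" "card M = 3" "?X = \<Union>F" "\<forall>N\<in>F - {M}. card N = 2"
    using surplus_1[OF finX F(1,2) g2 e] by metis
  then show ?thesis
  proof cases
    case (point z)
    have "\<exists>R. tournament_on (length [one] + 2 * n) R \<and> sub_iso G ?X (lex_sum R ([one] @ replicate (2 * n) two))"
    proof (rule inner_form[of F "[{z}]"])
      show "\<And>B. B \<in> set [{z}] \<Longrightarrow> disjnt B (\<Union>F)" using point(2) by simp
      show "?X = \<Union>(set [{z}]) \<union> \<Union>F" using point(3) by simp
      show "\<And>B. B \<in> set [{z}] \<Longrightarrow> is_module G B" using point(1) singleton_module by simp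
    qed (use ge(1) F(2) mod point(4) cF sub_iso_one in simp_all)
    then show ?thesis using outer_two[OF s] by auto
  next
    case (triple M)
    have r: "finite (F - {M})" "pairwise disjnt (F - {M})" "\<Union>(F - {M}) \<subseteq> ?X - M"
      using remove_block[OF finX F(1,2) triple(1)] ge(1) by auto
    have "\<exists>R. tournament_on (length [C3] + (2 * n - 1)) R \<and>
        sub_iso G ?X (lex_sum R ([C3] @ replicate (2 * n - 1) two))"
    proof (rule inner_form[of "F - {M}" "[M]"])
      show "?X = \<Union>(set [M]) \<union> \<Union>(F - {M})" using triple by auto
      show "list_all2 (sub_iso G) [M] [C3]" using sub_iso_C3 F triple by simp
      show "card (F - {M}) = 2 * n - 1" using triple(1) cF by simp
      show "\<And>B. B \<in> set [M] \<Longrightarrow> disjnt B (\<Union>(F - {M}))" using r(3) by (auto simp: disjnt_iff)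
      show "{} \<notin> set [M]" using triple(2) by auto
    qed (use r triple mod in auto)
    then show ?thesis using outer_two[OF s] n by auto
  qed
qed

text \<open>Outside the source and the sink there are \<open>4 * n\<close> vertices. With
  \<open>2 * n - 1\<close> blocks the surplus is 2: two points, a point and a 3-cycle, or two
  3-cycles. With \<open>2 * n\<close> blocks all are pairs, and one pair is regarded as two
  points.\<close>

lemma source_sink_form:
  assumes n: "1 \<le> n" and V: "card V = 4 * n + 2" and s: "is_source s" and t: "is_sink t" and st: "s \<noteq> t"
    and F: "\<Union>F \<subseteq> V - {s, t}" "pairwise disjnt F" "\<forall>M\<in>F. min_comodule G M" "\<forall>M\<in>F. nontrivial_module G M"
    and c: "2 * n - 1 \<le> card F"
  shows "(\<exists>R. tournament_on (2 * n + 1) R \<and>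
       sub_iso G V (lex_sum three [one, lex_sum R (one # one # replicate (2 * n - 1) two), one])) \<or>
    (\<exists>R. tournament_on (2 * n) R \<and>
       sub_iso G V (lex_sum three [one, lex_sum R (C3 # one # replicate (2 * n - 2) two), one])) \<or>
    (n \<ge> 2 \<and> (\<exists>R. tournament_on (2 * n - 1) R \<and>
       sub_iso G V (lex_sum three [one, lex_sum R (C3 # C3 # replicate (2 * n - 3) two), one])))"
proof -
  let ?X = "V - {s, t}"
  have finX: "finite ?X" using pair_finite_verts by simp
  have "{s, t} \<subseteq> V" using s t by (simp add: is_source_def is_sink_def)
  then have cX: "card ?X = 4 * n" using V st by (simp add: card_Diff_subset)
  have g2: "\<forall>M\<in>F. 2 \<le> card M" using F(4) nontrivial_moduleD(2) by blast
  have g4: "\<forall>M\<in>F. card M \<noteq> 4" using F(3,4) min_comodule_card_neq_4 by blast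
  note ge = card_Union_ge[OF finX F(1,2) g2]
  have mod: "is_module G M" if "M \<in> F" for M using F(4) that nontrivial_moduleD(1) by blast
  have MX: "M \<subseteq> ?X" if "M \<in> F" for M using F(1) that by blast
  \<comment> \<open>\<open>E\<close> may be smaller than \<open>F\<close>, so that one pair can be
    left out and its elements treated as points.\<close>
  have F8: ?thesis
    if zz: "z \<noteq> z'" "z \<in> ?X" "z' \<in> ?X" "z \<notin> \<Union>E" "z' \<notin> \<Union>E" "?X = insert z (insert z' (\<Union>E))"
      "E \<subseteq> F" "\<forall>M\<in>E. card M = 2" "card E = 2 * n - 1" for z z' E
  proof -
    have E: "finite E" "pairwise disjnt E"
      using zz(7) ge(1) F(2) finite_subset pairwise_subset by blast+
    have "\<exists>R. tournament_on (length [one, one] + (2 * n - 1)) R \<and>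
        sub_iso G ?X (lex_sum R ([one, one] @ replicate (2 * n - 1) two))"
    proof (rule inner_form[of E "[{z}, {z'}]"])
      show "\<And>B. B \<in> set [{z}, {z'}] \<Longrightarrow> disjnt B (\<Union>E)" using zz(4,5) by auto
      show "?X = \<Union>(set [{z}, {z'}]) \<union> \<Union>E" using zz(6) by (simp add: insert_commute)
      show "\<And>B. B \<in> set [{z}, {z'}] \<Longrightarrow> is_module G B" using zz(2,3) singleton_module by auto
      show "\<And>M. M \<in> E \<Longrightarrow> is_module G M" using mod zz(7) by blast
      show "\<And>M. M \<in> E \<Longrightarrow> card M = 2" using zz(8) by blast
      show "pairwise disjnt (set [{z}, {z'}])" using zz(1) by (simp add: pairwise_insert)
    qed (use E zz(1,9) sub_iso_one in simp_all)
    moreover have "length [one, one] + (2 * n - 1) = 2 * n + 1" using n by simp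
    ultimately show ?thesis using outer_three[OF s t st] by auto
  qed
  have "card F = 2 * n \<or> card F = 2 * n - 1" using c ge(3) cX by linarith
  then show ?thesis
  proof
    assume cF: "card F = 2 * n"
    then have "card ?X \<le> 2 * card F" using cX by simp
    note s0 = surplus_0[OF finX F(1,2) g2 this]
    have "F \<noteq> {}" using cF n by auto
    then obtain M where M: "M \<in> F" by blast
    have "card M = 2" using s0(1) M by blast
    then obtain z z' where z: "M = {z, z'}" "z \<noteq> z'" using card_2_iff by metis
    note r = remove_block[OF finX F(1,2) M]
    have U: "\<Union>F = M \<union> \<Union>(F - {M})" using M by blast
    show ?thesis
    proof (rule F8[of z z' "F - {M}"])
      show "z \<in> ?X" "z' \<in> ?X" using MX[OF M] z by blast+
      show "z \<notin> \<Union>(F - {M})" "z' \<notin> \<Union>(F - {M})" using r(2) z by blast+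
      show "?X = insert z (insert z' (\<Union>(F - {M})))" using s0(2) U z by blast
      show "card (F - {M}) = 2 * n - 1" using M cF by simp
    qed (use z s0 in auto)
  next
    assume cF: "card F = 2 * n - 1"
    then have e: "card ?X = 2 * card F + 2" using cX n by simp
    consider (points) z z' where "z \<noteq> z'" "z \<in> ?X - \<Union>F" "z' \<in> ?X - \<Union>F" "?X = insert z (insert z' (\<Union>F))"
        "\<forall>M\<in>F. card M = 2"
      | (triple) M z where "M \<in> F" "card M = 3" "z \<in> ?X - \<Union>F" "?X = insert z (\<Union>F)" "\<forall>N\<in>F - {M}. card N = 2"
      | (triples) M M' where "M \<in> F" "M' \<in> F" "M \<noteq> M'" "card M = 3" "card M' = 3" "?X = \<Union>F"
        "\<forall>N\<in>F - {M, M'}. card N = 2"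
      by (rule surplus_2[OF finX F(1,2) g2 g4 e])
    then show ?thesis
    proof cases
      case (points z z')
      show ?thesis by (rule F8[of z z' F]) (use points cF in auto)
    next
      case (triple M z)
      note r = remove_block[OF finX F(1,2) triple(1)]
      have "\<exists>R. tournament_on (length [C3, one] + (2 * n - 2)) R \<and>
          sub_iso G ?X (lex_sum R ([C3, one] @ replicate (2 * n - 2) two))"
      proof (rule inner_form[of "F - {M}" "[M, {z}]"])
        have zM: "z \<notin> M" using triple by blast
        show "?X = \<Union>(set [M, {z}]) \<union> \<Union>(F - {M})" using triple(1,4) by auto
        show "list_all2 (sub_iso G) [M, {z}] [C3, one]" using sub_iso_C3 sub_iso_one F triple by simp
        show "card (F - {M}) = 2 * n - 2" using triple(1) cF by simp
        show "\<And>B. B \<in> set [M, {z}] \<Longrightarrow> disjnt B (\<Union>(F - {M}))"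
          using r(2) triple(3) by (auto simp: disjnt_iff)
        show "{} \<notin> set [M, {z}]" using triple(2) by auto
        show "distinct [M, {z}]" using zM by auto
        show "pairwise disjnt (set [M, {z}])" using zM by (auto simp: pairwise_def)
        show "\<And>B. B \<in> set [M, {z}] \<Longrightarrow> is_module G B" using mod[OF triple(1)] triple(3) singleton_module[of z] by auto
      qed (use r ge(1) triple mod in auto)
      moreover have "length [C3, one] + (2 * n - 2) = 2 * n" using n by simp
      ultimately show ?thesis using outer_three[OF s t st] by auto
    next
      case (triples M M')
      \<comment> \<open>Two different triples among \<open>2 * n - 1\<close> blocks force
        \<open>n \<ge> 2\<close>, the side condition of (F10).\<close>
      have "card {M, M'} \<le> card F" using triples ge(1) by (intro card_mono) auto
      then have n2: "2 \<le> n" using triples(3) cF by simp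
      have d: "disjnt A B" if "A \<in> F" "B \<in> F" "A \<noteq> B" for A B using F(2) that by (simp add: pairwise_def)
      have "\<exists>R. tournament_on (length [C3, C3] + (2 * n - 3)) R \<and>
          sub_iso G ?X (lex_sum R ([C3, C3] @ replicate (2 * n - 3) two))"
      proof (rule inner_form[of "F - {M, M'}" "[M, M']"])
        show "?X = \<Union>(set [M, M']) \<union> \<Union>(F - {M, M'})" using triples(1,2,6) by auto
        show "list_all2 (sub_iso G) [M, M'] [C3, C3]" using sub_iso_C3 F triples by simp
        show "card (F - {M, M'}) = 2 * n - 3" using triples cF by (simp add: card_Diff_subset)
        show "disjnt B (\<Union>(F - {M, M'}))" if "B \<in> set [M, M']" for B
        proof -
          have "disjnt B N" if "N \<in> F - {M, M'}" for N
            using d[of B N] that \<open>B \<in> set [M, M']\<close> triples(1,2) by auto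
          then show ?thesis by (auto simp: disjnt_iff)
        qed
        show "{} \<notin> set [M, M']" using triples(4,5) by auto
        show "pairwise disjnt (set [M, M'])" using d triples by (auto simp: pairwise_def)
        show "pairwise disjnt (F - {M, M'})" using F(2) by (rule pairwise_subset) auto
      qed (use ge(1) triples mod in auto)
      moreover have "length [C3, C3] + (2 * n - 3) = 2 * n - 1" using n2 by simp
      ultimately show ?thesis using outer_three[OF s t st] n2 by auto
    qed
  qed
qed

text \<open>All vertices lie in \<open>2 * n + 1\<close> pairs. If one pair is not a module, its
  complement is one, and both elements of the pair treat this complement uniformly. They do so in
  opposite ways, and only the cyclic arrangement survives.\<close>

lemma no_singleton_form:
  assumes n: "1 \<le> n" and V: "card V = 4 * n + 2"
    and F: "\<Union>F \<subseteq> V" "pairwise disjnt F" "\<forall>M\<in>F. 2 \<le> card M" "\<forall>M\<in>F. min_comodule G M"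
    and c: "2 * n + 1 \<le> card F"
  shows "(\<exists>R. tournament_on (2 * n + 1) R \<and> sub_iso G V (lex_sum R (replicate (2 * n + 1) two))) \<or>
    (\<exists>R. tournament_on (2 * n) R \<and> sub_iso G V (lex_sum C3 [one, one, lex_sum R (replicate (2 * n) two)]))"
proof -
  have finV: "finite V" using pair_finite_verts .
  note ge = card_Union_ge[OF finV F(1-3)]
  have cF: "card F = 2 * n + 1" using c ge(3) V by linarith
  then have "card V \<le> 2 * card F" using V by simp
  note s0 = surplus_0[OF finV F(1-3) this]
  show ?thesis
  proof (cases "\<forall>M\<in>F. nontrivial_module G M")
    case True
    then have mod: "is_module G M" if "M \<in> F" for M using that nontrivial_moduleD(1) by blast
    have "\<exists>R. tournament_on (2 * n + 1) R \<and> sub_iso G V (lex_sum R (replicate (2 * n + 1) two))"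
      using inner_form[of F "[]" "[]" V "2 * n + 1"] ge(1) F(2) s0 mod cF by simp
    then show ?thesis ..
  next
    case False
    then obtain M where M: "M \<in> F" "\<not> nontrivial_module G M" by blast
    have mc: "min_comodule G M" "2 \<le> card M" using F(3,4) M by blast+
    have nt: "nontrivial_module G N" if "N \<in> F - {M}" for N
      using compl_type_unique[OF mc(1) M(2) mc(2)] F(4) that by blast
    define K where "K = V - M"
    have MV: "M \<subseteq> V" using min_comoduleD(2)[OF mc(1)] .
    have ntK: "nontrivial_module G K" using mc M(2) by (auto simp: min_comodule_def comodule_def K_def)
    note k = nontrivial_moduleD[OF ntK]
    obtain k where kK: "k \<in> K" using k(2) by fastforce
    obtain a b where ab: "M = {a, b}" "a \<rhd> b"
    proof -
      have "card M = 2" using s0(1) M(1) by blast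
      then obtain a b where "M = {a, b}" "a \<noteq> b" using card_2_iff by metis
      then show ?thesis using that[of a b] that[of b a] arc_total[of a b] MV by auto
    qed
    have abV: "a \<in> V" "b \<in> V" "a \<notin> K" "b \<notin> K" "a \<noteq> b" using ab MV by (auto simp: K_def)
    have VK: "V = insert a (insert b K)" using ab MV by (auto simp: K_def)
    have uni: "x \<rhd> l \<longleftrightarrow> x \<rhd> k" if "x \<in> {a, b}" "l \<in> K" for x l
      using module_in[OF k(1), of x l k] that kK abV by blast
    have tot: "l \<rhd> x \<longleftrightarrow> \<not> x \<rhd> l" if "x \<in> {a, b}" "l \<in> K" for x l
    proof -
      have "x \<in> V" "l \<in> V" "x \<noteq> l" using that abV k(4) by blast+
      then show ?thesis using arc_total[of x l] by blast
    qed
    have "\<not> (a \<rhd> k \<longleftrightarrow> b \<rhd> k)"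
    proof
      assume *: "a \<rhd> k \<longleftrightarrow> b \<rhd> k"
      have "is_module G M"
      proof (rule is_moduleI)
        fix v x y assume v: "v \<in> V" "v \<notin> M" "x \<in> M" "y \<in> M" "v \<rhd> x"
        then have "v \<in> K" "x \<in> {a, b}" "y \<in> {a, b}" using ab by (auto simp: K_def)
        then show "v \<rhd> y" using tot[of x v] tot[of y v] uni[of x v] uni[of y v] * v(5) by blast
      qed (rule MV)
      then show False using M(2) mc(2) kK by (auto simp: nontrivial_module_def K_def)
    qed
    \<comment> \<open>As \<open>a\<close> also dominates \<open>b\<close>, it would be a source, and
      \<open>{a}\<close> a comodule smaller than \<open>M\<close>.\<close>
    moreover have "\<not> a \<rhd> k"
    proof
      assume "a \<rhd> k"
      then have "is_source a" using uni[of a] ab(2) VK abV by (auto simp: is_source_def)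
      then have "comodule G {a}" using is_source_comodule V n by simp
      then have "{a} = M" using min_comoduleD(5)[OF mc(1)] ab by blast
      then show False using ab(1) abV(5) by auto
    qed
    ultimately have arcs: "b \<rhd> l" "l \<rhd> a" if "l \<in> K" for l
      using uni[of a l] uni[of b l] tot[of a l] that by blast+
    note r = remove_block[OF finV F(1,2) M(1)]
    have "K = \<Union>(F - {M})" using s0(2) r(2) M(1) by (auto simp: K_def)
    then have "\<exists>R. tournament_on (2 * n) R \<and> sub_iso G K (lex_sum R (replicate (2 * n) two))"
      using inner_form[of "F - {M}" "[]" "[]" K "2 * n"] ge(1) r(3) s0 nt nontrivial_moduleD(1) cF M(1) by simp
    then obtain R where "tournament_on (2 * n) R" "sub_iso G K (lex_sum R (replicate (2 * n) two))" by auto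
    then show ?thesis using outer_C3[OF ab(2) VK abV(3,4) arcs] by blast
  qed
qed

end

theorem theorem6p3:
  fixes n :: nat and T :: "'a pair_pre_digraph"
  assumes "n \<ge> 1"
  shows "T \<in> delta_maximal (4 * n + 2) \<longleftrightarrow>
    (\<exists>R. tournament_on (2 * n + 1) R \<and>
       T \<simeq> lex_sum R (replicate (2 * n + 1) two)) \<or>
    (\<exists>R. tournament_on (2 * n) R \<and>
       T \<simeq> lex_sum C3 [one, one, lex_sum R (replicate (2 * n) two)]) \<or>
    (\<exists>R. tournament_on (2 * n + 1) R \<and>
       (let X = lex_sum two [one, lex_sum R (one # replicate (2 * n) two)]
        in T \<simeq> X \<or> T \<simeq> dual X)) \<or>
    (\<exists>R. tournament_on (2 * n) R \<and>
       (let X = lex_sum two [one, lex_sum R (C3 # replicate (2 * n - 1) two)]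
        in T \<simeq> X \<or> T \<simeq> dual X)) \<or>
    (\<exists>R. tournament_on (2 * n + 1) R \<and>
       T \<simeq> lex_sum three [one, lex_sum R (one # one # replicate (2 * n - 1) two), one]) \<or>
    (\<exists>R. tournament_on (2 * n) R \<and>
       T \<simeq> lex_sum three [one, lex_sum R (C3 # one # replicate (2 * n - 2) two), one]) \<or>
    (n \<ge> 2 \<and> (\<exists>R. tournament_on (2 * n - 1) R \<and>
       T \<simeq> lex_sum three [one, lex_sum R (C3 # C3 # replicate (2 * n - 3) two), one]))"
  (is "_ \<longleftrightarrow> ?F4 \<or> ?F5 \<or> ?F6 \<or> ?F7 \<or> ?F8 \<or> ?F9 \<or> ?F10")
proof -
  have full5: "saturated n (lex_sum C3 [one, one, lex_sum R (replicate (2 * n) two)])" if "tournament_on (2 * n) R" for R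
    using that assms by (intro saturated_C3) (auto simp: sum_list_replicate)
  have full6: "saturated n (lex_sum two [one, lex_sum R (one # replicate (2 * n) two)])" if "tournament_on (2 * n + 1) R" for R
    using that assms by (intro saturated_two) (auto simp: sum_list_replicate)
  have full7: "saturated n (lex_sum two [one, lex_sum R (C3 # replicate (2 * n - 1) two)])" if "tournament_on (2 * n) R" for R
    using that assms by (intro saturated_two) (auto simp: sum_list_replicate)
  have full8: "saturated n (lex_sum three [one, lex_sum R (one # one # replicate (2 * n - 1) two), one])"
    if "tournament_on (2 * n + 1) R" for R
    using that assms by (intro saturated_three) (auto simp: sum_list_replicate)
  have full9: "saturated n (lex_sum three [one, lex_sum R (C3 # one # replicate (2 * n - 2) two), one])"
    if "tournament_on (2 * n) R" for R
  proof -
    have "Suc (Suc (2 * n - 2)) = 2 * n" using assms by simp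
    then show ?thesis using that assms by (intro saturated_three) (auto simp: sum_list_replicate)
  qed
  have full10: "saturated n (lex_sum three [one, lex_sum R (C3 # C3 # replicate (2 * n - 3) two), one])"
    if "tournament_on (2 * n - 1) R" "2 \<le> n" for R
  proof -
    have "Suc (Suc (2 * n - 3)) = 2 * n - 1" using that by simp
    then show ?thesis using that by (intro saturated_three) (auto simp: sum_list_replicate)
  qed
  note fulls = saturated_F4[OF _ assms] full5 full6 full7 full8 full9 full10
  note max = saturated_imp_delta_maximal[OF _ assms]
  show ?thesis
  proof
    assume "?F4 \<or> ?F5 \<or> ?F6 \<or> ?F7 \<or> ?F8 \<or> ?F9 \<or> ?F10"
    then consider ?F4 | ?F5 | ?F6 | ?F7 | ?F8 | ?F9 | ?F10 by blast
    then show "T \<in> delta_maximal (4 * n + 2)"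
    proof cases
      case 1
      then show ?thesis using max fulls(1) by blast
    next
      case 2
      then show ?thesis using max fulls(2) by blast
    next
      case 3
      then show ?thesis using max fulls(3) saturated_dual unfolding Let_def by blast
    next
      case 4
      then show ?thesis using max fulls(4) saturated_dual unfolding Let_def by blast
    next
      case 5
      then show ?thesis using max fulls(5) by blast
    next
      case 6
      then show ?thesis using max fulls(6) by blast
    next
      case 7
      then show ?thesis using max fulls(7) by blast
    qed
  next
    assume T: "T \<in> delta_maximal (4 * n + 2)"
    then interpret tournament T by (simp add: delta_maximal_def)
    have c: "card V = 4 * n + 2" and d: "decomposability_index T = n + 1"
      using T max_decomposability_index_eq[OF assms] by (auto simp: delta_maximal_def)
    have V6: "6 \<le> card V" and V3: "3 \<le> card V" using c assms by simp_all
    obtain D r where D: "canonical T D r" using ex_canonical by blast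
    have "n + 1 \<le> (card D + 1) div 2" using decomposability_index_le_canonical[OF V6 D] d by simp
    \<comment> \<open>With \<open>card D = 2 * n\<close> the division would yield only
      \<open>n\<close>.\<close>
    then have cD: "2 * n + 1 \<le> card D" by linarith
    have wf: "pair_wf_digraph H" if "saturated n H" for H :: "nat pair_pre_digraph"
    proof -
      interpret H: tournament H using that by (simp add: saturated_def)
      show ?thesis by (rule H.pair_wf_digraph)
    qed
    have iso: "T \<simeq> H" if "saturated n H" "sub_iso T V H" for H :: "nat pair_pre_digraph"
      using isomorphicI[OF pair_wf_digraph wf[OF that(1)] that(2)] .
    have iso_dual: "T \<simeq> dual H" if "saturated n H" "sub_iso (dual T) V H" for H :: "nat pair_pre_digraph"
      using iso[OF saturated_dual[OF that(1)]] that(2) by (simp add: sub_iso_dual)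
    show "?F4 \<or> ?F5 \<or> ?F6 \<or> ?F7 \<or> ?F8 \<or> ?F9 \<or> ?F10"
    proof (rule canonical_split[OF D V3])
      fix D1 F
      assume F: "\<Union>F \<subseteq> V - \<Union>D1" "pairwise disjnt F" "\<forall>M\<in>F. 2 \<le> card M" "\<forall>M\<in>F. min_comodule T M"
        and nt: "D1 \<noteq> {} \<longrightarrow> (\<forall>M\<in>F. nontrivial_module T M)"
        and cc: "card D = card D1 + card F"
        and D1: "D1 = {} \<or> (\<exists>s. D1 = {{s}} \<and> (is_source s \<or> is_sink s)) \<or>
          (\<exists>s t. D1 = {{s}, {t}} \<and> s \<noteq> t \<and> is_source s \<and> is_sink t)"
      \<comment> \<open>Without singletons, at least \<open>2 * n + 1\<close> blocks remain for (F4)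
        and (F5); with one, at least \<open>2 * n\<close> for (F6) and (F7); with two, at least
        \<open>2 * n - 1\<close> for (F8) to (F10).\<close>
      consider "D1 = {}" | s where "D1 = {{s}}" "is_source s" | t where "D1 = {{t}}" "is_sink t"
        | s t where "D1 = {{s}, {t}}" "s \<noteq> t" "is_source s" "is_sink t"
        using D1 by blast
      then show ?thesis
      proof cases
        case 1
        have "?F4 \<or> ?F5"
          using no_singleton_form[OF assms c _ F(2-4)] F(1) cc cD 1 iso fulls(1,2) by auto
        then show ?thesis by blast
      next
        case (2 s)
        have "\<Union>F \<subseteq> V - {s}" "2 * n \<le> card F" "\<forall>M\<in>F. nontrivial_module T M" using F(1) cc cD 2 nt by auto
        then have "?F6 \<or> ?F7"
          using source_form[OF assms c 2(2) _ F(2,4)] iso fulls(3,4) unfolding Let_def by blast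
        then show ?thesis by blast
      next
        case (3 t)
        have h: "\<Union>F \<subseteq> V - {t}" "2 * n \<le> card F" "\<forall>M\<in>F. nontrivial_module T M" using F(1) cc cD 3 nt by auto
        \<comment> \<open>A sink is a source of the dual; \<open>iso_dual\<close> turns the form
          found there into the dual form for \<open>T\<close>.\<close>
        have "(\<exists>R. tournament_on (2 * n + 1) R \<and>
            sub_iso (dual T) V (lex_sum two [one, lex_sum R (one # replicate (2 * n) two)])) \<or>
          (\<exists>R. tournament_on (2 * n) R \<and>
            sub_iso (dual T) V (lex_sum two [one, lex_sum R (C3 # replicate (2 * n - 1) two)]))"
          using tournament.source_form[OF tournament_dual assms, of t F] c 3 h F(2,4)
          by (simp add: is_source_dual min_comodule_dual nontrivial_module_dual)
        then have "?F6 \<or> ?F7" using iso_dual fulls(3,4) unfolding Let_def by blast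
        then show ?thesis by blast
      next
        case (4 s t)
        have "card D1 = 2" using 4 by simp
        then have h: "\<Union>F \<subseteq> V - {s, t}" "2 * n - 1 \<le> card F" "\<forall>M\<in>F. nontrivial_module T M"
          using F(1) cc cD 4 nt by auto
        have "?F8 \<or> ?F9 \<or> ?F10"
          using source_sink_form[OF assms c 4(3,4,2) h(1) F(2,4) h(3,2)] iso fulls(5-7) by blast
        then show ?thesis by blast
      qed
    qed
  qed
qed

end
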